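(* Let $1\le q<\infty$, $1<p<\infty$ and $1\le r\le\min\{p,q\}$. Let $\Omega\subset\mathbb{R}^N$ be open. For every pair of non-negative functions $v,w\in X^{q,p}(\Omega)$ set $\sigma^t=((1-t)v^r+t\,w^r)^{1/r}$ for $t\in[0,1]$. Then $\sigma^t\in X^{q,p}(\Omega)$ and \[ \int_\Omega|\nabla\sigma^t|^p\,dx\le(1-t)\int_\Omega|\nabla v|^p\,dx+t\int_\Omega|\nabla w|^p\,dx\qquad\text{for every }t\in[0,1]. \] Moreover, when $\Omega$ is connected: (a) if $1=r<p$, equality holds for some $t\in(0,1)$ if and only if $v=w+C$ for some $C\in\mathbb{R}$; (b) if $1<r<p$, equality holds for some $t\in(0,1)$ if and only if either $v=w$ or $v$ and $w$ are both constant; (c) if $1<r=p$ and in addition $1/v\in L^\infty_{\rm loc}(\Omega)$ and $1/w\in L^\infty_{\rm loc}(\Omega)$, equality holds for some $t\in(0,1)$ if and only if $v=C\,w$ for some $C>0$.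
   Context: $X^{q,p}(\Omega)=\{\psi\in L^q(\Omega):\nabla\psi\in L^p(\Omega;\mathbb{R}^N)\}$ with weak gradients. *)

theory Defs
  imports "HOL-Analysis.Analysis"
begin

fun Ck_on :: "nat \<Rightarrow> 'a::euclidean_space set \<Rightarrow> ('a \<Rightarrow> real) \<Rightarrow> bool" where
  "Ck_on 0 S f = continuous_on S f"
| "Ck_on (Suc k) S f =
     (continuous_on S f \<and>
      (\<exists>Df. (\<forall>x\<in>S. (f has_derivative (\<lambda>h. Df x \<bullet> h)) (at x)) \<and>
            (\<forall>i\<in>Basis. Ck_on k S (\<lambda>x. Df x \<bullet> i))))"

definition smooth_on :: "'a::euclidean_space set \<Rightarrow> ('a \<Rightarrow> real) \<Rightarrow> bool" where
  "smooth_on S f \<longleftrightarrow> (\<forall>k. Ck_on k S f)"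

definition test_fun :: "'a::euclidean_space set \<Rightarrow> ('a \<Rightarrow> real) \<Rightarrow> bool" where
  "test_fun \<Omega> \<phi> \<longleftrightarrow> smooth_on UNIV \<phi> \<and> compact (closure {x. \<phi> x \<noteq> 0})
      \<and> closure {x. \<phi> x \<noteq> 0} \<subseteq> \<Omega>"

definition loc_integrable :: "'a::euclidean_space set \<Rightarrow> ('a \<Rightarrow> 'b::{banach,second_countable_topology}) \<Rightarrow> bool" where
  "loc_integrable \<Omega> f \<longleftrightarrow> (\<forall>K. compact K \<and> K \<subseteq> \<Omega> \<longrightarrow> integrable (lebesgue_on K) f)"

definition weak_grad :: "'a::euclidean_space set \<Rightarrow> ('a \<Rightarrow> real) \<Rightarrow> ('a \<Rightarrow> 'a) \<Rightarrow> bool" where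
  "weak_grad \<Omega> \<psi> g \<longleftrightarrow> loc_integrable \<Omega> \<psi> \<and> loc_integrable \<Omega> g \<and>
     (\<forall>\<phi> D\<phi>. test_fun \<Omega> \<phi> \<and> (\<forall>x. (\<phi> has_derivative (\<lambda>h. D\<phi> x \<bullet> h)) (at x)) \<longrightarrow>
        (\<forall>i\<in>Basis. (\<integral>x. \<psi> x * (D\<phi> x \<bullet> i) \<partial>lebesgue_on \<Omega>)
                   = - (\<integral>x. (g x \<bullet> i) * \<phi> x \<partial>lebesgue_on \<Omega>)))"

definition Lp_real :: "real \<Rightarrow> 'a::euclidean_space set \<Rightarrow> ('a \<Rightarrow> real) \<Rightarrow> bool" where
  "Lp_real p \<Omega> f \<longleftrightarrow> f \<in> borel_measurable (lebesgue_on \<Omega>) \<and>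
     integrable (lebesgue_on \<Omega>) (\<lambda>x. \<bar>f x\<bar> powr p)"

definition Lp_vec :: "real \<Rightarrow> 'a::euclidean_space set \<Rightarrow> ('a \<Rightarrow> 'a) \<Rightarrow> bool" where
  "Lp_vec p \<Omega> g \<longleftrightarrow> g \<in> borel_measurable (lebesgue_on \<Omega>) \<and>
     integrable (lebesgue_on \<Omega>) (\<lambda>x. norm (g x) powr p)"

definition Xqp :: "real \<Rightarrow> real \<Rightarrow> 'a::euclidean_space set \<Rightarrow> ('a \<Rightarrow> real) set" where
  "Xqp q p \<Omega> = {\<psi>. Lp_real q \<Omega> \<psi> \<and> (\<exists>g. weak_grad \<Omega> \<psi> g \<and> Lp_vec p \<Omega> g)}"

definition energy :: "real \<Rightarrow> 'a::euclidean_space set \<Rightarrow> ('a \<Rightarrow> 'a) \<Rightarrow> real" where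
  "energy p \<Omega> g = (\<integral>x. norm (g x) powr p \<partial>lebesgue_on \<Omega>)"

definition inv_Linf_loc :: "'a::euclidean_space set \<Rightarrow> ('a \<Rightarrow> real) \<Rightarrow> bool" where
  "inv_Linf_loc \<Omega> v \<longleftrightarrow> (\<forall>K. compact K \<and> K \<subseteq> \<Omega> \<longrightarrow>
     (\<exists>M. AE x in lebesgue_on K. v x \<noteq> 0 \<and> \<bar>1 / v x\<bar> \<le> M))"

definition interp :: "real \<Rightarrow> ('a \<Rightarrow> real) \<Rightarrow> ('a \<Rightarrow> real) \<Rightarrow> real \<Rightarrow> 'a \<Rightarrow> real" where
  "interp r v w t x = ((1 - t) * v x powr r + t * w x powr r) powr (1 / r)"

end

theory Submission
  imports Defs
begin

text \<open>
  Away from its zeros the interpolation \<open>\<sigma> = ((1 - t) v^r + t w^r)^(1/r)\<close> satisfies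
  \<open>\<nabla>\<sigma> / \<sigma> = (1 - m) \<nabla>v / v + m \<nabla>w / w\<close> with the weight \<open>m = t w^r / \<sigma>^r\<close>. Convexity of the \<open>r\<close>-th power
  of the norm gives \<open>|\<nabla>\<sigma>|^r \<le> (1 - t) |\<nabla>v|^r + t |\<nabla>w|^r\<close>, and convexity of the power \<open>p / r\<close>
  then gives the inequality pointwise almost everywhere. The formula for \<open>\<nabla>\<sigma>\<close> comes from the chain rule
  for the regularisation \<open>(\<epsilon> + (1 - t) |v|^r + t |w|^r)^(1/r)\<close>, a continuously differentiable function of \<open>(v, w)\<close> with
  partial derivatives bounded by 1 uniformly in \<open>\<epsilon>\<close>, so that dominated convergence applies as \<open>\<epsilon> \<rightarrow> 0\<close>.

  Equality of the energies forces equality almost everywhere in both convexity inequalities: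
  for \<open>r > 1\<close> the logarithmic gradients \<open>\<nabla>v / v\<close> and \<open>\<nabla>w / w\<close> agree where \<open>v, w > 0\<close>, and for
  \<open>r < p\<close> the norms \<open>|\<nabla>v|\<close> and \<open>|\<nabla>w|\<close> agree. If \<open>1 < r < p\<close>, then at almost every point
  \<open>v = w\<close> or both gradients vanish, hence \<open>\<nabla>v = \<nabla>w\<close> and \<open>v - w\<close> is constant; if that constant is not 0,
  both gradients vanish throughout. If \<open>r = p\<close>, then \<open>ln v - ln w\<close> is constant.
\<close>

section \<open>Smooth functions and bump functions\<close>

text \<open>The energies are stated for an arbitrary weak gradient of the interpolation, so both
  existence, through an explicit candidate, and uniqueness almost everywhere are needed; uniqueness,
  constancy under a vanishing gradient and the chain rule all rest on mollification with an explicit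
  smooth kernel. The case \<open>r = 1\<close> is linear and is kept apart: there equality is
  decided by strict convexity of the power \<open>p\<close> of the norm alone. For
  \<open>r > 1\<close> the obstacle is that the root, as a function of \<open>v\<close> and
  \<open>w\<close>, is not smooth where its base vanishes, although its partial derivatives stay
  bounded; the added \<epsilon> keeps the base positive, and absolute values extend the formula to
  the whole plane, where the chain rule is stated. On the zero sets of \<open>v\<close> and
  \<open>w\<close> the logarithmic gradients say nothing; case (b) is closed there because a weak
  gradient vanishes almost everywhere on the zero set of its function, a fact applied to
  \<open>v\<close>, \<open>w\<close> and \<open>v - w\<close>. In case (c) the local bounds on
  \<open>1 / v\<close> and \<open>1 / w\<close> make \<open>ln v\<close> and \<open>ln w\<close>
  locally integrable, with the logarithmic gradients as their weak gradients.\<close>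

lemma Ck_on_SucD: "Ck_on (Suc k) S f \<Longrightarrow> Ck_on k S f"
proof (induction k arbitrary: f)
  case (Suc k)
  then show ?case
    by (metis Ck_on.simps(2))
qed simp

lemma Ck_on_const: "Ck_on k S (\<lambda>x. c)"
proof (induction k arbitrary: c)
  case (Suc k)
  have "((\<lambda>x. c) has_derivative (\<lambda>h. 0 \<bullet> h)) (at x)" for x :: 'a
    by (simp add: inner_zero_left[abs_def])
  moreover have "Ck_on k S (\<lambda>x. 0 \<bullet> i)" for i :: 'a
    using Suc by simp
  ultimately show ?case
    unfolding Ck_on.simps by (intro conjI exI[of _ "\<lambda>_. 0"] ballI continuous_on_const)
qed simp

lemma Ck_on_add:
  assumes "Ck_on k S f" "Ck_on k S g"
  shows "Ck_on k S (\<lambda>x. f x + g x)"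
  using assms
proof (induction k arbitrary: f g)
  case (Suc k)
  obtain F G where F: "\<forall>x\<in>S. (f has_derivative (\<lambda>h. F x \<bullet> h)) (at x)" "\<forall>i\<in>Basis. Ck_on k S (\<lambda>x. F x \<bullet> i)"
    and G: "\<forall>x\<in>S. (g has_derivative (\<lambda>h. G x \<bullet> h)) (at x)" "\<forall>i\<in>Basis. Ck_on k S (\<lambda>x. G x \<bullet> i)"
    using Suc.prems by auto
  show ?case
    unfolding Ck_on.simps
  proof (intro conjI exI[of _ "\<lambda>x. F x + G x"] ballI)
    show "continuous_on S (\<lambda>x. f x + g x)"
      using Suc.prems by (auto intro!: continuous_intros)
    show "((\<lambda>x. f x + g x) has_derivative (\<lambda>h. (F x + G x) \<bullet> h)) (at x)" if "x \<in> S" for x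
      using F(1) G(1) that by (auto intro!: derivative_eq_intros simp: inner_add_left)
    show "Ck_on k S (\<lambda>x. (F x + G x) \<bullet> i)" if "i \<in> Basis" for i
      using F(2) G(2) that Suc.IH by (auto simp: inner_add_left)
  qed
qed (auto intro!: continuous_intros)

lemma Ck_on_mult:
  assumes "Ck_on k S f" "Ck_on k S g"
  shows "Ck_on k S (\<lambda>x. f x * g x)"
  using assms
proof (induction k arbitrary: f g)
  case (Suc k)
  obtain F G where F: "\<forall>x\<in>S. (f has_derivative (\<lambda>h. F x \<bullet> h)) (at x)" "\<forall>i\<in>Basis. Ck_on k S (\<lambda>x. F x \<bullet> i)"
    and G: "\<forall>x\<in>S. (g has_derivative (\<lambda>h. G x \<bullet> h)) (at x)" "\<forall>i\<in>Basis. Ck_on k S (\<lambda>x. G x \<bullet> i)"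
    using Suc.prems by auto
  have fg: "Ck_on k S f" "Ck_on k S g"
    using Suc.prems Ck_on_SucD by blast+
  show ?case
    unfolding Ck_on.simps
  proof (intro conjI exI[of _ "\<lambda>x. f x *\<^sub>R G x + g x *\<^sub>R F x"] ballI)
    show "continuous_on S (\<lambda>x. f x * g x)"
      using Suc.prems by (auto intro!: continuous_intros)
    show "((\<lambda>x. f x * g x) has_derivative (\<lambda>h. (f x *\<^sub>R G x + g x *\<^sub>R F x) \<bullet> h)) (at x)" if "x \<in> S" for x
      using F(1) G(1) that by (auto intro!: derivative_eq_intros simp: inner_add_left)
    show "Ck_on k S (\<lambda>x. (f x *\<^sub>R G x + g x *\<^sub>R F x) \<bullet> i)" if "i \<in> Basis" for i
      using F(2) G(2) that Suc.IH fg by (auto simp: inner_add_left intro!: Ck_on_add)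
  qed
qed (auto intro!: continuous_intros)

lemma Ck_on_inner_left: "Ck_on k S (\<lambda>x. (x - a) \<bullet> i)"
proof (cases k)
  case (Suc k')
  have "\<forall>x\<in>S. ((\<lambda>x. (x - a) \<bullet> i) has_derivative (\<lambda>h. i \<bullet> h)) (at x)"
    by (auto intro!: derivative_eq_intros simp: inner_commute)
  then show ?thesis unfolding Suc Ck_on.simps
    by (intro conjI exI[of _ "\<lambda>_. i"]) (auto intro!: continuous_intros Ck_on_const)
qed (auto intro!: continuous_intros)

text \<open>The family \<open>bump_profile m\<close> spans a space closed under differentiation, so smoothness of
  the bump functions follows by induction on the order of differentiability for all \<open>m\<close> at once.\<close>

definition bump_profile :: "nat \<Rightarrow> real \<Rightarrow> real" where
  "bump_profile m s = (if 0 < s then exp (- (1 / s)) / s ^ m else 0)"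

lemma bump_profile_nonneg: "0 \<le> bump_profile m s"
  by (simp add: bump_profile_def)

text \<open>A single term of the exponential series at \<open>1 / s\<close> bounds
  \<open>exp (1 / s)\<close> from below, so the profile vanishes at 0 to every order
  \<open>n\<close>. Order 2 is what makes it differentiable there.\<close>

lemma bump_profile_le: "bump_profile m s \<le> fact (m + n) * \<bar>s\<bar> ^ n"
proof (cases "0 < s")
  case True
  have "(1 / s) ^ (m + n) / fact (m + n) \<le> exp (1 / s)"
  proof -
    have "(\<lambda>k. (1 / s) ^ k /\<^sub>R fact k) sums exp (1 / s)" by (rule exp_converges)
    then have "sum (\<lambda>k. (1 / s) ^ k /\<^sub>R fact k) {m + n} \<le> exp (1 / s)"
      using True sum_le_suminf[of "\<lambda>k. (1 / s) ^ k /\<^sub>R fact k" "{m + n}"] by (simp add: sums_iff)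
    then show ?thesis by (simp add: divide_inverse mult.commute)
  qed
  then have "exp (- (1 / s)) \<le> fact (m + n) * s ^ (m + n)"
    using True by (simp add: exp_minus field_simps)
  then show ?thesis
    using True by (simp add: bump_profile_def field_simps power_add)
qed (simp add: bump_profile_def)

text \<open>For positive \<open>s\<close> the quotient rule returns two other members of the family;
  at 0 the quadratic bound beats the division by the increment.\<close>

lemma bump_profile_has_derivative:
  "(bump_profile m has_real_derivative
     (bump_profile (m + 2) s - real m * bump_profile (m + 1) s)) (at s)"
proof -
  consider "s < 0" | "s = 0" | "s > 0" by linarith
  then show ?thesis
  proof cases
    case 1
    then have "\<forall>\<^sub>F x in nhds s. bump_profile m x = 0"
      using eventually_nhds_in_open[of "{..<0}" s] by (auto elim!: eventually_mono simp: bump_profile_def)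
    then have "(bump_profile m has_real_derivative 0) (at s)"
      by (subst DERIV_cong_ev[OF refl _ refl]) auto
    with 1 show ?thesis by (simp add: bump_profile_def)
  next
    case 2
    have "((\<lambda>h. bump_profile m h / h) \<longlongrightarrow> 0) (at 0)"
    proof (rule Lim_null_comparison)
      show "\<forall>\<^sub>F h in at 0. norm (bump_profile m h / h) \<le> fact (m + 2) * \<bar>h\<bar>"
      proof (rule always_eventually, rule allI)
        show "norm (bump_profile m h / h) \<le> fact (m + 2) * \<bar>h\<bar>" for h
          using bump_profile_le[of m h 2] bump_profile_nonneg[of m h]
          by (cases "h = 0") (simp_all add: divide_le_eq power2_eq_square mult.assoc del: fact_Suc abs_mult_self_eq)
      qed
      show "((\<lambda>h. fact (m + 2) * \<bar>h\<bar>) \<longlongrightarrow> (0::real)) (at 0)"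
        by (auto intro!: tendsto_eq_intros)
    qed
    with 2 show ?thesis
      by (simp add: DERIV_def) (simp add: bump_profile_def)
  next
    case 3
    have "((\<lambda>s. exp (- (1 / s)) / s ^ m) has_real_derivative
        exp (- (1 / s)) / s ^ (m + 2) - real m * (exp (- (1 / s)) / s ^ (m + 1))) (at s)"
    proof -
      have "(exp (- (1 / s)) * (1 / s\<^sup>2) * s ^ m - exp (- (1 / s)) * (real m * s ^ (m - 1))) / (s ^ m * s ^ m)
        = exp (- (1 / s)) / s ^ (m + 2) - real m * (exp (- (1 / s)) / s ^ (m + 1))"
        using 3 by (cases m) (simp_all add: field_simps power2_eq_square)
      then show ?thesis
        using 3 by (auto intro!: derivative_eq_intros simp: power2_eq_square)
    qed
    moreover have "\<forall>\<^sub>F x in nhds s. bump_profile m x = exp (- (1 / x)) / x ^ m"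
      using eventually_nhds_in_open[of "{0<..}" s] 3 by (auto elim!: eventually_mono simp: bump_profile_def)
    ultimately have "(bump_profile m has_real_derivative
        exp (- (1 / s)) / s ^ (m + 2) - real m * (exp (- (1 / s)) / s ^ (m + 1))) (at s)"
      by (subst DERIV_cong_ev[OF refl _ refl])
    with 3 show ?thesis by (simp add: bump_profile_def)
  qed
qed

lemma continuous_on_bump_profile: "continuous_on A (bump_profile m)"
  by (meson DERIV_continuous bump_profile_has_derivative continuous_at_imp_continuous_on)

text \<open>Chain rule for the radial function with profile \<open>bump_profile m\<close>. All
  \<open>m\<close> are kept because differentiating a component again leads to other members of the
  family.\<close>

definition bump_grad :: "nat \<Rightarrow> real \<Rightarrow> 'a::euclidean_space \<Rightarrow> 'a" where
  "bump_grad m e z = (- 2 * (bump_profile (m + 2) (e\<^sup>2 - z \<bullet> z)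
       - real m * bump_profile (m + 1) (e\<^sup>2 - z \<bullet> z))) *\<^sub>R z"

lemma bump_has_derivative:
  "((\<lambda>y::'a::euclidean_space. bump_profile m (e\<^sup>2 - (y - a) \<bullet> (y - a)))
      has_derivative (\<lambda>h. bump_grad m e (y - a) \<bullet> h)) (at y)"
proof -
  have "((\<lambda>y. e\<^sup>2 - (y - a) \<bullet> (y - a)) has_derivative (\<lambda>h. - 2 * ((y - a) \<bullet> h))) (at y)"
    by (auto intro!: derivative_eq_intros simp: inner_commute)
  from has_derivative_compose[OF this bump_profile_has_derivative[THEN has_field_derivative_imp_has_derivative]]
  show ?thesis
    by (simp add: bump_grad_def algebra_simps)
qed

lemma Ck_on_bump:
  "Ck_on k UNIV (\<lambda>y::'a::euclidean_space. bump_profile m (e\<^sup>2 - (y - a) \<bullet> (y - a)))"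
proof (induction k arbitrary: m)
  case 0
  show ?case
    by (auto intro!: continuous_intros continuous_on_compose2[OF continuous_on_bump_profile[of UNIV]])
next
  case (Suc k)
  show ?case
    unfolding Ck_on.simps
  proof (intro conjI exI[of _ "\<lambda>y. bump_grad m e (y - a)"] ballI)
    show "continuous_on UNIV (\<lambda>y::'a. bump_profile m (e\<^sup>2 - (y - a) \<bullet> (y - a)))"
      by (auto intro!: continuous_intros continuous_on_compose2[OF continuous_on_bump_profile[of UNIV]])
    have eq: "bump_grad m e (y - a) \<bullet> i = (- 2 * (bump_profile (m + 2) (e\<^sup>2 - (y - a) \<bullet> (y - a))
       + (- real m) * bump_profile (m + 1) (e\<^sup>2 - (y - a) \<bullet> (y - a)))) * ((y - a) \<bullet> i)" for y i :: 'a
      by (simp add: bump_grad_def)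
    show "Ck_on k UNIV (\<lambda>y. bump_grad m e (y - a) \<bullet> i)" for i :: 'a
      unfolding eq by (intro Ck_on_mult Ck_on_add Ck_on_const Ck_on_inner_left Suc.IH)
  qed (rule bump_has_derivative)
qed

text \<open>The classical bump \<open>exp (- 1 / (e^2 - |z|^2))\<close>, extended by 0 outside the
  ball of radius \<open>e\<close>.\<close>

definition ball_bump :: "real \<Rightarrow> 'a::euclidean_space \<Rightarrow> real" where
  "ball_bump e z = bump_profile 0 (e\<^sup>2 - z \<bullet> z)"

lemma ball_bump_eq_0: "0 < e \<Longrightarrow> e \<le> norm z \<Longrightarrow> ball_bump e z = 0"
  by (simp add: ball_bump_def bump_profile_def power2_norm_eq_inner[symmetric] not_less power_mono)

lemma bump_grad_eq_0: "0 < e \<Longrightarrow> e \<le> norm z \<Longrightarrow> bump_grad m e z = 0"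
proof -
  assume "0 < e" "e \<le> norm z"
  then have "\<not> 0 < e\<^sup>2 - z \<bullet> z"
    by (simp add: power2_norm_eq_inner[symmetric] power_mono not_less)
  then show ?thesis
    unfolding bump_grad_def bump_profile_def by (simp only: if_False) simp
qed

lemma ball_bump_pos: "norm z < e \<Longrightarrow> 0 < ball_bump e z"
  by (simp add: ball_bump_def bump_profile_def power2_norm_eq_inner[symmetric] power_strict_mono)

lemma ball_bump_nonneg: "0 \<le> ball_bump e z"
  by (simp add: ball_bump_def bump_profile_nonneg)

lemma ball_bump_minus: "ball_bump e (- z) = ball_bump e z"
  by (simp add: ball_bump_def)

lemma bump_grad_minus: "bump_grad m e (- z) = - bump_grad m e z"
  by (simp add: bump_grad_def)

lemma continuous_on_ball_bump: "continuous_on A (ball_bump e)"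
  unfolding ball_bump_def
  by (auto intro!: continuous_intros continuous_on_compose2[OF continuous_on_bump_profile[of UNIV]])

lemma continuous_on_bump_grad: "continuous_on A (bump_grad m e)"
  unfolding bump_grad_def
  by (auto intro!: continuous_intros continuous_on_compose2[OF continuous_on_bump_profile[of UNIV]])

lemma test_fun_ball_bump:
  assumes "0 < e" "cball a e \<subseteq> \<Omega>"
  shows "test_fun \<Omega> (\<lambda>y. ball_bump e (y - a))"
proof -
  have "{y. ball_bump e (y - a) \<noteq> 0} \<subseteq> cball a e"
    using ball_bump_eq_0[OF assms(1)] by (force simp: dist_norm norm_minus_commute)
  then have "closure {y. ball_bump e (y - a) \<noteq> 0} \<subseteq> cball a e"
    by (simp add: closure_minimal)
  moreover from this have "compact (closure {y. ball_bump e (y - a) \<noteq> 0})"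
    by (metis bounded_cball bounded_subset closed_closure compact_eq_bounded_closed)
  ultimately show ?thesis
    using assms(2) Ck_on_bump[of _ 0 e a] by (auto simp: test_fun_def smooth_on_def ball_bump_def)
qed

section \<open>Gradients and supports of test functions\<close>

lemma test_fun_continuous: "test_fun \<Omega> \<phi> \<Longrightarrow> continuous_on UNIV \<phi>"
  by (metis Ck_on.simps(1) smooth_on_def test_fun_def)

text \<open>Weak gradients are tested against any derivative field of \<phi>. Smoothness supplies
  some continuous field, and uniqueness of the derivative identifies \<open>D\<close> with
  it.\<close>

lemma test_fun_grad:
  assumes \<phi>: "test_fun \<Omega> \<phi>" and D: "\<And>x. (\<phi> has_derivative (\<lambda>h. D x \<bullet> h)) (at x)"
  shows "continuous_on UNIV D" "x \<notin> closure {x. \<phi> x \<noteq> 0} \<Longrightarrow> D x = 0"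
proof -
  have "Ck_on (Suc 0) UNIV \<phi>"
    using \<phi> by (simp add: smooth_on_def test_fun_def)
  then obtain E where E: "\<And>x. (\<phi> has_derivative (\<lambda>h. E x \<bullet> h)) (at x)"
      "\<And>i. i \<in> Basis \<Longrightarrow> continuous_on UNIV (\<lambda>x. E x \<bullet> i)"
    by auto
  have "D x = E x" for x
  proof -
    have "D x \<bullet> h = E x \<bullet> h" for h
      using fun_cong[OF has_derivative_unique[OF D E(1), of x], of h] .
    then have "(D x - E x) \<bullet> (D x - E x) = 0"
      by (simp only: inner_diff_left)
    then show ?thesis by simp
  qed
  then have "D = E" by blast
  then show "continuous_on UNIV D"
    using E(2) continuous_on_componentwise[of UNIV E] by blast
  show "D x = 0" if "x \<notin> closure {x. \<phi> x \<noteq> 0}"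
  proof -
    let ?U = "- closure {x. \<phi> x \<noteq> 0}"
    have "open ?U" by (rule open_Compl[OF closed_closure])
    moreover have "x \<in> ?U" using that by blast
    moreover have "0 = \<phi> y" if "y \<in> ?U" for y
      using that subsetD[OF closure_subset, of y "{x. \<phi> x \<noteq> 0}"] by (metis ComplD mem_Collect_eq)
    ultimately have "(\<phi> has_derivative (\<lambda>h. 0)) (at x)"
      by (rule has_derivative_transform_within_open[OF has_derivative_const])
    from fun_cong[OF has_derivative_unique[OF D this], of "D x"]
    show ?thesis by (simp only: inner_eq_zero_iff)
  qed
qed

section \<open>Continuity of translations in L1\<close>

lemma integrable_lborel_compact_support:
  fixes f :: "'a::euclidean_space \<Rightarrow> real"
  assumes "continuous_on UNIV f" "compact K" "\<And>x. x \<notin> K \<Longrightarrow> f x = 0"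
  shows "integrable lborel f"
proof -
  have "integrable lborel (\<lambda>x. indicator K x *\<^sub>R f x)"
    by (rule borel_integrable_compact[unfolded set_integrable_def]) (use assms in \<open>auto intro: continuous_on_subset\<close>)
  moreover have "(\<lambda>x. indicator K x *\<^sub>R f x) = f"
    using assms(3) by (auto simp: indicator_def of_bool_def)
  ultimately show ?thesis by simp
qed

lemma bounded_compact_support:
  fixes f :: "'a::euclidean_space \<Rightarrow> 'b::real_normed_vector"
  assumes "continuous_on UNIV f" "compact K" "\<And>x. x \<notin> K \<Longrightarrow> f x = 0"
  obtains B where "0 < B" "\<And>x. norm (f x) \<le> B"
proof -
  have "bounded (f ` K)"
    using assms by (intro compact_imp_bounded compact_continuous_image) (auto intro: continuous_on_subset)
  then obtain B where "0 < B" "\<And>x. x \<in> K \<Longrightarrow> norm (f x) \<le> B"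
    unfolding bounded_pos by auto
  with assms(3) that show ?thesis
    by (metis less_imp_le norm_zero)
qed

section \<open>Invariance of integrals under translation and reflection\<close>

lemma integrable_translation_iff:
  fixes f :: "'a::euclidean_space \<Rightarrow> 'b::{banach, second_countable_topology}"
  shows "integrable lborel (\<lambda>x. f (c + x)) \<longleftrightarrow> integrable lborel f"
proof -
  have *: "integrable lborel (\<lambda>x. g (b + x))" if "integrable lborel g" for g :: "'a \<Rightarrow> 'b" and b
  proof (subst integrable_distr_eq[symmetric, of "(+) b" lborel borel g])
    show "g \<in> borel_measurable borel"
      using borel_measurable_integrable[OF that] by simp
  qed (use that in \<open>simp_all add: lborel_distr_plus\<close>)
  show ?thesis
    using *[of f c] *[of "\<lambda>x. f (c + x)" "- c"] by auto
qed

lemma integral_translation: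
  fixes f :: "'a::euclidean_space \<Rightarrow> 'b::{banach, second_countable_topology}"
  assumes "f \<in> borel_measurable borel"
  shows "(\<integral>x. f (c + x) \<partial>lborel) = (\<integral>x. f x \<partial>lborel)"
  using integral_distr[of "(+) c" lborel borel f] assms by (simp add: lborel_distr_plus)

lemma nn_integral_translation:
  fixes f :: "'a::euclidean_space \<Rightarrow> ennreal"
  assumes "f \<in> borel_measurable borel"
  shows "(\<integral>\<^sup>+x. f (c + x) \<partial>lborel) = (\<integral>\<^sup>+x. f x \<partial>lborel)"
  using nn_integral_distr[of "(+) c" lborel borel f] assms by (simp add: lborel_distr_plus)

lemma lborel_distr_uminus_euclidean:
  "distr lborel borel uminus = (lborel :: 'a::euclidean_space measure)"
  by (subst lborel_affine[of "-1" 0]) (auto simp: density_1 one_ennreal_def[symmetric])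

lemma integral_reflection:
  fixes f :: "'a::euclidean_space \<Rightarrow> 'b::{banach, second_countable_topology}"
  assumes f: "f \<in> borel_measurable borel"
  shows "(\<integral>z. f (x - z) \<partial>lborel) = (\<integral>y. f y \<partial>lborel)"
proof -
  have "(\<integral>z. f (x - z) \<partial>lborel) = (\<integral>z. f (x + z) \<partial>lborel)"
    using integral_distr[of "uminus" lborel borel "\<lambda>z. f (x + z)"] f by (simp add: lborel_distr_uminus_euclidean)
  then show ?thesis using f integral_translation by metis
qed

lemma integrable_reflection:
  fixes f :: "'a::euclidean_space \<Rightarrow> 'b::{banach, second_countable_topology}"
  assumes f: "integrable lborel f"
  shows "integrable lborel (\<lambda>z. f (x - z))"
proof -
  have "integrable lborel (\<lambda>z. f (x + z))"
    using f integrable_translation_iff by blast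
  moreover have "(\<lambda>z. f (x + z)) \<in> borel_measurable borel"
    using borel_measurable_integrable[OF f] by simp
  ultimately show ?thesis
    using integrable_distr_eq[of "uminus" lborel borel "\<lambda>z. f (x + z)"] by (simp add: lborel_distr_uminus_euclidean)
qed

text \<open>Valued in \<open>ennreal\<close>, so that subadditivity and the exchange of integrals
  require measurability only.\<close>

abbreviation L1_modulus :: "('a::euclidean_space \<Rightarrow> real) \<Rightarrow> 'a \<Rightarrow> ennreal" where
  "L1_modulus f h \<equiv> (\<integral>\<^sup>+x. ennreal \<bar>f (x - h) - f x\<bar> \<partial>lborel)"

text \<open>A closed inner approximation is cut off by growing balls; as \<open>A\<close> has finite
  measure, continuity from above makes the excess converge to that of the closed set.\<close>

lemma inner_regular_lborel_compact:
  fixes A :: "'a::euclidean_space set"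
  assumes A: "A \<in> sets borel" "emeasure lborel A < \<infinity>" and "0 < e"
  obtains K where "compact K" "K \<subseteq> A" "emeasure lborel (A - K) < ennreal e"
proof -
  have "A \<in> sets lebesgue" using A by simp
  moreover have "0 < e / 2" using \<open>0 < e\<close> by simp
  ultimately obtain T where T: "closed T" "T \<subseteq> A" "emeasure lebesgue (A - T) < ennreal (e / 2)"
    by (rule sets_lebesgue_inner_closed)
  have [measurable]: "T \<in> sets borel" "A \<in> sets borel" using T A by auto
  define C where "C n = T \<inter> cball 0 (real n)" for n
  have C: "C n \<in> sets lborel" for n by (simp add: C_def)
  have "decseq (\<lambda>n. A - C n)"
    unfolding C_def decseq_def by (intro allI impI Diff_mono Int_mono subset_cball) auto
  moreover have "emeasure lborel (A - C n) \<noteq> \<infinity>" for n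
    using A emeasure_mono[of "A - C n" A lborel] by (auto simp: top_unique)
  ultimately have "(\<lambda>n. emeasure lborel (A - C n)) \<longlonglongrightarrow> emeasure lborel (\<Inter>n. A - C n)"
    using A C by (intro Lim_emeasure_decseq) auto
  moreover have "(\<Inter>n. A - C n) = A - T"
    using real_arch_simple by (auto simp: C_def)
  moreover have "emeasure lborel (A - T) < ennreal e"
  proof -
    have "emeasure lborel (A - T) < ennreal (e / 2)" using T(3) by simp
    also have "\<dots> \<le> ennreal e" using \<open>0 < e\<close> by (simp add: ennreal_leI)
    finally show ?thesis .
  qed
  ultimately have "\<forall>\<^sub>F n in sequentially. emeasure lborel (A - C n) < ennreal e"
    by (metis order_tendstoD(2))
  then obtain n where "emeasure lborel (A - C n) < ennreal e"
    by (meson eventually_happens' sequentially_bot)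
  moreover have "compact (C n)" "C n \<subseteq> A"
    using T by (auto simp: C_def closed_Int_compact)
  ultimately show ?thesis using that by blast
qed

lemma L1_modulus_add:
  assumes [measurable]: "f \<in> borel_measurable borel" "g \<in> borel_measurable borel"
  shows "L1_modulus (\<lambda>x. f x + g x) h \<le> L1_modulus f h + L1_modulus g h"
proof -
  have "L1_modulus (\<lambda>x. f x + g x) h \<le> (\<integral>\<^sup>+x. ennreal \<bar>f (x - h) - f x\<bar> + ennreal \<bar>g (x - h) - g x\<bar> \<partial>lborel)"
    by (intro nn_integral_mono) (auto simp: ennreal_plus[symmetric] simp del: ennreal_plus intro!: ennreal_leI)
  then show ?thesis by (simp add: nn_integral_add)
qed

lemma L1_modulus_le:
  assumes [measurable]: "f \<in> borel_measurable borel"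
  shows "L1_modulus f h \<le> 2 * (\<integral>\<^sup>+x. ennreal \<bar>f x\<bar> \<partial>lborel)"
proof -
  have "L1_modulus f h \<le> (\<integral>\<^sup>+x. ennreal \<bar>f (- h + x)\<bar> + ennreal \<bar>f x\<bar> \<partial>lborel)"
    by (intro nn_integral_mono) (auto simp: ennreal_plus[symmetric] simp del: ennreal_plus intro!: ennreal_leI)
  also have "\<dots> = (\<integral>\<^sup>+x. ennreal \<bar>f x\<bar> \<partial>lborel) + (\<integral>\<^sup>+x. ennreal \<bar>f x\<bar> \<partial>lborel)"
    using nn_integral_translation[of "\<lambda>x. ennreal \<bar>f x\<bar>" "- h"] by (subst nn_integral_add) auto
  finally show ?thesis by (simp add: mult_2)
qed

text \<open>With \<open>K\<close> compact inside \<open>A\<close> and \<open>U\<close> open around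
  \<open>K\<close>, a shift shorter than the margin between \<open>K\<close> and the complement of
  \<open>U\<close> alters the indicator of \<open>K\<close> only on \<open>U - K\<close> and its
  translate. The remainder \<open>A - K\<close> costs at most twice its norm.\<close>

lemma L1_modulus_indicator:
  fixes A :: "'a::euclidean_space set"
  assumes A[measurable]: "A \<in> sets borel" and fin: "emeasure lborel A < \<infinity>" and "0 < e"
  obtains d where "0 < d" "\<And>h. norm h < d \<Longrightarrow> L1_modulus (\<lambda>x. indicator A x * c) h \<le> ennreal e"
proof -
  \<comment> \<open>Each of the two pieces will contribute \<open>2 * (\<bar>c\<bar> * e')\<close>,
    hence the 4; the added 1 keeps the quotient meaningful for \<open>c = 0\<close>.\<close>
  define e' where "e' = e / (4 * (\<bar>c\<bar> + 1))"
  have e': "0 < e'" "4 * (\<bar>c\<bar> * e') \<le> e"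
    using \<open>0 < e\<close> by (auto simp: e'_def field_simps)
  obtain K where K: "compact K" "K \<subseteq> A" "emeasure lborel (A - K) < ennreal e'"
    using inner_regular_lborel_compact[OF A fin e'(1)] by blast
  have Kb[measurable]: "K \<in> sets borel" using K by (simp add: borel_compact)
  obtain U where U: "open U" "K \<subseteq> U" "emeasure lborel (U - K) < ennreal e'"
    using outer_regular_lborel[OF Kb e'(1)] by blast
  have [measurable]: "U \<in> sets borel" using U by simp
  obtain d where d: "0 < d" "(\<Union>x\<in>K. ball x d) \<subseteq> U"
    using compact_subset_open_imp_ball_epsilon_subset[OF K(1) U(1,2)] by blast
  have K1: "L1_modulus (\<lambda>x. indicator K x * c) h \<le> ennreal (2 * (\<bar>c\<bar> * e'))" if h: "norm h < d" for h
  proof -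
    let ?g = "\<lambda>x. indicator (U - K) x :: ennreal"
    have "ennreal \<bar>indicator K (x - h) * c - indicator K x * c\<bar> \<le> ennreal \<bar>c\<bar> * (?g (- h + x) + ?g x)" for x
    proof -
      have "x - h \<in> K \<Longrightarrow> x \<in> U" "x \<in> K \<Longrightarrow> x - h \<in> U"
        using d(2) h by (auto simp: dist_norm intro!: subsetD[OF d(2)] bexI)
      then show ?thesis by (auto simp: indicator_def)
    qed
    then have "L1_modulus (\<lambda>x. indicator K x * c) h \<le> (\<integral>\<^sup>+x. ennreal \<bar>c\<bar> * (?g (- h + x) + ?g x) \<partial>lborel)"
      by (intro nn_integral_mono)
    also have "\<dots> = ennreal \<bar>c\<bar> * (emeasure lborel (U - K) + emeasure lborel (U - K))"
      using nn_integral_translation[of ?g "- h"] by (simp add: nn_integral_cmult nn_integral_add)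
    also have "\<dots> \<le> ennreal \<bar>c\<bar> * (ennreal e' + ennreal e')"
      using U(3) by (intro mult_left_mono add_mono) auto
    also have "\<dots> = ennreal (2 * (\<bar>c\<bar> * e'))"
      using e'(1) by (simp add: ennreal_plus[symmetric] ennreal_mult[symmetric] algebra_simps del: ennreal_plus)
    finally show ?thesis .
  qed
  have K2: "L1_modulus (\<lambda>x. indicator (A - K) x * c) h \<le> ennreal (2 * (\<bar>c\<bar> * e'))" for h
  proof -
    have "L1_modulus (\<lambda>x. indicator (A - K) x * c) h \<le> 2 * (\<integral>\<^sup>+x. ennreal \<bar>indicator (A - K) x * c\<bar> \<partial>lborel)"
      by (rule L1_modulus_le) measurable
    also have "(\<integral>\<^sup>+x. ennreal \<bar>indicator (A - K) x * c\<bar> \<partial>lborel) = (\<integral>\<^sup>+x. ennreal \<bar>c\<bar> * indicator (A - K) x \<partial>lborel)"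
      by (intro nn_integral_cong) (simp add: indicator_def)
    also have "\<dots> = ennreal \<bar>c\<bar> * emeasure lborel (A - K)"
      by (simp add: nn_integral_cmult)
    also have "2 * (ennreal \<bar>c\<bar> * emeasure lborel (A - K)) \<le> 2 * (ennreal \<bar>c\<bar> * ennreal e')"
      using K(3) by (intro mult_left_mono) auto
    also have "\<dots> = ennreal (2 * (\<bar>c\<bar> * e'))"
      using e'(1) by (simp add: ennreal_mult)
    finally show ?thesis .
  qed
  have "L1_modulus (\<lambda>x. indicator A x * c) h \<le> ennreal e" if "norm h < d" for h
  proof -
    have *: "indicator A x * c = indicator K x * c + indicator (A - K) x * c" for x
      using K(2) by (auto simp: indicator_def)
    have "L1_modulus (\<lambda>x. indicator A x * c) h
        \<le> L1_modulus (\<lambda>x. indicator K x * c) h + L1_modulus (\<lambda>x. indicator (A - K) x * c) h"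
      unfolding * by (rule L1_modulus_add) measurable
    also have "\<dots> \<le> ennreal (2 * (\<bar>c\<bar> * e')) + ennreal (2 * (\<bar>c\<bar> * e'))"
      using K1[OF that] K2 by (rule add_mono)
    also have "\<dots> = ennreal (4 * (\<bar>c\<bar> * e'))"
      using e'(1) by (simp add: ennreal_plus[symmetric] del: ennreal_plus)
    also have "\<dots> \<le> ennreal e"
      using e'(2) by (rule ennreal_leI)
    finally show ?thesis .
  qed
  with d(1) that show ?thesis by blast
qed

text \<open>Induction over integrable functions: indicators, sums, dominated limits. In the limit
  case the approximation error enters with twice its norm, so it is made smaller than
  \<open>e / 4\<close>, and \<open>e / 2\<close> is left for the approximant.\<close>

lemma L1_modulus_tendsto_0:
  fixes f :: "'a::euclidean_space \<Rightarrow> real"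
  assumes "integrable lborel f" "0 < e"
  obtains d where "0 < d" "\<And>h. norm h < d \<Longrightarrow> L1_modulus f h \<le> ennreal e"
proof -
  have "\<forall>e>0. \<exists>d>0. \<forall>h. norm h < d \<longrightarrow> L1_modulus f h \<le> ennreal e"
    using assms(1)
  proof (induction rule: integrable_induct)
    case (base A c)
    show ?case
    proof (intro allI impI)
      fix e :: real assume "0 < e"
      with base show "\<exists>d>0. \<forall>h. norm h < d \<longrightarrow> L1_modulus (\<lambda>x. indicator A x *\<^sub>R c) h \<le> ennreal e"
        using L1_modulus_indicator[of A e c] by auto
    qed
  next
    case (add f g)
    show ?case
    proof (intro allI impI)
      fix e :: real assume "0 < e"
      then have "0 < e / 2" by simp
      with add.IH(1) obtain d1 where d1: "0 < d1" "\<And>h. norm h < d1 \<Longrightarrow> L1_modulus f h \<le> ennreal (e / 2)"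
        by blast
      from \<open>0 < e / 2\<close> add.IH(2) obtain d2 where d2: "0 < d2" "\<And>h. norm h < d2 \<Longrightarrow> L1_modulus g h \<le> ennreal (e / 2)"
        by blast
      have fg: "f \<in> borel_measurable borel" "g \<in> borel_measurable borel"
        using add.hyps by (auto dest: borel_measurable_integrable)
      have "L1_modulus (\<lambda>x. f x + g x) h \<le> ennreal e" if "norm h < min d1 d2" for h
      proof -
        have "L1_modulus (\<lambda>x. f x + g x) h \<le> ennreal (e / 2) + ennreal (e / 2)"
          using that by (intro order_trans[OF L1_modulus_add[OF fg]] add_mono d1 d2) simp_all
        then show ?thesis
          using \<open>0 < e\<close> by (simp add: ennreal_plus[symmetric] del: ennreal_plus)
      qed
      with d1(1) d2(1) show "\<exists>d>0. \<forall>h. norm h < d \<longrightarrow> L1_modulus (\<lambda>x. f x + g x) h \<le> ennreal e"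
        by (intro exI[of _ "min d1 d2"]) auto
    qed
  next
    case (lim f s)
    have ms[measurable]: "\<And>i. s i \<in> borel_measurable borel" and mf[measurable]: "f \<in> borel_measurable borel"
      using lim.hyps by (auto dest: borel_measurable_integrable)
    show ?case
    proof (intro allI impI)
      fix e :: real assume "0 < e"
      have "(\<lambda>i. \<integral>\<^sup>+x. ennreal (norm (f x - s i x)) \<partial>lborel) \<longlonglongrightarrow> 0"
      proof (rule nn_integral_dominated_convergence_norm[where w = "\<lambda>x. 2 * norm (f x)"])
        show "(\<integral>\<^sup>+x. ennreal (2 * norm (f x)) \<partial>lborel) < \<infinity>"
          using lim.hyps integrable_iff_bounded[of lborel "\<lambda>x. 2 * f x"] by (simp add: abs_mult)
      qed (use lim.hyps in auto)
      then have "\<forall>\<^sub>F i in sequentially. (\<integral>\<^sup>+x. ennreal (norm (f x - s i x)) \<partial>lborel) < ennreal (e / 4)"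
        using \<open>0 < e\<close> by (intro order_tendstoD(2)) auto
      then obtain i where i: "(\<integral>\<^sup>+x. ennreal (norm (f x - s i x)) \<partial>lborel) < ennreal (e / 4)"
        by (meson eventually_happens' sequentially_bot)
      obtain d where d: "0 < d" "\<And>h. norm h < d \<Longrightarrow> L1_modulus (s i) h \<le> ennreal (e / 2)"
        using lim.IH[of i] \<open>0 < e\<close> half_gt_zero[of e] by blast
      have "L1_modulus f h \<le> ennreal e" if "norm h < d" for h
      proof -
        have "L1_modulus (\<lambda>x. s i x + (f x - s i x)) h \<le> L1_modulus (s i) h + L1_modulus (\<lambda>x. f x - s i x) h"
          by (rule L1_modulus_add) measurable
        then have "L1_modulus f h \<le> L1_modulus (s i) h + L1_modulus (\<lambda>x. f x - s i x) h" by simp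
        also have "\<dots> \<le> ennreal (e / 2) + 2 * ennreal (e / 4)"
        proof (rule add_mono[OF d(2)[OF that]])
          have "L1_modulus (\<lambda>x. f x - s i x) h \<le> 2 * (\<integral>\<^sup>+x. ennreal \<bar>f x - s i x\<bar> \<partial>lborel)"
            by (rule L1_modulus_le) measurable
          also have "\<dots> \<le> 2 * ennreal (e / 4)"
            using i by (intro mult_left_mono) auto
          finally show "L1_modulus (\<lambda>x. f x - s i x) h \<le> 2 * ennreal (e / 4)" .
        qed
        also have "\<dots> = ennreal e"
        proof -
          have "2 * ennreal (e / 4) = ennreal (e / 2)"
            using \<open>0 < e\<close> ennreal_mult[of 2 "e / 4"] by simp
          then show ?thesis
            using \<open>0 < e\<close> by (simp only: ennreal_plus[symmetric]) simp
        qed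
        finally show ?thesis .
      qed
      with d(1) show "\<exists>d>0. \<forall>h. norm h < d \<longrightarrow> L1_modulus f h \<le> ennreal e" by blast
    qed
  qed
  with assms(2) that show ?thesis by blast
qed

section \<open>Mollification\<close>

lemma convolution_continuous:
  fixes f k :: "'a::euclidean_space \<Rightarrow> real"
  assumes f: "integrable lborel f" and k: "continuous_on UNIV k" "\<And>z. \<bar>k z\<bar> \<le> B"
  shows "continuous_on UNIV (\<lambda>x. \<integral>y. f y * k (x - y) \<partial>lborel)"
proof (rule continuous_at_imp_continuous_on, rule ballI)
  have fm[measurable]: "f \<in> borel_measurable borel" and km[measurable]: "k \<in> borel_measurable borel"
    using f k(1) by (auto dest: borel_measurable_integrable borel_measurable_continuous_onI)
  show "isCont (\<lambda>x. \<integral>y. f y * k (x - y) \<partial>lborel) x" for x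
    unfolding continuous_at_sequentially o_def
  proof (intro allI impI)
    fix X assume X: "X \<longlonglongrightarrow> x"
    show "(\<lambda>n. \<integral>y. f y * k (X n - y) \<partial>lborel) \<longlonglongrightarrow> (\<integral>y. f y * k (x - y) \<partial>lborel)"
    proof (rule integral_dominated_convergence[where w = "\<lambda>y. \<bar>f y\<bar> * B"])
      show "AE y in lborel. (\<lambda>n. f y * k (X n - y)) \<longlonglongrightarrow> f y * k (x - y)"
        by (intro AE_I2 tendsto_intros isCont_tendsto_compose[where g = k] X)
           (use k(1) in \<open>simp add: continuous_on_eq_continuous_at\<close>)
      show "AE y in lborel. norm (f y * k (X n - y)) \<le> \<bar>f y\<bar> * B" for n
        using k(2) by (auto simp: abs_mult intro!: mult_left_mono)
    qed (use f in auto)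
  qed
qed

text \<open>Differentiation under the integral along one line: the mean value theorem bounds the
  difference quotients of the kernel by \<open>B\<close>, which provides the dominating function
  \<open>\<bar>f y\<bar> * B\<close>. Derivatives along lines are all that is used later, so real
  derivatives suffice.\<close>

lemma convolution_has_derivative:
  fixes f k dk :: "'a::euclidean_space \<Rightarrow> real"
  assumes f: "integrable lborel f"
    and k: "continuous_on UNIV k" "\<And>z. \<bar>k z\<bar> \<le> C"
    and dk: "continuous_on UNIV dk" "\<And>z. \<bar>dk z\<bar> \<le> B"
    and D: "\<And>z s. ((\<lambda>s. k (z + s *\<^sub>R h)) has_real_derivative dk (z + s *\<^sub>R h)) (at s)"
  shows "((\<lambda>s. \<integral>y. f y * k (x + s *\<^sub>R h - y) \<partial>lborel) has_real_derivative
      (\<integral>y. f y * dk (x + s *\<^sub>R h - y) \<partial>lborel)) (at s)"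
proof -
  have fm[measurable]: "f \<in> borel_measurable borel" and km[measurable]: "k \<in> borel_measurable borel"
    and dkm[measurable]: "dk \<in> borel_measurable borel"
    using f k(1) dk(1) by (auto dest: borel_measurable_integrable borel_measurable_continuous_onI)
  define K where "K s y = f y * k (x + s *\<^sub>R h - y)" for s y
  have int: "integrable lborel (K s)" for s
    unfolding K_def
    by (rule Bochner_Integration.integrable_bound[where f = "\<lambda>y. f y * C"])
       (use f k(2) in \<open>auto simp: abs_mult intro!: mult_left_mono order_trans[OF k(2) abs_ge_self]\<close>)
  have "(\<lambda>\<sigma>. ((\<integral>y. K (s + \<sigma>) y \<partial>lborel) - (\<integral>y. K s y \<partial>lborel)) / \<sigma>) \<midarrow>0\<rightarrow> (\<integral>y. f y * dk (x + s *\<^sub>R h - y) \<partial>lborel)"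
    \<comment> \<open>Dominated convergence is a statement about sequences, so the limit at 0 is
      tested along sequences of nonzero increments.\<close>
    unfolding LIMSEQ_SEQ_conv[symmetric]
  proof (intro allI impI, elim conjE)
    fix \<sigma> :: "nat \<Rightarrow> real" assume \<sigma>: "\<forall>n. \<sigma> n \<noteq> 0" "\<sigma> \<longlonglongrightarrow> 0"
    have "(\<lambda>n. \<integral>y. (K (s + \<sigma> n) y - K s y) / \<sigma> n \<partial>lborel) \<longlonglongrightarrow> (\<integral>y. f y * dk (x + s *\<^sub>R h - y) \<partial>lborel)"
    proof (rule integral_dominated_convergence[where w = "\<lambda>y. \<bar>f y\<bar> * B"])
      show "AE y in lborel. (\<lambda>n. (K (s + \<sigma> n) y - K s y) / \<sigma> n) \<longlonglongrightarrow> f y * dk (x + s *\<^sub>R h - y)"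
      proof (rule AE_I2)
        fix y
        have "((\<lambda>s. k ((x - y) + s *\<^sub>R h)) has_real_derivative dk ((x - y) + s *\<^sub>R h)) (at s)"
          by (rule D)
        then have "(\<lambda>\<sigma>. (k ((x - y) + (s + \<sigma>) *\<^sub>R h) - k ((x - y) + s *\<^sub>R h)) / \<sigma>) \<midarrow>0\<rightarrow> dk ((x - y) + s *\<^sub>R h)"
          by (simp add: DERIV_def)
        with \<sigma> have "(\<lambda>n. (k ((x - y) + (s + \<sigma> n) *\<^sub>R h) - k ((x - y) + s *\<^sub>R h)) / \<sigma> n) \<longlonglongrightarrow> dk ((x - y) + s *\<^sub>R h)"
          unfolding LIMSEQ_SEQ_conv[symmetric] by blast
        then have "(\<lambda>n. f y * ((k ((x - y) + (s + \<sigma> n) *\<^sub>R h) - k ((x - y) + s *\<^sub>R h)) / \<sigma> n)) \<longlonglongrightarrow> f y * dk ((x - y) + s *\<^sub>R h)"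
          by (intro tendsto_intros)
        then show "(\<lambda>n. (K (s + \<sigma> n) y - K s y) / \<sigma> n) \<longlonglongrightarrow> f y * dk (x + s *\<^sub>R h - y)"
          by (simp add: K_def algebra_simps)
      qed
      show "AE y in lborel. norm ((K (s + \<sigma> n) y - K s y) / \<sigma> n) \<le> \<bar>f y\<bar> * B" for n
      proof (rule AE_I2)
        fix y
        have "norm (k ((x - y) + (s + \<sigma> n) *\<^sub>R h) - k ((x - y) + s *\<^sub>R h)) \<le> B * norm ((s + \<sigma> n) - s)"
          by (rule field_differentiable_bound[where S = UNIV]) (use D dk(2) in auto)
        then have "\<bar>f y\<bar> * norm (k ((x - y) + (s + \<sigma> n) *\<^sub>R h) - k ((x - y) + s *\<^sub>R h)) \<le> \<bar>f y\<bar> * (B * \<bar>\<sigma> n\<bar>)"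
          by (intro mult_left_mono) auto
        moreover have "K (s + \<sigma> n) y - K s y = f y * (k ((x - y) + (s + \<sigma> n) *\<^sub>R h) - k ((x - y) + s *\<^sub>R h))"
          by (simp add: K_def algebra_simps)
        ultimately show "norm ((K (s + \<sigma> n) y - K s y) / \<sigma> n) \<le> \<bar>f y\<bar> * B"
          using \<sigma>(1) by (simp add: abs_mult divide_le_eq mult.assoc)
      qed
    qed (use f int in \<open>auto intro!: borel_measurable_integrable\<close>)
    then show "(\<lambda>n. ((\<integral>y. K (s + \<sigma> n) y \<partial>lborel) - (\<integral>y. K s y \<partial>lborel)) / \<sigma> n) \<longlonglongrightarrow> (\<integral>y. f y * dk (x + s *\<^sub>R h - y) \<partial>lborel)"
      using int by (simp add: Bochner_Integration.integral_diff)
  qed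
  then show ?thesis
    by (simp add: DERIV_def K_def)
qed

section \<open>The normalised kernel and convolution with it\<close>

lemma integrable_ball_bump:
  assumes "0 < e"
  shows "integrable lborel (ball_bump e :: 'a::euclidean_space \<Rightarrow> real)"
  by (rule integrable_lborel_compact_support[where K = "cball 0 e"])
     (use assms in \<open>auto intro!: continuous_on_ball_bump ball_bump_eq_0\<close>)

lemma integral_ball_bump_pos:
  assumes "0 < e"
  shows "0 < (\<integral>z. ball_bump e (z::'a::euclidean_space) \<partial>lborel)"
proof (rule ccontr)
  assume "\<not> 0 < (\<integral>z. ball_bump e (z::'a) \<partial>lborel)"
  moreover have "0 \<le> (\<integral>z. ball_bump e (z::'a) \<partial>lborel)"
    by (simp add: ball_bump_nonneg)
  ultimately have "(\<integral>z. ball_bump e (z::'a) \<partial>lborel) = 0" by linarith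
  moreover have "integrable lborel (ball_bump e :: 'a \<Rightarrow> real)"
    by (rule integrable_ball_bump[OF assms])
  ultimately have "AE z::'a in lborel. ball_bump e z = 0"
    using integral_nonneg_eq_0_iff_AE[of lborel "ball_bump e :: 'a \<Rightarrow> real"] by (simp add: ball_bump_nonneg)
  then have "AE z::'a in lborel. z \<notin> ball 0 e"
    by eventually_elim (use ball_bump_pos in fastforce)
  then have "emeasure lborel (ball 0 e :: 'a set) = 0"
    by (subst (asm) AE_iff_measurable[OF _ refl]) (auto simp: ball_def)
  then have "measure lborel (ball 0 e :: 'a set) = 0"
    by (simp add: measure_def)
  then show False
    using content_ball_pos[OF assms, of "0::'a"] by simp
qed

definition mollifier :: "real \<Rightarrow> 'a::euclidean_space \<Rightarrow> real" where
  "mollifier e z = ball_bump e z / (\<integral>z. ball_bump e (z::'a) \<partial>lborel)"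

definition mollifier_grad :: "real \<Rightarrow> 'a::euclidean_space \<Rightarrow> 'a" where
  "mollifier_grad e z = bump_grad 0 e z /\<^sub>R (\<integral>z. ball_bump e (z::'a) \<partial>lborel)"

lemma mollifier_nonneg: "0 \<le> mollifier e z"
  by (simp add: mollifier_def ball_bump_nonneg)

lemma mollifier_eq_0: "0 < e \<Longrightarrow> e \<le> norm z \<Longrightarrow> mollifier e z = 0"
  by (simp add: mollifier_def ball_bump_eq_0)

lemma continuous_on_mollifier: "continuous_on A (mollifier e)"
  unfolding mollifier_def divide_inverse by (intro continuous_intros continuous_on_ball_bump)

lemma continuous_on_mollifier_grad: "continuous_on A (\<lambda>z. mollifier_grad e z \<bullet> h)"
  unfolding mollifier_grad_def by (intro continuous_intros continuous_on_bump_grad)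

lemma mollifier_bounded:
  assumes "0 < e"
  obtains B where "\<And>z::'a::euclidean_space. \<bar>mollifier e z\<bar> \<le> B"
proof -
  have "z \<notin> cball 0 e \<Longrightarrow> mollifier e z = 0" for z :: 'a
    using assms by (simp add: mollifier_eq_0)
  from bounded_compact_support[OF continuous_on_mollifier compact_cball this]
  obtain B where "\<And>z::'a. norm (mollifier e z) \<le> B" by blast
  then show ?thesis using that[of B] by simp
qed

lemma mollifier_grad_bounded:
  assumes "0 < e"
  obtains B where "\<And>z::'a::euclidean_space. \<bar>mollifier_grad e z \<bullet> h\<bar> \<le> B"
proof -
  have "z \<notin> cball 0 e \<Longrightarrow> mollifier_grad e z \<bullet> h = 0" for z :: 'a
    using assms by (simp add: mollifier_grad_def bump_grad_eq_0)
  from bounded_compact_support[OF continuous_on_mollifier_grad compact_cball this]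
  obtain B where "\<And>z::'a. norm (mollifier_grad e z \<bullet> h) \<le> B" by blast
  then show ?thesis using that[of B] by simp
qed

lemma integrable_mollifier: "0 < e \<Longrightarrow> integrable lborel (mollifier e :: 'a::euclidean_space \<Rightarrow> real)"
  unfolding mollifier_def[abs_def] by (intro integrable_divide integrable_ball_bump) auto

lemma integral_mollifier: "0 < e \<Longrightarrow> (\<integral>z. mollifier e (z::'a::euclidean_space) \<partial>lborel) = 1"
  using integral_ball_bump_pos[of e, where 'a = 'a] by (simp add: mollifier_def)

lemma mollifier_has_derivative:
  "((\<lambda>s. mollifier e (z + s *\<^sub>R h)) has_real_derivative (mollifier_grad e (z + s *\<^sub>R h) \<bullet> h)) (at s)"
proof -
  have "((\<lambda>y. ball_bump e y) has_derivative (\<lambda>h. bump_grad 0 e (z + s *\<^sub>R h') \<bullet> h)) (at (z + s *\<^sub>R h'))" for h'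
    using bump_has_derivative[of 0 e 0 "z + s *\<^sub>R h'"] by (simp add: ball_bump_def)
  moreover have "((\<lambda>s. z + s *\<^sub>R h) has_derivative (\<lambda>s. s *\<^sub>R h)) (at s)"
    by (auto intro!: derivative_eq_intros)
  ultimately have "((\<lambda>s. ball_bump e (z + s *\<^sub>R h)) has_derivative (\<lambda>t. bump_grad 0 e (z + s *\<^sub>R h) \<bullet> (t *\<^sub>R h))) (at s)"
    using has_derivative_compose by blast
  then have "((\<lambda>s. ball_bump e (z + s *\<^sub>R h)) has_real_derivative bump_grad 0 e (z + s *\<^sub>R h) \<bullet> h) (at s)"
    by (simp add: has_field_derivative_def mult.commute[of _ "bump_grad 0 e (z + s *\<^sub>R h) \<bullet> h"])
  then show ?thesis
    unfolding mollifier_def mollifier_grad_def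
    by (auto intro!: derivative_eq_intros simp: divide_inverse)
qed

definition mollify :: "real \<Rightarrow> ('a::euclidean_space \<Rightarrow> real) \<Rightarrow> 'a \<Rightarrow> real" where
  "mollify e f x = (\<integral>y. f y * mollifier e (x - y) \<partial>lborel)"

text \<open>The derivative falls on the kernel, so this is defined for every integrable
  \<open>f\<close>. Agreement with the mollified weak derivative is a separate matter and holds only
  at points whose kernel ball stays inside the region where \<open>f\<close> is a true copy of the
  function.\<close>

definition mollify_deriv :: "real \<Rightarrow> ('a::euclidean_space \<Rightarrow> real) \<Rightarrow> 'a \<Rightarrow> 'a \<Rightarrow> real" where
  "mollify_deriv e f h x = (\<integral>y. f y * (mollifier_grad e (x - y) \<bullet> h) \<partial>lborel)"

lemma continuous_on_mollify:
  assumes "0 < e" "integrable lborel f"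
  shows "continuous_on UNIV (mollify e f)"
proof -
  obtain B where "\<And>z::'a. \<bar>mollifier e z\<bar> \<le> B" using mollifier_bounded[OF assms(1)] by blast
  then show ?thesis
    unfolding mollify_def[abs_def] by (rule convolution_continuous[OF assms(2) continuous_on_mollifier])
qed

lemma continuous_on_mollify_deriv:
  assumes "0 < e" "integrable lborel f"
  shows "continuous_on UNIV (mollify_deriv e f h)"
proof -
  obtain B where "\<And>z::'a. \<bar>mollifier_grad e z \<bullet> h\<bar> \<le> B" using mollifier_grad_bounded[OF assms(1)] by blast
  then show ?thesis
    unfolding mollify_deriv_def[abs_def] by (rule convolution_continuous[OF assms(2) continuous_on_mollifier_grad])
qed

lemma mollify_has_derivative:
  assumes "0 < e" "integrable lborel f"
  shows "((\<lambda>s. mollify e f (x + s *\<^sub>R h)) has_real_derivative mollify_deriv e f h (x + s *\<^sub>R h)) (at s)"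
proof -
  obtain B where "\<And>z::'a. \<bar>mollifier e z\<bar> \<le> B" using mollifier_bounded[OF assms(1)] by blast
  moreover obtain C where "\<And>z::'a. \<bar>mollifier_grad e z \<bullet> h\<bar> \<le> C" using mollifier_grad_bounded[OF assms(1)] by blast
  ultimately show ?thesis
    unfolding mollify_def mollify_deriv_def
    by (intro convolution_has_derivative[OF assms(2) continuous_on_mollifier _ continuous_on_mollifier_grad _ mollifier_has_derivative])
qed

text \<open>Since the kernel has mass 1, the error at \<open>x\<close> is an average of the
  differences \<open>f (x - z) - f x\<close>. Exchanging the integrals bounds its norm by the same
  average of moduli, over shifts shorter than \<open>e\<close>.\<close>

lemma mollify_L1_error:
  fixes f :: "'a::euclidean_space \<Rightarrow> real"
  assumes e: "0 < e" and f: "integrable lborel f"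
    and mod: "\<And>h. norm h < e \<Longrightarrow> L1_modulus f h \<le> ennreal \<eta>"
  shows "(\<integral>\<^sup>+x. ennreal \<bar>mollify e f x - f x\<bar> \<partial>lborel) \<le> ennreal \<eta>"
proof -
  have fm[measurable]: "f \<in> borel_measurable borel" using f by (auto dest: borel_measurable_integrable)
  have km[measurable]: "(mollifier e :: 'a \<Rightarrow> real) \<in> borel_measurable borel"
    by (rule borel_measurable_continuous_onI[OF continuous_on_mollifier])
  have intK: "integrable lborel (mollifier e :: 'a \<Rightarrow> real)" by (rule integrable_mollifier[OF e])
  obtain B where B: "\<And>z::'a. \<bar>mollifier e z\<bar> \<le> B" using mollifier_bounded[OF e] by blast
  have pt: "ennreal \<bar>mollify e f x - f x\<bar> \<le> (\<integral>\<^sup>+z. ennreal (\<bar>f (x - z) - f x\<bar> * mollifier e z) \<partial>lborel)" for x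
  proof -
    have int1: "integrable lborel (\<lambda>z. f (x - z) * mollifier e z)"
      by (rule Bochner_Integration.integrable_bound[where f = "\<lambda>z. f (x - z) * B"])
         (use integrable_reflection[OF f] B in \<open>auto simp: abs_mult intro!: mult_left_mono order_trans[OF B abs_ge_self]\<close>)
    have "mollify e f x = (\<integral>z. f (x - z) * mollifier e z \<partial>lborel)"
      unfolding mollify_def
      using integral_reflection[of "\<lambda>y. f y * mollifier e (x - y)" x] by simp
    then have eq: "mollify e f x - f x = (\<integral>z. (f (x - z) - f x) * mollifier e z \<partial>lborel)"
      using int1 intK integral_mollifier[OF e, where 'a = 'a] by (simp add: left_diff_distrib)
    have int2: "integrable lborel (\<lambda>z. (f (x - z) - f x) * mollifier e z)"
      using int1 intK by (simp add: left_diff_distrib)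
    have "ennreal (norm (\<integral>z. (f (x - z) - f x) * mollifier e z \<partial>lborel))
        \<le> (\<integral>\<^sup>+z. ennreal (norm ((f (x - z) - f x) * mollifier e z)) \<partial>lborel)"
      by (rule integral_norm_bound_ennreal[OF int2])
    then show ?thesis by (simp add: eq abs_mult mollifier_nonneg)
  qed
  have "(\<integral>\<^sup>+x. ennreal \<bar>mollify e f x - f x\<bar> \<partial>lborel)
      \<le> (\<integral>\<^sup>+x. \<integral>\<^sup>+z. ennreal (\<bar>f (x - z) - f x\<bar> * mollifier e z) \<partial>lborel \<partial>lborel)"
    by (intro nn_integral_mono pt)
  also have "\<dots> = (\<integral>\<^sup>+z. \<integral>\<^sup>+x. ennreal (\<bar>f (x - z) - f x\<bar> * mollifier e z) \<partial>lborel \<partial>lborel)"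
    by (rule lborel_pair.Fubini'[symmetric]) measurable
  also have "\<dots> \<le> (\<integral>\<^sup>+z. ennreal \<eta> * ennreal (mollifier e (z::'a)) \<partial>lborel)"
  proof (intro nn_integral_mono)
    fix z :: 'a
    have "(\<integral>\<^sup>+x. ennreal (\<bar>f (x - z) - f x\<bar> * mollifier e z) \<partial>lborel) = L1_modulus f z * ennreal (mollifier e z)"
      by (subst nn_integral_multc[symmetric]) (auto simp: ennreal_mult mollifier_nonneg)
    also have "\<dots> \<le> ennreal \<eta> * ennreal (mollifier e z)"
      using mod[of z] mollifier_eq_0[OF e, of z] by (cases "norm z < e") (auto intro: mult_right_mono)
    finally show "(\<integral>\<^sup>+x. ennreal (\<bar>f (x - z) - f x\<bar> * mollifier e z) \<partial>lborel) \<le> ennreal \<eta> * ennreal (mollifier e z)" .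
  qed
  also have "\<dots> = ennreal \<eta> * (\<integral>\<^sup>+z. ennreal (mollifier e (z::'a)) \<partial>lborel)"
    by (rule nn_integral_cmult) measurable
  also have "(\<integral>\<^sup>+z. ennreal (mollifier e (z::'a)) \<partial>lborel) = 1"
    using nn_integral_eq_integral[OF intK] by (simp add: mollifier_nonneg integral_mollifier[OF e])
  finally show ?thesis by simp
qed

text \<open>The error estimate, fed with the trivial bound of the modulus by twice the norm of
  \<open>f\<close>, already shows that \<open>mollify e f\<close> differs from \<open>f\<close> by
  an integrable function.\<close>

lemma integrable_mollify:
  assumes e: "0 < e" and f: "integrable lborel f"
  shows "integrable lborel (mollify e f)"
proof -
  have fm[measurable]: "f \<in> borel_measurable borel" using f by (auto dest: borel_measurable_integrable)
  have mm[measurable]: "mollify e f \<in> borel_measurable borel"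
    by (rule borel_measurable_continuous_onI[OF continuous_on_mollify[OF e f]])
  have fin: "(\<integral>\<^sup>+x. ennreal \<bar>f x\<bar> \<partial>lborel) < top"
    using f by (simp add: integrable_iff_bounded)
  then obtain c where c: "2 * (\<integral>\<^sup>+x. ennreal \<bar>f x\<bar> \<partial>lborel) = ennreal c"
    by (cases "\<integral>\<^sup>+x. ennreal \<bar>f x\<bar> \<partial>lborel") (auto simp: ennreal_mult[of 2, simplified, symmetric])
  have "(\<integral>\<^sup>+x. ennreal \<bar>mollify e f x - f x\<bar> \<partial>lborel) \<le> ennreal c"
    by (rule mollify_L1_error[OF e f]) (use L1_modulus_le[OF fm] c in simp)
  then have "integrable lborel (\<lambda>x. mollify e f x - f x)"
    by (auto simp: integrable_iff_bounded intro: le_less_trans)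
  from Bochner_Integration.integrable_add[OF this f] show ?thesis by simp
qed

lemma mollify_L1_tendsto:
  fixes f :: "'a::euclidean_space \<Rightarrow> real"
  assumes f: "integrable lborel f" and \<epsilon>: "\<And>n. 0 < \<epsilon> n" "\<epsilon> \<longlonglongrightarrow> 0"
  shows "(\<lambda>n. \<integral>x. \<bar>mollify (\<epsilon> n) f x - f x\<bar> \<partial>lborel) \<longlonglongrightarrow> 0"
proof (rule LIMSEQ_I)
  fix r :: real assume "0 < r"
  then obtain d where d: "0 < d" "\<And>h. norm h < d \<Longrightarrow> L1_modulus f h \<le> ennreal (r / 2)"
    using L1_modulus_tendsto_0[OF f, of "r / 2"] by auto
  obtain N where N: "\<And>n. N \<le> n \<Longrightarrow> norm (\<epsilon> n - 0) < d"
    using LIMSEQ_D[OF \<epsilon>(2) d(1)] by blast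
  have "norm ((\<integral>x. \<bar>mollify (\<epsilon> n) f x - f x\<bar> \<partial>lborel) - 0) < r" if "N \<le> n" for n
  proof -
    have int: "integrable lborel (\<lambda>x. \<bar>mollify (\<epsilon> n) f x - f x\<bar>)"
      using integrable_mollify[OF \<epsilon>(1) f] f by auto
    have "(\<integral>\<^sup>+x. ennreal \<bar>mollify (\<epsilon> n) f x - f x\<bar> \<partial>lborel) \<le> ennreal (r / 2)"
      by (rule mollify_L1_error[OF \<epsilon>(1) f]) (use d(2) N[OF that] in auto)
    then have "(\<integral>x. \<bar>mollify (\<epsilon> n) f x - f x\<bar> \<partial>lborel) \<le> r / 2"
      using \<open>0 < r\<close> nn_integral_eq_integral[OF int] by simp
    then show ?thesis using \<open>0 < r\<close> by simp
  qed
  then show "\<exists>N. \<forall>n\<ge>N. norm ((\<integral>x. \<bar>mollify (\<epsilon> n) f x - f x\<bar> \<partial>lborel) - 0) < r" by blast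
qed

lemma mollify_AE_subseq:
  fixes f :: "'a::euclidean_space \<Rightarrow> real"
  assumes f: "integrable lborel f" and \<epsilon>: "\<And>n. 0 < \<epsilon> n" "\<epsilon> \<longlonglongrightarrow> 0"
  obtains s where "strict_mono s" "AE x in lborel. (\<lambda>n. mollify (\<epsilon> (s n)) f x) \<longlonglongrightarrow> f x"
proof -
  have "\<exists>s. strict_mono s \<and> (AE x in lborel. (\<lambda>n. mollify (\<epsilon> (s n)) f x - f x) \<longlonglongrightarrow> 0)"
    by (rule tendsto_L1_AE_subseq)
       (use integrable_mollify[OF \<epsilon>(1) f] f mollify_L1_tendsto[OF assms] in auto)
  with that show ?thesis by (auto simp: LIM_zero_iff)
qed

text \<open>Convergence in L1 yields convergence almost everywhere only along a subsequence; the
  second subsequence is taken inside the first, so that one sequence of radii serves both functions.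
  The bound \<delta> keeps the kernels inside a prescribed neighbourhood.\<close>

lemma mollify_AE_subseq2:
  fixes f g :: "'a::euclidean_space \<Rightarrow> real"
  assumes f: "integrable lborel f" and g: "integrable lborel g" and \<delta>: "0 < \<delta>"
  obtains \<epsilon> where "\<And>n::nat. 0 < \<epsilon> n" "\<And>n. \<epsilon> n \<le> \<delta>" "\<epsilon> \<longlonglongrightarrow> 0"
    "AE x in lborel. (\<lambda>n. mollify (\<epsilon> n) f x) \<longlonglongrightarrow> f x"
    "AE x in lborel. (\<lambda>n. mollify (\<epsilon> n) g x) \<longlonglongrightarrow> g x"
proof -
  define \<epsilon> where "\<epsilon> n = \<delta> / real (Suc n)" for n
  have \<epsilon>: "0 < \<epsilon> n" "\<epsilon> n \<le> \<delta>" for n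
    using \<delta> by (auto simp: \<epsilon>_def field_simps)
  have \<epsilon>0: "\<epsilon> \<longlonglongrightarrow> 0"
    using tendsto_mult_right[OF LIMSEQ_inverse_real_of_nat, of \<delta>] by (simp add: \<epsilon>_def[abs_def] divide_inverse mult.commute)
  obtain s where s: "strict_mono s" "AE x in lborel. (\<lambda>n. mollify (\<epsilon> (s n)) f x) \<longlonglongrightarrow> f x"
    using mollify_AE_subseq[OF f \<epsilon>(1) \<epsilon>0] by blast
  have \<epsilon>s: "(\<lambda>n. \<epsilon> (s n)) \<longlonglongrightarrow> 0"
    using LIMSEQ_subseq_LIMSEQ[OF \<epsilon>0 s(1)] by (simp add: o_def)
  obtain s' where s': "strict_mono s'" "AE x in lborel. (\<lambda>n. mollify (\<epsilon> (s (s' n))) g x) \<longlonglongrightarrow> g x"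
    using mollify_AE_subseq[OF g \<epsilon>(1) \<epsilon>s] by blast
  show ?thesis
  proof (rule that[of "\<lambda>n. \<epsilon> (s (s' n))"])
    show "(\<lambda>n. \<epsilon> (s (s' n))) \<longlonglongrightarrow> 0"
      using LIMSEQ_subseq_LIMSEQ[OF \<epsilon>s s'(1)] by (simp add: o_def)
    show "AE x in lborel. (\<lambda>n. mollify (\<epsilon> (s (s' n))) f x) \<longlonglongrightarrow> f x"
      using s(2)
    proof eventually_elim
      case (elim x)
      show ?case using LIMSEQ_subseq_LIMSEQ[OF elim s'(1)] by (simp add: o_def)
    qed
  qed (use \<epsilon> s' in auto)
qed

section \<open>Weak derivatives\<close>

lemma lebesgue_on_compact_measurable:
  fixes f :: "'a::euclidean_space \<Rightarrow> 'b::real_normed_vector"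
  assumes "compact K"
  shows "f \<in> borel_measurable (lebesgue_on K) \<longleftrightarrow> (\<lambda>x. indicator K x *\<^sub>R f x) \<in> borel_measurable lebesgue"
  using assms by (intro borel_measurable_restrict_space_iff) (auto intro!: lmeasurable_compact fmeasurableD)

lemma integrable_lebesgue_on_compact:
  fixes f :: "'a::euclidean_space \<Rightarrow> 'b::{banach, second_countable_topology}"
  assumes "compact K"
  shows "integrable (lebesgue_on K) f \<longleftrightarrow> integrable lebesgue (\<lambda>x. indicator K x *\<^sub>R f x)"
  using assms by (intro integrable_restrict_space) (auto intro!: lmeasurable_compact fmeasurableD)

lemma AE_lebesgue_on_open_iff:
  fixes \<Omega> :: "'a::euclidean_space set"
  assumes "open \<Omega>"
  shows "(AE x in lebesgue_on \<Omega>. P x) \<longleftrightarrow> (AE x in lebesgue. x \<in> \<Omega> \<longrightarrow> P x)"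
  using assms by (intro AE_restrict_space_iff) auto

lemma AE_lebesgue_on_compact_iff:
  fixes K :: "'a::euclidean_space set"
  assumes "compact K"
  shows "(AE x in lebesgue_on K. P x) \<longleftrightarrow> (AE x in lebesgue. x \<in> K \<longrightarrow> P x)"
  using assms by (intro AE_restrict_space_iff) (auto intro!: lmeasurable_compact fmeasurableD)

text \<open>An open set is a countable union of compact sets, so exceptional sets need only be null
  on compact subsets.\<close>

lemma AE_lebesgue_on_openI:
  fixes \<Omega> :: "'a::euclidean_space set"
  assumes "open \<Omega>" "\<And>K. compact K \<Longrightarrow> K \<subseteq> \<Omega> \<Longrightarrow> AE x in lebesgue. x \<in> K \<longrightarrow> P x"
  shows "AE x in lebesgue_on \<Omega>. P x"
proof -
  obtain C where C: "\<And>n::nat. compact (C n)" "\<And>n. C n \<subseteq> \<Omega>" "\<Union>(range C) = \<Omega>"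
    using open_Union_compact_subsets[OF assms(1)] by metis
  have "AE x in lebesgue. \<forall>n. x \<in> C n \<longrightarrow> P x"
    unfolding AE_all_countable using assms(2) C by blast
  then have "AE x in lebesgue. x \<in> \<Omega> \<longrightarrow> P x"
    by eventually_elim (use C(3) in blast)
  then show ?thesis using AE_lebesgue_on_open_iff[OF assms(1)] by blast
qed

lemma loc_integrable_measurable:
  fixes f :: "'a::euclidean_space \<Rightarrow> 'b::{banach, second_countable_topology}"
  assumes "open \<Omega>" "loc_integrable \<Omega> f"
  shows "f \<in> borel_measurable (lebesgue_on \<Omega>)"
proof -
  obtain C where C: "\<And>n::nat. compact (C n)" "\<And>n. C n \<subseteq> \<Omega>" "\<Union>(range C) = \<Omega>"
    using open_Union_compact_subsets[OF assms(1)] by metis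
  show ?thesis
  proof (rule measurable_piecewise_restrict2[where A = C])
    show "C n \<in> sets (lebesgue_on \<Omega>)" for n
      using C(1,2)[of n] assms(1) by (auto simp: sets_restrict_space_iff intro!: lmeasurable_compact fmeasurableD)
    show "space (lebesgue_on \<Omega>) = (\<Union>n. C n)" using C(3) by simp
    show "\<exists>h\<in>borel_measurable (lebesgue_on \<Omega>). \<forall>x\<in>C n. f x = h x" for n
    proof (intro bexI ballI)
      have "integrable (lebesgue_on (C n)) f"
        using assms(2) C(1,2) unfolding loc_integrable_def by blast
      then have "f \<in> borel_measurable (lebesgue_on (C n))"
        by (rule borel_measurable_integrable)
      then have "(\<lambda>x. indicator (C n) x *\<^sub>R f x) \<in> borel_measurable lebesgue"
        using C(1) lebesgue_on_compact_measurable by blast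
      then show "(\<lambda>x. indicator (C n) x *\<^sub>R f x) \<in> borel_measurable (lebesgue_on \<Omega>)"
        by (rule measurable_restrict_space1)
    qed simp
  qed
qed

lemma loc_integrable_add:
  assumes "loc_integrable \<Omega> f" "loc_integrable \<Omega> g"
  shows "loc_integrable \<Omega> (\<lambda>x. f x + g x)"
  using assms by (auto simp: loc_integrable_def)

lemma loc_integrable_cmult:
  fixes f :: "'a::euclidean_space \<Rightarrow> real"
  shows "loc_integrable \<Omega> f \<Longrightarrow> loc_integrable \<Omega> (\<lambda>x. c * f x)"
  by (auto simp: loc_integrable_def)

lemma loc_integrable_abs:
  fixes f :: "'a::euclidean_space \<Rightarrow> real"
  shows "loc_integrable \<Omega> f \<Longrightarrow> loc_integrable \<Omega> (\<lambda>x. \<bar>f x\<bar>)"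
  by (auto simp: loc_integrable_def)

lemma loc_integrable_const: "loc_integrable \<Omega> (\<lambda>_. c::real)"
  unfolding loc_integrable_def
proof (intro allI impI, elim conjE)
  fix K :: "'a set" assume "compact K"
  then have "emeasure lebesgue K < \<infinity>" "K \<in> sets lebesgue"
    using lmeasurable_compact[of K] by (auto simp: fmeasurable_def)
  then show "integrable (lebesgue_on K) (\<lambda>_. c)"
    by (simp add: integrable_restrict_space)
qed

lemma loc_integrable_bound:
  fixes f :: "'a::euclidean_space \<Rightarrow> 'b::{banach, second_countable_topology}" and H :: "'a \<Rightarrow> real"
  assumes \<Omega>: "open \<Omega>" and f: "f \<in> borel_measurable (lebesgue_on \<Omega>)" and H: "loc_integrable \<Omega> H"
    and le: "AE x in lebesgue_on \<Omega>. norm (f x) \<le> H x"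
  shows "loc_integrable \<Omega> f"
  unfolding loc_integrable_def
proof (intro allI impI, elim conjE)
  fix K assume K: "compact K" "K \<subseteq> \<Omega>"
  show "integrable (lebesgue_on K) f"
  proof (rule Bochner_Integration.integrable_bound)
    show "integrable (lebesgue_on K) H" using H K by (simp add: loc_integrable_def)
    show "f \<in> borel_measurable (lebesgue_on K)" using measurable_restrict_mono[OF f K(2)] .
    have "AE x in lebesgue. x \<in> K \<longrightarrow> norm (f x) \<le> norm (H x)"
      using le unfolding AE_lebesgue_on_open_iff[OF \<Omega>] by eventually_elim (use K(2) in force)
    then show "AE x in lebesgue_on K. norm (f x) \<le> norm (H x)"
      unfolding AE_lebesgue_on_compact_iff[OF K(1)] .
  qed
qed

text \<open>Mollification acts on functions that are integrable for \<open>lborel\<close> on the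
  whole space. A locally integrable function is merely Lebesgue measurable and is controlled only
  inside \<Omega>, so it is cut off by \<open>K\<close> and replaced by a Borel function equal to it
  almost everywhere.\<close>

lemma loc_integrable_borel_representative:
  fixes f :: "'a::euclidean_space \<Rightarrow> real"
  assumes "loc_integrable \<Omega> f" "compact K" "K \<subseteq> \<Omega>"
  obtains f0 where "integrable lborel f0" "AE x in lborel. f0 x = indicator K x * f x"
proof -
  have int: "integrable lebesgue (\<lambda>x. indicator K x * f x)"
    using assms integrable_lebesgue_on_compact[OF assms(2), of f] by (simp add: loc_integrable_def)
  then obtain f0 where f0: "f0 \<in> borel_measurable lborel" "AE x in lborel. indicator K x * f x = f0 x"
    using completion_ex_borel_measurable_real[of "\<lambda>x. indicator K x * f x" lborel] by blast
  have "integrable lebesgue f0"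
    using int f0 by (subst integrable_cong_AE[of _ _ "\<lambda>x. indicator K x * f x"])
      (auto intro: measurable_completion AE_completion simp: eq_commute)
  then have "integrable lborel f0"
    using f0(1) integrable_completion by blast
  with f0(2) that show ?thesis by (simp add: eq_commute)
qed

text \<open>Carries integrals against compactly supported continuous functions from \<Omega> to
  \<open>lborel\<close>, where translation and mollification are available. The two functions have
  to agree on \<open>K\<close> only, because \<open>k\<close> vanishes elsewhere.\<close>

lemma integral_lebesgue_on_compact_support:
  fixes f k :: "'a::euclidean_space \<Rightarrow> real"
  assumes \<Omega>: "open \<Omega>" and f: "loc_integrable \<Omega> f" and K: "compact K" "K \<subseteq> \<Omega>"
    and k: "continuous_on UNIV k" "\<And>x. x \<notin> K \<Longrightarrow> k x = 0"
    and f0: "f0 \<in> borel_measurable borel" "AE x in lborel. x \<in> K \<longrightarrow> f0 x = f x"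
  shows "(\<integral>x. f x * k x \<partial>lebesgue_on \<Omega>) = (\<integral>x. f0 x * k x \<partial>lborel)"
proof -
  have km: "k \<in> borel_measurable borel" by (rule borel_measurable_continuous_onI[OF k(1)])
  have fK: "(\<lambda>x. indicator K x *\<^sub>R f x) \<in> borel_measurable lebesgue"
    using f K lebesgue_on_compact_measurable[OF K(1), of f] by (auto simp: loc_integrable_def)
  have "(\<integral>x. f x * k x \<partial>lebesgue_on \<Omega>) = (\<integral>x. indicator \<Omega> x *\<^sub>R (f x * k x) \<partial>lebesgue)"
    using \<Omega> by (intro integral_restrict_space) auto
  also have "\<dots> = (\<integral>x. (indicator K x *\<^sub>R f x) * k x \<partial>lebesgue)"
    using K(2) k(2) by (intro Bochner_Integration.integral_cong) (auto simp: indicator_def)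
  also have "\<dots> = (\<integral>x. f0 x * k x \<partial>lebesgue)"
  proof (rule integral_cong_AE)
    show "AE x in lebesgue. (indicator K x *\<^sub>R f x) * k x = f0 x * k x"
      using AE_completion[OF f0(2)] by eventually_elim (use k(2) in \<open>auto simp: indicator_def\<close>)
    have "f0 \<in> borel_measurable lebesgue" "k \<in> borel_measurable lebesgue"
      using f0(1) km by (auto intro: measurable_completion)
    then show "(\<lambda>x. (indicator K x *\<^sub>R f x) * k x) \<in> borel_measurable lebesgue"
        "(\<lambda>x. f0 x * k x) \<in> borel_measurable lebesgue"
      using borel_measurable_times[OF fK] borel_measurable_times by blast+
  qed
  also have "\<dots> = (\<integral>x. f0 x * k x \<partial>lborel)"
    using f0(1) km by (intro integral_completion) auto
  finally show ?thesis .
qed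

lemma integrable_lebesgue_on_compact_support:
  fixes f k :: "'a::euclidean_space \<Rightarrow> real"
  assumes \<Omega>: "open \<Omega>" and f: "loc_integrable \<Omega> f" and K: "compact K" "K \<subseteq> \<Omega>"
    and k: "continuous_on UNIV k" "\<And>x. x \<notin> K \<Longrightarrow> k x = 0"
  shows "integrable (lebesgue_on \<Omega>) (\<lambda>x. f x * k x)"
proof -
  have km: "k \<in> borel_measurable lebesgue"
    using borel_measurable_continuous_onI[OF k(1)] by (intro measurable_completion) auto
  obtain B where B: "\<And>x. norm (k x) \<le> B" using bounded_compact_support[OF k(1) K(1) k(2)] by blast
  have fK: "integrable lebesgue (\<lambda>x. indicator K x *\<^sub>R f x)"
    using f K integrable_lebesgue_on_compact[OF K(1), of f] by (auto simp: loc_integrable_def)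
  have "integrable lebesgue (\<lambda>x. (indicator K x *\<^sub>R f x) * k x)"
  proof (rule Bochner_Integration.integrable_bound)
    show "integrable lebesgue (\<lambda>x. (indicator K x *\<^sub>R f x) * B)" using fK by simp
    show "AE x in lebesgue. norm (indicator K x *\<^sub>R f x * k x) \<le> norm (indicator K x *\<^sub>R f x * B)"
      using B by (auto simp: abs_mult intro!: mult_left_mono order_trans[OF B abs_ge_self, simplified])
  qed (use fK km in \<open>auto intro!: borel_measurable_times\<close>)
  moreover have "(\<lambda>x. (indicator K x *\<^sub>R f x) * k x) = (\<lambda>x. indicator \<Omega> x *\<^sub>R (f x * k x))"
    using K(2) k(2) by (auto simp: indicator_def fun_eq_iff)
  ultimately show ?thesis
    using \<Omega> by (subst integrable_restrict_space) auto
qed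

text \<open>Allowing every direction \<open>h\<close>, not only basis vectors, makes the mollification of a function
  with vanishing weak gradient constant along segments.\<close>

definition weak_deriv :: "'a::euclidean_space set \<Rightarrow> 'a \<Rightarrow> ('a \<Rightarrow> real) \<Rightarrow> ('a \<Rightarrow> real) \<Rightarrow> bool" where
  "weak_deriv \<Omega> h \<psi> g \<longleftrightarrow> loc_integrable \<Omega> \<psi> \<and> loc_integrable \<Omega> g \<and>
     (\<forall>\<phi> D. test_fun \<Omega> \<phi> \<and> (\<forall>x. (\<phi> has_derivative (\<lambda>k. D x \<bullet> k)) (at x)) \<longrightarrow>
        (\<integral>x. \<psi> x * (D x \<bullet> h) \<partial>lebesgue_on \<Omega>) = - (\<integral>x. g x * \<phi> x \<partial>lebesgue_on \<Omega>))"

lemma test_fun_support: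
  assumes "test_fun \<Omega> \<phi>" "\<And>x. (\<phi> has_derivative (\<lambda>k. D x \<bullet> k)) (at x)"
  obtains K where "compact K" "K \<subseteq> \<Omega>" "\<And>x. x \<notin> K \<Longrightarrow> \<phi> x = 0" "\<And>x. x \<notin> K \<Longrightarrow> D x = 0"
    "continuous_on UNIV \<phi>" "\<And>h. continuous_on UNIV (\<lambda>x. D x \<bullet> h)"
proof (rule that)
  show "compact (closure {x. \<phi> x \<noteq> 0})" "closure {x. \<phi> x \<noteq> 0} \<subseteq> \<Omega>"
    using assms(1) by (auto simp: test_fun_def)
  show "\<phi> x = 0" if "x \<notin> closure {x. \<phi> x \<noteq> 0}" for x
    using that subsetD[OF closure_subset, of x "{x. \<phi> x \<noteq> 0}"] by (metis mem_Collect_eq)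
  show "D x = 0" if "x \<notin> closure {x. \<phi> x \<noteq> 0}" for x
    using test_fun_grad(2)[OF assms that] .
  show "continuous_on UNIV \<phi>" using test_fun_continuous[OF assms(1)] .
  show "continuous_on UNIV (\<lambda>x. D x \<bullet> h)" for h
    using test_fun_grad(1)[OF assms] by (intro continuous_intros)
qed

lemma weak_deriv_integrable:
  assumes "open \<Omega>" "loc_integrable \<Omega> \<psi>" "test_fun \<Omega> \<phi>" "\<And>x. (\<phi> has_derivative (\<lambda>k. D x \<bullet> k)) (at x)"
  shows "integrable (lebesgue_on \<Omega>) (\<lambda>x. \<psi> x * \<phi> x)" "integrable (lebesgue_on \<Omega>) (\<lambda>x. \<psi> x * (D x \<bullet> h))"
proof -
  obtain K where "compact K" "K \<subseteq> \<Omega>" "\<And>x. x \<notin> K \<Longrightarrow> \<phi> x = 0" "\<And>x. x \<notin> K \<Longrightarrow> D x = 0"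
    "continuous_on UNIV \<phi>" "\<And>h. continuous_on UNIV (\<lambda>x. D x \<bullet> h)"
    using test_fun_support[OF assms(3,4)] by metis
  then show "integrable (lebesgue_on \<Omega>) (\<lambda>x. \<psi> x * \<phi> x)" "integrable (lebesgue_on \<Omega>) (\<lambda>x. \<psi> x * (D x \<bullet> h))"
    using integrable_lebesgue_on_compact_support[OF assms(1,2)] by simp_all
qed

section \<open>Linearity, locality and uniqueness of weak derivatives\<close>

lemma weak_deriv_add:
  assumes "open \<Omega>" "weak_deriv \<Omega> h \<psi> g" "weak_deriv \<Omega> h \<psi>' g'"
  shows "weak_deriv \<Omega> h (\<lambda>x. \<psi> x + \<psi>' x) (\<lambda>x. g x + g' x)"
  unfolding weak_deriv_def
proof (intro conjI allI impI; (elim conjE)?)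
  show "loc_integrable \<Omega> (\<lambda>x. \<psi> x + \<psi>' x)" "loc_integrable \<Omega> (\<lambda>x. g x + g' x)"
    using assms by (auto simp: weak_deriv_def intro: loc_integrable_add)
  fix \<phi> D assume \<phi>: "test_fun \<Omega> \<phi>" "\<forall>x. (\<phi> has_derivative (\<lambda>k. D x \<bullet> k)) (at x)"
  have l: "loc_integrable \<Omega> \<psi>" "loc_integrable \<Omega> \<psi>'" "loc_integrable \<Omega> g" "loc_integrable \<Omega> g'"
    using assms by (auto simp: weak_deriv_def)
  note i = weak_deriv_integrable[OF assms(1) _ \<phi>(1), of _ D, OF _ \<phi>(2)[rule_format]]
  have "(\<integral>x. \<psi> x * (D x \<bullet> h) \<partial>lebesgue_on \<Omega>) = - (\<integral>x. g x * \<phi> x \<partial>lebesgue_on \<Omega>)"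
    "(\<integral>x. \<psi>' x * (D x \<bullet> h) \<partial>lebesgue_on \<Omega>) = - (\<integral>x. g' x * \<phi> x \<partial>lebesgue_on \<Omega>)"
    using assms(2,3) \<phi> by (auto simp: weak_deriv_def)
  then show "(\<integral>x. (\<psi> x + \<psi>' x) * (D x \<bullet> h) \<partial>lebesgue_on \<Omega>) = - (\<integral>x. (g x + g' x) * \<phi> x \<partial>lebesgue_on \<Omega>)"
    using i[OF l(1)] i[OF l(2)] i[OF l(3)] i[OF l(4)] by (simp add: distrib_right)
qed

lemma weak_deriv_cmult:
  assumes "weak_deriv \<Omega> h \<psi> g"
  shows "weak_deriv \<Omega> h (\<lambda>x. c * \<psi> x) (\<lambda>x. c * g x)"
  using assms by (auto simp: weak_deriv_def mult.assoc intro: loc_integrable_cmult)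

lemma weak_deriv_cong_AE:
  assumes \<Omega>: "open \<Omega>" and \<psi>: "weak_deriv \<Omega> h \<psi> g"
    and m: "\<psi>' \<in> borel_measurable (lebesgue_on \<Omega>)" "g' \<in> borel_measurable (lebesgue_on \<Omega>)"
    and eq: "AE x in lebesgue_on \<Omega>. \<psi>' x = \<psi> x" "AE x in lebesgue_on \<Omega>. g' x = g x"
  shows "weak_deriv \<Omega> h \<psi>' g'"
  unfolding weak_deriv_def
proof (intro conjI allI impI; (elim conjE)?)
  have l: "loc_integrable \<Omega> \<psi>" "loc_integrable \<Omega> g" using \<psi> by (auto simp: weak_deriv_def)
  have l': "loc_integrable \<Omega> (\<lambda>x. \<bar>\<psi> x\<bar>)" "loc_integrable \<Omega> (\<lambda>x. \<bar>g x\<bar>)"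
    using l loc_integrable_abs by auto
  note lm = loc_integrable_measurable[OF \<Omega> l(1)] loc_integrable_measurable[OF \<Omega> l(2)]
  show "loc_integrable \<Omega> \<psi>'"
    by (rule loc_integrable_bound[OF \<Omega> m(1) l'(1)]) (use eq(1) in \<open>eventually_elim, simp\<close>)
  show "loc_integrable \<Omega> g'"
    by (rule loc_integrable_bound[OF \<Omega> m(2) l'(2)]) (use eq(2) in \<open>eventually_elim, simp\<close>)
  fix \<phi> D assume \<phi>: "test_fun \<Omega> \<phi>" "\<forall>x. (\<phi> has_derivative (\<lambda>k. D x \<bullet> k)) (at x)"
  have \<phi>m: "\<phi> \<in> borel_measurable lebesgue" "(\<lambda>x. D x \<bullet> h) \<in> borel_measurable lebesgue"
    using test_fun_continuous[OF \<phi>(1)] test_fun_grad(1)[OF \<phi>(1), of D] \<phi>(2)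
    by (auto intro!: measurable_completion borel_measurable_continuous_onI continuous_intros)
  note \<phi>m' = measurable_restrict_space1[OF \<phi>m(1), of \<Omega>] measurable_restrict_space1[OF \<phi>m(2), of \<Omega>]
  have "(\<integral>x. \<psi>' x * (D x \<bullet> h) \<partial>lebesgue_on \<Omega>) = (\<integral>x. \<psi> x * (D x \<bullet> h) \<partial>lebesgue_on \<Omega>)"
    by (rule integral_cong_AE)
      (use m lm \<phi>m' in \<open>auto intro!: borel_measurable_times\<close>, use eq(1) in \<open>eventually_elim, simp\<close>)
  moreover have "(\<integral>x. g' x * \<phi> x \<partial>lebesgue_on \<Omega>) = (\<integral>x. g x * \<phi> x \<partial>lebesgue_on \<Omega>)"
    by (rule integral_cong_AE)
      (use m lm \<phi>m' in \<open>auto intro!: borel_measurable_times\<close>, use eq(2) in \<open>eventually_elim, simp\<close>)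
  moreover have "(\<integral>x. \<psi> x * (D x \<bullet> h) \<partial>lebesgue_on \<Omega>) = - (\<integral>x. g x * \<phi> x \<partial>lebesgue_on \<Omega>)"
    using \<psi> \<phi> by (auto simp: weak_deriv_def)
  ultimately show "(\<integral>x. \<psi>' x * (D x \<bullet> h) \<partial>lebesgue_on \<Omega>) = - (\<integral>x. g' x * \<phi> x \<partial>lebesgue_on \<Omega>)"
    by simp
qed

text \<open>The closed neighbourhood is the Minkowski sum of \<open>K\<close> with
  \<open>cball 0 \<delta>\<close>, hence compact. Its margin leaves room for kernels centred at
  points of \<open>K\<close>.\<close>

lemma compact_neighbourhood:
  fixes K :: "'a::euclidean_space set"
  assumes "compact K" "open \<Omega>" "K \<subseteq> \<Omega>"
  obtains \<delta> K' where "0 < \<delta>" "compact K'" "K \<subseteq> K'" "K' \<subseteq> \<Omega>" "\<And>x. x \<in> K \<Longrightarrow> cball x \<delta> \<subseteq> K'"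
proof -
  obtain \<delta> where \<delta>: "\<delta> > 0" "(\<Union>x\<in>K. cball x \<delta>) \<subseteq> \<Omega>"
    using compact_subset_open_imp_cball_epsilon_subset[OF assms] by blast
  have eq: "(\<Union>x\<in>K. cball x \<delta>) = {x + y |x y. x \<in> K \<and> y \<in> cball 0 \<delta>}"
  proof (intro set_eqI iffI; clarsimp)
    fix x z assume "x \<in> K" "dist x z \<le> \<delta>"
    then show "\<exists>xa (y::'a). z = xa + y \<and> xa \<in> K \<and> norm y \<le> \<delta>"
      by (intro exI[of _ x] exI[of _ "z - x"]) (auto simp: dist_norm norm_minus_commute)
  next
    fix x y :: 'a assume "x \<in> K" "norm y \<le> \<delta>"
    then show "\<exists>xa\<in>K. dist xa (x + y) \<le> \<delta>" by (auto simp: dist_norm intro!: bexI[of _ x])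
  qed
  have "compact (\<Union>x\<in>K. cball x \<delta>)"
    unfolding eq by (rule compact_sums[OF assms(1) compact_cball])
  moreover have "K \<subseteq> (\<Union>x\<in>K. cball x \<delta>)" using \<delta>(1) by force
  ultimately show ?thesis
    using that[of \<delta> "\<Union>x\<in>K. cball x \<delta>"] \<delta> by blast
qed

text \<open>The kernel centred at \<open>x\<close> is itself the test function.\<close>

lemma mollify_weak_deriv:
  assumes \<Omega>: "open \<Omega>" and \<psi>: "weak_deriv \<Omega> h \<psi> g" and K: "compact K" "K \<subseteq> \<Omega>"
    and f0: "integrable lborel f0" "AE x in lborel. f0 x = indicator K x * \<psi> x"
    and g0: "integrable lborel g0" "AE x in lborel. g0 x = indicator K x * g x"
    and e: "0 < e" "cball x e \<subseteq> K"
  shows "mollify_deriv e f0 h x = mollify e g0 x"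
proof -
  let ?D = "\<lambda>y. bump_grad 0 e (y - x)" and ?\<phi> = "\<lambda>y. ball_bump e (y - x)"
  let ?c = "\<integral>z. ball_bump e (z::'a) \<partial>lborel"
  have D: "(?\<phi> has_derivative (\<lambda>k. ?D y \<bullet> k)) (at y)" for y
    unfolding ball_bump_def by (rule bump_has_derivative)
  have T: "test_fun \<Omega> ?\<phi>" using e K(2) by (intro test_fun_ball_bump) auto
  have z: "?\<phi> y = 0" "?D y \<bullet> h = 0" if "y \<notin> cball x e" for y
    using that e(1) by (auto simp: dist_norm norm_minus_commute ball_bump_eq_0 bump_grad_eq_0)
  have c: "continuous_on UNIV ?\<phi>" "continuous_on UNIV (\<lambda>y. ?D y \<bullet> h)"
    using test_fun_continuous[OF T] test_fun_grad(1)[OF T D] by (auto intro!: continuous_intros)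
  have l: "loc_integrable \<Omega> \<psi>" "loc_integrable \<Omega> g" using \<psi> by (auto simp: weak_deriv_def)
  have sub: "cball x e \<subseteq> \<Omega>" using e K(2) by auto
  have fm: "f0 \<in> borel_measurable borel" "g0 \<in> borel_measurable borel"
    using f0 g0 by (auto dest: borel_measurable_integrable)
  have ae: "AE y in lborel. y \<in> cball x e \<longrightarrow> f0 y = \<psi> y"
    using f0(2) by eventually_elim (use e(2) in \<open>auto simp: indicator_def split: if_splits\<close>)
  have ae': "AE y in lborel. y \<in> cball x e \<longrightarrow> g0 y = g y"
    using g0(2) by eventually_elim (use e(2) in \<open>auto simp: indicator_def split: if_splits\<close>)
  have "(\<integral>y. \<psi> y * (?D y \<bullet> h) \<partial>lebesgue_on \<Omega>) = - (\<integral>y. g y * ?\<phi> y \<partial>lebesgue_on \<Omega>)"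
    using \<psi> T D by (auto simp: weak_deriv_def)
  then have *: "(\<integral>y. f0 y * (?D y \<bullet> h) \<partial>lborel) = - (\<integral>y. g0 y * ?\<phi> y \<partial>lborel)"
    using integral_lebesgue_on_compact_support[OF \<Omega> l(1) compact_cball sub c(2) z(2) fm(1) ae]
      integral_lebesgue_on_compact_support[OF \<Omega> l(2) compact_cball sub c(1) z(1) fm(2) ae'] by simp
  \<comment> \<open>The kernel is evaluated at \<open>x - y\<close> and the test function at
    \<open>y - x\<close>; the gradient is odd, and its sign cancels the minus sign of the weak
    formulation.\<close>
  have "mollify_deriv e f0 h x = (\<integral>y. (- 1 / ?c) * (f0 y * (?D y \<bullet> h)) \<partial>lborel)"
    unfolding mollify_deriv_def mollifier_grad_def
    by (intro Bochner_Integration.integral_cong refl) (simp add: divide_inverse bump_grad_minus[of 0 e "_ - x", simplified])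
  also have "\<dots> = (1 / ?c) * (\<integral>y. g0 y * ?\<phi> y \<partial>lborel)"
    using * by (subst integral_mult_right_zero) simp
  also have "\<dots> = (\<integral>y. (1 / ?c) * (g0 y * ?\<phi> y) \<partial>lborel)"
    by (rule integral_mult_right_zero[symmetric])
  also have "\<dots> = mollify e g0 x"
    unfolding mollify_def mollifier_def
    by (intro Bochner_Integration.integral_cong refl) (simp add: ball_bump_minus[of e "_ - x", simplified])
  finally show ?thesis .
qed

text \<open>On \<open>K\<close> the mollified \<open>g\<close> equals the derivative of the
  mollified zero function, hence 0, while along a sequence of radii it converges to \<open>g\<close>
  almost everywhere.\<close>

lemma weak_deriv_zero_imp:
  assumes \<Omega>: "open \<Omega>" and g: "weak_deriv \<Omega> h (\<lambda>_. 0) g"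
  shows "AE x in lebesgue_on \<Omega>. g x = 0"
proof (rule AE_lebesgue_on_openI[OF \<Omega>])
  fix K assume K: "compact K" "K \<subseteq> \<Omega>"
  obtain \<delta> K' where \<delta>: "0 < \<delta>" "compact K'" "K \<subseteq> K'" "K' \<subseteq> \<Omega>" "\<And>x. x \<in> K \<Longrightarrow> cball x \<delta> \<subseteq> K'"
    using compact_neighbourhood[OF K(1) \<Omega> K(2)] by metis
  have l: "loc_integrable \<Omega> g" using g by (simp add: weak_deriv_def)
  obtain g0 where g0: "integrable lborel g0" "AE x in lborel. g0 x = indicator K' x * g x"
    using loc_integrable_borel_representative[OF l \<delta>(2,4)] by blast
  obtain \<epsilon> where \<epsilon>: "\<And>n::nat. 0 < \<epsilon> n" "\<And>n. \<epsilon> n \<le> \<delta>"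
    and s: "AE x in lborel. (\<lambda>n. mollify (\<epsilon> n) g0 x) \<longlonglongrightarrow> g0 x"
    by (rule mollify_AE_subseq2[OF g0(1) g0(1) \<delta>(1)]) blast
  have z: "mollify (\<epsilon> n) g0 x = 0" if "x \<in> K" for n x
  proof -
    have "cball x (\<epsilon> n) \<subseteq> K'" using \<delta>(5)[OF that] \<epsilon>(2)[of n] by auto
    from mollify_weak_deriv[OF \<Omega> g \<delta>(2,4) _ _ g0 \<epsilon>(1) this, of "\<lambda>_. 0"]
    show ?thesis by (simp add: mollify_deriv_def)
  qed
  have "AE x in lborel. x \<in> K \<longrightarrow> g x = 0"
    using s g0(2)
  proof eventually_elim
    case (elim x)
    show ?case
    proof
      assume "x \<in> K"
      then have "(\<lambda>n. 0) \<longlonglongrightarrow> g0 x" using elim(1) z by simp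
      then have "g0 x = 0" using LIMSEQ_unique tendsto_const by blast
      then show "g x = 0" using elim(2) \<open>x \<in> K\<close> \<delta>(3) by (auto simp: indicator_def)
    qed
  qed
  then show "AE x in lebesgue. x \<in> K \<longrightarrow> g x = 0" by (rule AE_completion)
qed

lemma weak_deriv_unique:
  assumes \<Omega>: "open \<Omega>" and g: "weak_deriv \<Omega> h \<psi> g" "weak_deriv \<Omega> h \<psi>' g'"
    and eq: "AE x in lebesgue_on \<Omega>. \<psi> x = \<psi>' x"
  shows "AE x in lebesgue_on \<Omega>. g x = g' x"
proof -
  have d: "weak_deriv \<Omega> h (\<lambda>x. \<psi> x + (-1) * \<psi>' x) (\<lambda>x. g x + (-1) * g' x)"
    using weak_deriv_add[OF \<Omega> g(1) weak_deriv_cmult[OF g(2)]] .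
  have "weak_deriv \<Omega> h (\<lambda>_. 0) (\<lambda>x. g x + (-1) * g' x)"
  proof (rule weak_deriv_cong_AE[OF \<Omega> d])
    show "AE x in lebesgue_on \<Omega>. 0 = \<psi> x + - 1 * \<psi>' x" using eq by eventually_elim simp
    show "(\<lambda>x. g x + - 1 * g' x) \<in> borel_measurable (lebesgue_on \<Omega>)"
      using d by (intro loc_integrable_measurable[OF \<Omega>]) (simp add: weak_deriv_def)
  qed auto
  from weak_deriv_zero_imp[OF \<Omega> this] show ?thesis by eventually_elim simp
qed

section \<open>Vanishing weak derivatives and dominated limits\<close>

text \<open>Kernels of radius at most \<open>r\<close> centred in the ball of radius
  \<open>r\<close> stay in the ball of radius \<open>2 * r\<close>. There the mollifications have
  vanishing derivative in every direction, so they are constant along each segment from the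
  centre.\<close>

lemma weak_deriv_zero_locally_const:
  assumes \<Omega>: "open \<Omega>" and \<psi>: "\<And>h. weak_deriv \<Omega> h \<psi> (\<lambda>_. 0)" and r: "0 < r" "cball x (2 * r) \<subseteq> \<Omega>"
  obtains c where "AE y in lebesgue. y \<in> ball x r \<longrightarrow> \<psi> y = c"
proof -
  let ?K = "cball x (2 * r)"
  have l: "loc_integrable \<Omega> \<psi>" using \<psi> by (simp add: weak_deriv_def)
  obtain f0 where f0: "integrable lborel f0" "AE y in lborel. f0 y = indicator ?K y * \<psi> y"
    using loc_integrable_borel_representative[OF l compact_cball r(2)] by blast
  obtain \<epsilon> where \<epsilon>: "\<And>n::nat. 0 < \<epsilon> n" "\<And>n. \<epsilon> n \<le> r"
    and s: "AE y in lborel. (\<lambda>n. mollify (\<epsilon> n) f0 y) \<longlonglongrightarrow> f0 y"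
    by (rule mollify_AE_subseq2[OF f0(1) f0(1) r(1)]) blast
  have z: "mollify_deriv (\<epsilon> n) f0 h y = 0" if "y \<in> ball x r" for n h y
  proof -
    have "cball y (\<epsilon> n) \<subseteq> ?K"
    proof
      fix w assume "w \<in> cball y (\<epsilon> n)"
      then have "dist x w \<le> dist x y + dist y w" "dist y w \<le> r" "dist x y < r"
        using that \<epsilon>(2)[of n] by (auto intro: dist_triangle)
      then show "w \<in> ?K" by simp
    qed
    from mollify_weak_deriv[OF \<Omega> \<psi> compact_cball r(2) f0 _ _ \<epsilon>(1) this, of "\<lambda>_. 0"]
    show ?thesis by (simp add: mollify_def)
  qed
  have const: "mollify (\<epsilon> n) f0 y = mollify (\<epsilon> n) f0 x" if y: "y \<in> ball x r" for n y
  proof -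
    have in_ball: "x + t *\<^sub>R (y - x) \<in> ball x r" if "t \<in> {0..1}" for t
    proof -
      have "norm (t *\<^sub>R (y - x)) \<le> norm (y - x)"
        using that by (auto intro: mult_left_le_one_le)
      then show ?thesis using y by (simp add: dist_norm norm_minus_commute)
    qed
    have "\<exists>c. \<forall>t\<in>{0..1::real}. mollify (\<epsilon> n) f0 (x + t *\<^sub>R (y - x)) = c"
    proof (rule has_field_derivative_zero_constant)
      show "((\<lambda>t. mollify (\<epsilon> n) f0 (x + t *\<^sub>R (y - x))) has_field_derivative 0) (at t within {0..1})" if "t \<in> {0..1}" for t
        using mollify_has_derivative[OF \<epsilon>(1) f0(1), of n x "y - x" t] z[OF in_ball[OF that]]
        by (auto intro: has_field_derivative_at_within)
    qed auto
    then obtain c where c: "\<And>t. t \<in> {0..1::real} \<Longrightarrow> mollify (\<epsilon> n) f0 (x + t *\<^sub>R (y - x)) = c" by blast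
    from c[of 0] c[of 1] show ?thesis by simp
  qed
  \<comment> \<open>Convergence at the centre is not known in advance: it is forced by any point of
    the ball at which the mollifications converge, as they take the same values there.\<close>
  define c where "c = lim (\<lambda>n. mollify (\<epsilon> n) f0 x)"
  have "AE y in lborel. y \<in> ball x r \<longrightarrow> \<psi> y = c"
    using s f0(2)
  proof eventually_elim
    case (elim y)
    show ?case
    proof
      assume y: "y \<in> ball x r"
      then have "(\<lambda>n. mollify (\<epsilon> n) f0 x) \<longlonglongrightarrow> f0 y" using elim(1) const by simp
      then have "f0 y = c" unfolding c_def by (rule limI[symmetric])
      moreover have "y \<in> ?K" using y r(1) by simp
      ultimately show "\<psi> y = c" using elim(2) by simp
    qed
  qed
  then show ?thesis using that AE_completion by blast
qed

text \<open>The local constants are regarded as a function of the centre. Balls that overlap have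
  equal constants, so this function is locally constant, and connectedness of \<Omega> makes it
  constant.\<close>

lemma weak_deriv_zero_const:
  assumes \<Omega>: "open \<Omega>" "connected \<Omega>" and \<psi>: "\<And>h. weak_deriv \<Omega> h \<psi> (\<lambda>_. 0)"
  obtains c where "AE x in lebesgue_on \<Omega>. \<psi> x = c"
proof -
  have "\<exists>r c. 0 < r \<and> (AE y in lebesgue. y \<in> ball x r \<longrightarrow> \<psi> y = c)" if x: "x \<in> \<Omega>" for x
  proof -
    obtain R where R: "0 < R" "cball x R \<subseteq> \<Omega>" using open_contains_cball_eq[OF \<Omega>(1)] x by blast
    have R2: "0 < R / 2" "cball x (2 * (R / 2)) \<subseteq> \<Omega>" using R by simp_all
    from weak_deriv_zero_locally_const[OF \<Omega>(1) \<psi> R2] obtain c where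
      "AE y in lebesgue. y \<in> ball x (R / 2) \<longrightarrow> \<psi> y = c" .
    with R2(1) show ?thesis by blast
  qed
  then obtain r c where r: "\<And>x. x \<in> \<Omega> \<Longrightarrow> 0 < r x" and
    c: "\<And>x. x \<in> \<Omega> \<Longrightarrow> AE y in lebesgue. y \<in> ball x (r x) \<longrightarrow> \<psi> y = c x"
    by metis
  have ceq: "c x = c y" if "x \<in> \<Omega>" "y \<in> \<Omega>" "y \<in> ball x (r x)" for x y
  proof (rule ccontr)
    assume "c x \<noteq> c y"
    let ?U = "ball x (r x) \<inter> ball y (r y)"
    have "AE z in lebesgue. z \<in> - ?U"
      using c[OF that(1)] c[OF that(2)] by eventually_elim (use \<open>c x \<noteq> c y\<close> in auto)
    \<comment> \<open>A closed set that contains almost every point is the whole space; yet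
      \<open>y\<close> lies in both balls, so it cannot belong to the complement of the
      overlap.\<close>
    then have "y \<in> - ?U"
      by (intro mem_closed_if_AE_lebesgue) (auto intro!: closed_Compl open_Int)
    then show False using that r[OF that(2)] by simp
  qed
  show ?thesis
  proof (cases "\<Omega> = {}")
    case True
    then show ?thesis using that[of 0] by (simp add: AE_lebesgue_on_open_iff)
  next
    case False
    then obtain x0 where x0: "x0 \<in> \<Omega>" by blast
    have cc: "c x = c x0" if "x \<in> \<Omega>" for x
    proof (rule connected_local_const[OF \<Omega>(2) that x0])
      show "\<forall>a\<in>\<Omega>. \<forall>\<^sub>F b in at a within \<Omega>. c a = c b"
      proof
        fix a assume a: "a \<in> \<Omega>"
        have "c a = c b" if "b \<in> \<Omega>" "dist b a < r a" for b
          using ceq[OF a that(1)] that(2) by (simp add: dist_commute)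
        then show "\<forall>\<^sub>F b in at a within \<Omega>. c a = c b"
          unfolding eventually_at using r[OF a] by blast
      qed
    qed
    have "AE x in lebesgue. x \<in> K \<longrightarrow> \<psi> x = c x0" if K: "compact K" "K \<subseteq> \<Omega>" for K
    proof -
      obtain F where F: "F \<subseteq> K" "finite F" "K \<subseteq> (\<Union>x\<in>F. ball x (r x))"
      proof (rule compactE_image[OF K(1)])
        show "K \<subseteq> (\<Union>x\<in>K. ball x (r x))" using r K(2) by force
      qed auto
      have "AE y in lebesgue. \<forall>x\<in>F. y \<in> ball x (r x) \<longrightarrow> \<psi> y = c x"
        using c F K(2) by (intro AE_finite_allI) auto
      then show ?thesis
      proof eventually_elim
        case (elim y)
        show ?case
        proof
          assume "y \<in> K"
          then obtain x where x: "x \<in> F" "y \<in> ball x (r x)" using F(3) by blast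
          have "x \<in> \<Omega>" using x(1) F(1) K(2) by blast
          then show "\<psi> y = c x0" using elim x cc by metis
        qed
      qed
    qed
    then show ?thesis by (rule that[OF AE_lebesgue_on_openI[OF \<Omega>(1)]])
  qed
qed

text \<open>By translation invariance every difference quotient of \<open>u\<close> has integral 0,
  and dominated convergence passes this on to the derivative. Any direction is treated at once,
  without iterated integrals in coordinates.\<close>

lemma integral_directional_derivative_eq_0:
  fixes u du :: "'a::euclidean_space \<Rightarrow> real"
  assumes c: "continuous_on UNIV u" "continuous_on UNIV du" and K: "compact K"
    and z: "\<And>x. x \<notin> K \<Longrightarrow> u x = 0" "\<And>x. x \<notin> K \<Longrightarrow> du x = 0"
    and D: "\<And>x s. ((\<lambda>s. u (x + s *\<^sub>R h)) has_real_derivative du (x + s *\<^sub>R h)) (at s)"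
  shows "(\<integral>x. du x \<partial>lborel) = 0"
proof -
  have um[measurable]: "u \<in> borel_measurable borel" "du \<in> borel_measurable borel"
    using c by (auto intro: borel_measurable_continuous_onI)
  have ui: "integrable lborel u" by (rule integrable_lborel_compact_support[OF c(1) K z(1)])
  obtain B where B: "\<And>x. norm (du x) \<le> B" using bounded_compact_support[OF c(2) K z(2)] by blast
  define \<sigma> where "\<sigma> n = inverse (real (Suc n))" for n
  have \<sigma>: "0 < \<sigma> n" "\<sigma> n \<le> 1" "\<sigma> n \<noteq> 0" for n
    by (auto simp: \<sigma>_def field_simps)
  have \<sigma>0: "\<sigma> \<longlonglongrightarrow> 0" unfolding \<sigma>_def by (rule LIMSEQ_inverse_real_of_nat)
  define q where "q n x = (u (\<sigma> n *\<^sub>R h + x) - u x) / \<sigma> n" for n x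
  \<comment> \<open>All increments satisfy \<open>\<sigma> n \<le> 1\<close>, so this enlargement of
    \<open>K\<close> by \<open>norm h\<close> contains the supports of all difference quotients and
    carries the dominating function.\<close>
  define K' where "K' = {x + y |x y. x \<in> K \<and> y \<in> cball 0 (norm h)}"
  have K': "compact K'" unfolding K'_def by (rule compact_sums[OF K compact_cball])
  then have K'm: "K' \<in> sets lborel" "emeasure lborel K' < \<infinity>"
    using emeasure_bounded_finite[OF compact_imp_bounded[OF K']] by (auto simp: borel_compact)
  have q0: "q n x = 0" if "x \<notin> K'" for n x
  proof -
    have "x \<notin> K"
    proof
      assume "x \<in> K"
      then have "x + 0 \<in> K'" unfolding K'_def by (intro CollectI exI[of _ x] exI[of _ 0]) auto
      then show False using that by simp
    qed
    moreover have "\<sigma> n *\<^sub>R h + x \<notin> K"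
    proof
      assume "\<sigma> n *\<^sub>R h + x \<in> K"
      moreover have "norm (- (\<sigma> n *\<^sub>R h)) \<le> norm h"
        using \<sigma>[of n] by (simp add: mult_left_le_one_le)
      ultimately have "(\<sigma> n *\<^sub>R h + x) + (- (\<sigma> n *\<^sub>R h)) \<in> K'"
        unfolding K'_def by (intro CollectI exI[of _ "\<sigma> n *\<^sub>R h + x"] exI[of _ "- (\<sigma> n *\<^sub>R h)"]) auto
      then show False using that by simp
    qed
    ultimately show ?thesis using z(1) by (simp add: q_def)
  qed
  have "(\<lambda>n. \<integral>x. q n x \<partial>lborel) \<longlonglongrightarrow> (\<integral>x. du x \<partial>lborel)"
  proof (rule integral_dominated_convergence[where w = "\<lambda>x. B * indicator K' x"])
    show "integrable lborel (\<lambda>x. B * indicator K' x)" using K'm by simp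
    show "AE x in lborel. (\<lambda>n. q n x) \<longlonglongrightarrow> du x"
    proof (rule AE_I2)
      fix x
      have "(\<lambda>s. (u (x + (0 + s) *\<^sub>R h) - u (x + 0 *\<^sub>R h)) / s) \<midarrow>0\<rightarrow> du (x + 0 *\<^sub>R h)"
        using D[of x 0] unfolding DERIV_def .
      then have "(\<lambda>n. (u (x + (0 + \<sigma> n) *\<^sub>R h) - u (x + 0 *\<^sub>R h)) / \<sigma> n) \<longlonglongrightarrow> du (x + 0 *\<^sub>R h)"
        using \<sigma>(3) \<sigma>0 unfolding LIMSEQ_SEQ_conv[symmetric] by blast
      then show "(\<lambda>n. q n x) \<longlonglongrightarrow> du x" by (simp add: q_def add.commute)
    qed
    show "AE x in lborel. norm (q n x) \<le> B * indicator K' x" for n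
    proof (rule AE_I2)
      fix x
      have "norm (u (x + \<sigma> n *\<^sub>R h) - u (x + 0 *\<^sub>R h)) \<le> B * norm (\<sigma> n - 0)"
        by (rule field_differentiable_bound[where S = UNIV]) (use D B in auto)
      then have "norm (q n x) \<le> B"
        using \<sigma>[of n] by (simp add: q_def add.commute divide_le_eq)
      then show "norm (q n x) \<le> B * indicator K' x"
        using q0[of x n] by (simp add: indicator_def)
    qed
  qed (auto simp: q_def)
  moreover have "(\<integral>x. q n x \<partial>lborel) = 0" for n
  proof -
    have "integrable lborel (\<lambda>x. u (\<sigma> n *\<^sub>R h + x))" using ui integrable_translation_iff by blast
    then have "(\<integral>x. q n x \<partial>lborel) = ((\<integral>x. u (\<sigma> n *\<^sub>R h + x) \<partial>lborel) - (\<integral>x. u x \<partial>lborel)) / \<sigma> n"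
      unfolding q_def using ui by simp
    also have "\<dots> = 0" using integral_translation[OF um(1)] by simp
    finally show ?thesis .
  qed
  ultimately have "(\<lambda>n::nat. 0) \<longlonglongrightarrow> (\<integral>x. du x \<partial>lborel)" by simp
  then show ?thesis by (rule LIMSEQ_unique) (rule tendsto_const)
qed

text \<open>Dominated convergence on both sides of the weak formulation. Locally integrable
  majorants are enough, because they are multiplied by a continuous function of compact
  support.\<close>

lemma weak_deriv_limit:
  assumes \<Omega>: "open \<Omega>" and n: "\<And>n::nat. weak_deriv \<Omega> h (\<psi> n) (g n)"
    and m: "\<psi>' \<in> borel_measurable (lebesgue_on \<Omega>)" "g' \<in> borel_measurable (lebesgue_on \<Omega>)"
    and H: "loc_integrable \<Omega> H" "loc_integrable \<Omega> G"
    and lim: "AE x in lebesgue_on \<Omega>. (\<lambda>n. \<psi> n x) \<longlonglongrightarrow> \<psi>' x" "AE x in lebesgue_on \<Omega>. (\<lambda>n. g n x) \<longlonglongrightarrow> g' x"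
    and bd: "\<And>n. AE x in lebesgue_on \<Omega>. \<bar>\<psi> n x\<bar> \<le> H x" "\<And>n. AE x in lebesgue_on \<Omega>. \<bar>g n x\<bar> \<le> G x"
  shows "weak_deriv \<Omega> h \<psi>' g'"
proof -
  have loc: "loc_integrable \<Omega> f'"
    if "\<And>n::nat. loc_integrable \<Omega> (f n)" "f' \<in> borel_measurable (lebesgue_on \<Omega>)" "loc_integrable \<Omega> F"
      "AE x in lebesgue_on \<Omega>. (\<lambda>n. f n x) \<longlonglongrightarrow> f' x" "\<And>n. AE x in lebesgue_on \<Omega>. \<bar>f n x\<bar> \<le> F x"
    for f :: "nat \<Rightarrow> 'a \<Rightarrow> real" and f' F
  proof (rule loc_integrable_bound[OF \<Omega> that(2,3)])
    have "AE x in lebesgue_on \<Omega>. \<forall>n. \<bar>f n x\<bar> \<le> F x"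
      unfolding AE_all_countable using that(5) by blast
    then show "AE x in lebesgue_on \<Omega>. norm (f' x) \<le> F x"
      using that(4)
    proof eventually_elim
      case (elim x)
      show ?case
        by (rule LIMSEQ_le_const2[OF tendsto_norm[OF elim(2)]]) (use elim(1) in simp)
    qed
  qed
  have int: "(\<lambda>n. \<integral>x. f n x * k x \<partial>lebesgue_on \<Omega>) \<longlonglongrightarrow> (\<integral>x. f' x * k x \<partial>lebesgue_on \<Omega>)"
    if "\<And>n::nat. loc_integrable \<Omega> (f n)" "f' \<in> borel_measurable (lebesgue_on \<Omega>)" "loc_integrable \<Omega> F"
      "AE x in lebesgue_on \<Omega>. (\<lambda>n. f n x) \<longlonglongrightarrow> f' x" "\<And>n. AE x in lebesgue_on \<Omega>. \<bar>f n x\<bar> \<le> F x"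
      and k: "continuous_on UNIV k" "compact K" "K \<subseteq> \<Omega>" "\<And>x. x \<notin> K \<Longrightarrow> k x = 0"
    for f :: "nat \<Rightarrow> 'a \<Rightarrow> real" and f' F and k :: "'a \<Rightarrow> real" and K
  proof (rule integral_dominated_convergence[where w = "\<lambda>x. F x * \<bar>k x\<bar>"])
    have km: "k \<in> borel_measurable (lebesgue_on \<Omega>)"
      using borel_measurable_continuous_onI[OF k(1)] by (intro measurable_restrict_space1 measurable_completion) auto
    show "(\<lambda>x. f' x * k x) \<in> borel_measurable (lebesgue_on \<Omega>)"
      by (rule borel_measurable_times[OF that(2) km])
    show "(\<lambda>x. f n x * k x) \<in> borel_measurable (lebesgue_on \<Omega>)" for n
      by (rule borel_measurable_times[OF loc_integrable_measurable[OF \<Omega> that(1)] km])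
    show "integrable (lebesgue_on \<Omega>) (\<lambda>x. F x * \<bar>k x\<bar>)"
      by (rule integrable_lebesgue_on_compact_support[OF \<Omega> that(3) k(2,3)]) (use k in \<open>auto intro!: continuous_intros\<close>)
    show "AE x in lebesgue_on \<Omega>. (\<lambda>n. f n x * k x) \<longlonglongrightarrow> f' x * k x"
      using that(4) by eventually_elim (intro tendsto_intros)
    show "AE x in lebesgue_on \<Omega>. norm (f n x * k x) \<le> F x * \<bar>k x\<bar>" for n
      using that(5)[of n] by eventually_elim (auto simp: abs_mult intro!: mult_right_mono)
  qed
  have nl: "loc_integrable \<Omega> (\<psi> n)" "loc_integrable \<Omega> (g n)" for n
    using n[of n] by (auto simp: weak_deriv_def)
  show ?thesis
    unfolding weak_deriv_def
  proof (intro conjI allI impI; (elim conjE)?)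
    show "loc_integrable \<Omega> \<psi>'" by (rule loc[OF nl(1) m(1) H(1) lim(1) bd(1)])
    show "loc_integrable \<Omega> g'" by (rule loc[OF nl(2) m(2) H(2) lim(2) bd(2)])
    fix \<phi> D assume \<phi>: "test_fun \<Omega> \<phi>" "\<forall>x. (\<phi> has_derivative (\<lambda>k. D x \<bullet> k)) (at x)"
    obtain K where K: "compact K" "K \<subseteq> \<Omega>" "\<And>x. x \<notin> K \<Longrightarrow> \<phi> x = 0" "\<And>x. x \<notin> K \<Longrightarrow> D x = 0"
      "continuous_on UNIV \<phi>" "\<And>h. continuous_on UNIV (\<lambda>x. D x \<bullet> h)"
      using test_fun_support[OF \<phi>(1), of D] \<phi>(2) by metis
    have "(\<lambda>n. \<integral>x. \<psi> n x * (D x \<bullet> h) \<partial>lebesgue_on \<Omega>) \<longlonglongrightarrow> (\<integral>x. \<psi>' x * (D x \<bullet> h) \<partial>lebesgue_on \<Omega>)"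
      by (rule int[OF nl(1) m(1) H(1) lim(1) bd(1) K(6,1,2)]) (simp add: K(4))
    moreover have "(\<lambda>n. \<integral>x. g n x * \<phi> x \<partial>lebesgue_on \<Omega>) \<longlonglongrightarrow> (\<integral>x. g' x * \<phi> x \<partial>lebesgue_on \<Omega>)"
      by (rule int[OF nl(2) m(2) H(2) lim(2) bd(2) K(5,1,2)]) (simp add: K(3))
    moreover have "(\<integral>x. \<psi> n x * (D x \<bullet> h) \<partial>lebesgue_on \<Omega>) = - (\<integral>x. g n x * \<phi> x \<partial>lebesgue_on \<Omega>)" for n
      using n[of n] \<phi> by (auto simp: weak_deriv_def)
    ultimately have "(\<lambda>n. - (\<integral>x. g n x * \<phi> x \<partial>lebesgue_on \<Omega>)) \<longlonglongrightarrow> (\<integral>x. \<psi>' x * (D x \<bullet> h) \<partial>lebesgue_on \<Omega>)"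
      "(\<lambda>n. - (\<integral>x. g n x * \<phi> x \<partial>lebesgue_on \<Omega>)) \<longlonglongrightarrow> - (\<integral>x. g' x * \<phi> x \<partial>lebesgue_on \<Omega>)"
      by (auto intro: tendsto_minus)
    then show "(\<integral>x. \<psi>' x * (D x \<bullet> h) \<partial>lebesgue_on \<Omega>) = - (\<integral>x. g' x * \<phi> x \<partial>lebesgue_on \<Omega>)"
      by (rule LIMSEQ_unique)
  qed
qed

section \<open>The chain rule\<close>

text \<open>The difference of the products is split as \<open>c n * (a n - a')\<close> plus
  \<open>(c n - c') * a'\<close>: the first part is controlled by convergence in L1 and the bound on
  \<open>c n\<close>, the second by dominated convergence.\<close>

lemma L1_tendsto_mult_bounded:
  fixes c :: "nat \<Rightarrow> 'a::euclidean_space \<Rightarrow> real"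
  assumes a: "\<And>n. integrable lborel (a n)" "integrable lborel a'" "(\<lambda>n. \<integral>x. \<bar>a n x - a' x\<bar> \<partial>lborel) \<longlonglongrightarrow> 0"
    and c: "\<And>n. c n \<in> borel_measurable borel" "c' \<in> borel_measurable borel" "\<And>n x. \<bar>c n x\<bar> \<le> M" "\<And>x. \<bar>c' x\<bar> \<le> M"
    and lim: "AE x in lborel. (\<lambda>n. c n x) \<longlonglongrightarrow> c' x"
  shows "(\<lambda>n. \<integral>x. c n x * a n x \<partial>lborel) \<longlonglongrightarrow> (\<integral>x. c' x * a' x \<partial>lborel)"
    "\<And>n. integrable lborel (\<lambda>x. c n x * a n x)" "integrable lborel (\<lambda>x. c' x * a' x)"
proof -
  have bint: "integrable lborel (\<lambda>x. k x * f x)"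
    if "integrable lborel f" "k \<in> borel_measurable borel" "\<And>x. \<bar>k x\<bar> \<le> M" for f k :: "'a \<Rightarrow> real"
  proof (rule Bochner_Integration.integrable_bound)
    show "integrable lborel (\<lambda>x. M * f x)" using that(1) by simp
    show "AE x in lborel. norm (k x * f x) \<le> norm (M * f x)"
      using that(3) by (auto simp: abs_mult intro!: mult_right_mono order_trans[OF that(3) abs_ge_self])
  qed (use that borel_measurable_integrable[OF that(1)] in auto)
  show i: "integrable lborel (\<lambda>x. c n x * a n x)" for n using bint[OF a(1) c(1,3)] .
  show i0: "integrable lborel (\<lambda>x. c' x * a' x)" using bint[OF a(2) c(2,4)] .
  have j: "integrable lborel (\<lambda>x. c n x * (a n x - a' x))" for n
    using bint[OF _ c(1,3)] a(1,2) by simp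
  have k: "integrable lborel (\<lambda>x. c n x * a' x)" for n using bint[OF a(2) c(1,3)] .
  have "(\<lambda>n. \<integral>x. c n x * (a n x - a' x) \<partial>lborel) \<longlonglongrightarrow> 0"
  proof (rule Lim_null_comparison)
    show "(\<lambda>n. M * (\<integral>x. \<bar>a n x - a' x\<bar> \<partial>lborel)) \<longlonglongrightarrow> 0"
      using tendsto_mult_right_zero[OF a(3)] .
    show "\<forall>\<^sub>F n in sequentially. norm (\<integral>x. c n x * (a n x - a' x) \<partial>lborel) \<le> M * (\<integral>x. \<bar>a n x - a' x\<bar> \<partial>lborel)"
    proof (rule always_eventually, rule allI)
      fix n
      have "norm (\<integral>x. c n x * (a n x - a' x) \<partial>lborel) \<le> (\<integral>x. M * \<bar>a n x - a' x\<bar> \<partial>lborel)"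
        using j a(1,2) c(3) by (intro Bochner_Integration.integral_norm_bound_integral) (auto simp: abs_mult intro!: mult_right_mono)
      then show "norm (\<integral>x. c n x * (a n x - a' x) \<partial>lborel) \<le> M * (\<integral>x. \<bar>a n x - a' x\<bar> \<partial>lborel)" by simp
    qed
  qed
  moreover have "(\<lambda>n. \<integral>x. c n x * a' x \<partial>lborel) \<longlonglongrightarrow> (\<integral>x. c' x * a' x \<partial>lborel)"
  proof (rule integral_dominated_convergence[where w = "\<lambda>x. M * \<bar>a' x\<bar>"])
    show "AE x in lborel. (\<lambda>n. c n x * a' x) \<longlonglongrightarrow> c' x * a' x"
      using lim by eventually_elim (intro tendsto_intros)
    show "AE x in lborel. norm (c n x * a' x) \<le> M * \<bar>a' x\<bar>" for n
      using c(3) by (auto simp: abs_mult intro!: mult_right_mono)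
  qed (use a(2) borel_measurable_integrable[OF a(2)] c in auto)
  ultimately have "(\<lambda>n. (\<integral>x. c n x * (a n x - a' x) \<partial>lborel) + (\<integral>x. c n x * a' x \<partial>lborel)) \<longlonglongrightarrow> 0 + (\<integral>x. c' x * a' x \<partial>lborel)"
    by (rule tendsto_add)
  moreover have "(\<integral>x. c n x * (a n x - a' x) \<partial>lborel) + (\<integral>x. c n x * a' x \<partial>lborel) = (\<integral>x. c n x * a n x \<partial>lborel)" for n
    using j[of n] k[of n] by (simp add: Bochner_Integration.integral_add[symmetric] algebra_simps)
  ultimately show "(\<lambda>n. \<integral>x. c n x * a n x \<partial>lborel) \<longlonglongrightarrow> (\<integral>x. c' x * a' x \<partial>lborel)" by simp
qed

lemma has_real_derivativeI:
  assumes "(f has_derivative g) F" "\<And>t. g t = D * t"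
  shows "(f has_real_derivative D) F"
proof -
  have "g = (*) D" using assms(2) by (rule ext)
  with assms(1) show ?thesis by (simp add: has_field_derivative_def)
qed

text \<open>Mean value bound along the segment from \<open>p'\<close> to \<open>p\<close>, where the
  derivative is a combination of the two bounded partial derivatives.\<close>

lemma bounded_partials_lipschitz:
  fixes F F1 F2 :: "real \<times> real \<Rightarrow> real"
  assumes D: "\<And>p. (F has_derivative (\<lambda>k. F1 p * fst k + F2 p * snd k)) (at p)"
    and B: "\<And>p. \<bar>F1 p\<bar> \<le> M" "\<And>p. \<bar>F2 p\<bar> \<le> M"
  shows "\<bar>F p - F p'\<bar> \<le> M * (\<bar>fst p - fst p'\<bar> + \<bar>snd p - snd p'\<bar>)"
proof -
  let ?k = "p - p'"
  let ?d = "\<lambda>s. F1 (p' + s *\<^sub>R ?k) * fst ?k + F2 (p' + s *\<^sub>R ?k) * snd ?k"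
  have d: "((\<lambda>s. F (p' + s *\<^sub>R ?k)) has_real_derivative ?d s) (at s)" for s
  proof -
    have "((\<lambda>s. p' + s *\<^sub>R ?k) has_derivative (\<lambda>t. t *\<^sub>R ?k)) (at s)"
      by (auto intro!: derivative_eq_intros)
    from has_derivative_compose[OF this D] show ?thesis
      by (rule has_real_derivativeI) (simp add: algebra_simps)
  qed
  have "norm (F (p' + 1 *\<^sub>R ?k) - F (p' + 0 *\<^sub>R ?k)) \<le> M * (\<bar>fst ?k\<bar> + \<bar>snd ?k\<bar>) * norm (1 - 0 :: real)"
  proof (rule field_differentiable_bound[where S = UNIV])
    fix s :: real
    have "\<bar>?d s\<bar> \<le> \<bar>F1 (p' + s *\<^sub>R ?k)\<bar> * \<bar>fst ?k\<bar> + \<bar>F2 (p' + s *\<^sub>R ?k)\<bar> * \<bar>snd ?k\<bar>"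
      by (metis abs_mult abs_triangle_ineq)
    also have "\<dots> \<le> M * \<bar>fst ?k\<bar> + M * \<bar>snd ?k\<bar>"
      by (intro add_mono mult_right_mono B) auto
    finally show "norm (?d s) \<le> M * (\<bar>fst ?k\<bar> + \<bar>snd ?k\<bar>)" by (simp add: distrib_left)
  qed (use d in auto)
  then show ?thesis by simp
qed

text \<open>With mollified arguments, the product of \<open>F\<close> and the test function is
  continuously differentiable along lines and compactly supported, so its derivative integrates to
  0. In the limit the coefficients from \<open>F1\<close> and \<open>F2\<close> stay bounded and
  converge almost everywhere, while the mollified derivatives converge in L1.\<close>

lemma weak_deriv_chain:
  fixes F F1 F2 :: "real \<times> real \<Rightarrow> real"
  assumes \<Omega>: "open \<Omega>" and v: "weak_deriv \<Omega> h v a" and w: "weak_deriv \<Omega> h w b"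
    and D: "\<And>p. (F has_derivative (\<lambda>k. F1 p * fst k + F2 p * snd k)) (at p)"
    and c: "continuous_on UNIV F1" "continuous_on UNIV F2"
    and B: "\<And>p. \<bar>F1 p\<bar> \<le> M" "\<And>p. \<bar>F2 p\<bar> \<le> M"
  shows "weak_deriv \<Omega> h (\<lambda>x. F (v x, w x)) (\<lambda>x. F1 (v x, w x) * a x + F2 (v x, w x) * b x)"
proof -
  have lip: "\<bar>F p - F p'\<bar> \<le> M * (\<bar>fst p - fst p'\<bar> + \<bar>snd p - snd p'\<bar>)" for p p'
    by (rule bounded_partials_lipschitz[OF D B])
  have l: "loc_integrable \<Omega> v" "loc_integrable \<Omega> w" "loc_integrable \<Omega> a" "loc_integrable \<Omega> b"
    using v w by (auto simp: weak_deriv_def)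
  note la = l[THEN loc_integrable_abs]
  note lm = l[THEN loc_integrable_measurable[OF \<Omega>]]
  have Fc: "continuous_on UNIV F"
    using D by (auto intro!: continuous_at_imp_continuous_on has_derivative_continuous)
  have comp: "(\<lambda>x. G (v x, w x)) \<in> borel_measurable (lebesgue_on \<Omega>)" if "continuous_on UNIV G" for G :: "real \<times> real \<Rightarrow> real"
    by (rule measurable_compose[OF borel_measurable_Pair[OF lm(1,2)] borel_measurable_continuous_onI[OF that]])
  have M0: "0 \<le> M" using B(1)[of 0] by linarith
  have dm: "(\<lambda>x. F1 (v x, w x) * a x + F2 (v x, w x) * b x) \<in> borel_measurable (lebesgue_on \<Omega>)"
    using comp[OF c(1)] comp[OF c(2)] lm(3,4) by (intro borel_measurable_add borel_measurable_times)
  have lF: "loc_integrable \<Omega> (\<lambda>x. F (v x, w x))"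
  proof (rule loc_integrable_bound[OF \<Omega> comp[OF Fc], where H = "\<lambda>x. \<bar>F 0\<bar> + M * (\<bar>v x\<bar> + \<bar>w x\<bar>)"])
    show "loc_integrable \<Omega> (\<lambda>x. \<bar>F 0\<bar> + M * (\<bar>v x\<bar> + \<bar>w x\<bar>))"
      by (intro loc_integrable_add loc_integrable_cmult loc_integrable_const la)
    show "AE x in lebesgue_on \<Omega>. norm (F (v x, w x)) \<le> \<bar>F 0\<bar> + M * (\<bar>v x\<bar> + \<bar>w x\<bar>)"
    proof (rule AE_I2)
      show "norm (F (v x, w x)) \<le> \<bar>F 0\<bar> + M * (\<bar>v x\<bar> + \<bar>w x\<bar>)" for x
        using lip[of "(v x, w x)" 0] abs_triangle_ineq2[of "F (v x, w x)" "F 0"] by simp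
    qed
  qed
  have ld1: "loc_integrable \<Omega> (\<lambda>x. F1 (v x, w x) * a x)"
    by (rule loc_integrable_bound[OF \<Omega> _ loc_integrable_cmult[OF la(3), of M]])
      (use comp[OF c(1)] lm(3) B in \<open>auto simp: abs_mult intro!: borel_measurable_times mult_right_mono\<close>)
  have ld2: "loc_integrable \<Omega> (\<lambda>x. F2 (v x, w x) * b x)"
    by (rule loc_integrable_bound[OF \<Omega> _ loc_integrable_cmult[OF la(4), of M]])
      (use comp[OF c(2)] lm(4) B in \<open>auto simp: abs_mult intro!: borel_measurable_times mult_right_mono\<close>)
  have ld: "loc_integrable \<Omega> (\<lambda>x. F1 (v x, w x) * a x + F2 (v x, w x) * b x)"
    by (rule loc_integrable_add[OF ld1 ld2])
  show ?thesis
    unfolding weak_deriv_def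
  proof (intro conjI lF ld allI impI, elim conjE)
    fix \<phi> E assume \<phi>: "test_fun \<Omega> \<phi>" and E: "\<forall>x. (\<phi> has_derivative (\<lambda>k. E x \<bullet> k)) (at x)"
    obtain K where K: "compact K" "K \<subseteq> \<Omega>" "\<And>x. x \<notin> K \<Longrightarrow> \<phi> x = 0" "\<And>x. x \<notin> K \<Longrightarrow> E x = 0"
      "continuous_on UNIV \<phi>" "\<And>h. continuous_on UNIV (\<lambda>x. E x \<bullet> h)"
      using test_fun_support[OF \<phi>, of E] E by metis
    obtain \<delta> K' where \<delta>: "0 < \<delta>" "compact K'" "K \<subseteq> K'" "K' \<subseteq> \<Omega>" "\<And>x. x \<in> K \<Longrightarrow> cball x \<delta> \<subseteq> K'"
      using compact_neighbourhood[OF K(1) \<Omega> K(2)] by metis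
    obtain v0 where v0: "integrable lborel v0" "AE x in lborel. v0 x = indicator K' x * v x"
      using loc_integrable_borel_representative[OF l(1) \<delta>(2,4)] by blast
    obtain w0 where w0: "integrable lborel w0" "AE x in lborel. w0 x = indicator K' x * w x"
      using loc_integrable_borel_representative[OF l(2) \<delta>(2,4)] by blast
    obtain a0 where a0: "integrable lborel a0" "AE x in lborel. a0 x = indicator K' x * a x"
      using loc_integrable_borel_representative[OF l(3) \<delta>(2,4)] by blast
    obtain b0 where b0: "integrable lborel b0" "AE x in lborel. b0 x = indicator K' x * b x"
      using loc_integrable_borel_representative[OF l(4) \<delta>(2,4)] by blast
    note m0[measurable] = v0(1)[THEN borel_measurable_integrable, simplified] w0(1)[THEN borel_measurable_integrable, simplified]
      a0(1)[THEN borel_measurable_integrable, simplified] b0(1)[THEN borel_measurable_integrable, simplified]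
    obtain \<epsilon> where \<epsilon>: "\<And>n::nat. 0 < \<epsilon> n" "\<And>n. \<epsilon> n \<le> \<delta>" "\<epsilon> \<longlonglongrightarrow> 0"
      "AE x in lborel. (\<lambda>n. mollify (\<epsilon> n) v0 x) \<longlonglongrightarrow> v0 x"
      "AE x in lborel. (\<lambda>n. mollify (\<epsilon> n) w0 x) \<longlonglongrightarrow> w0 x"
      using mollify_AE_subseq2[OF v0(1) w0(1) \<delta>(1)] by blast
    define vw where "vw n x = (mollify (\<epsilon> n) v0 x, mollify (\<epsilon> n) w0 x)" for n x
    define vw0 where "vw0 x = (v0 x, w0 x)" for x
    have vwc: "continuous_on UNIV (vw n)" for n
      unfolding vw_def by (intro continuous_intros continuous_on_mollify \<epsilon> v0 w0)
    have vwm: "(\<lambda>x. G (vw n x)) \<in> borel_measurable borel" "(\<lambda>x. G (vw0 x)) \<in> borel_measurable borel"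
      if "continuous_on UNIV G" for n and G :: "real \<times> real \<Rightarrow> real"
    proof -
      show "(\<lambda>x. G (vw n x)) \<in> borel_measurable borel"
        by (rule borel_measurable_continuous_onI[OF continuous_on_compose2[OF that vwc]]) auto
      have "vw0 \<in> borel_measurable borel"
        unfolding vw0_def by (rule borel_measurable_Pair) measurable
      from measurable_compose[OF this borel_measurable_continuous_onI[OF that]]
      show "(\<lambda>x. G (vw0 x)) \<in> borel_measurable borel" .
    qed
    have vwlim: "AE x in lborel. (\<lambda>n. G (vw n x)) \<longlonglongrightarrow> G (vw0 x)" if "continuous_on UNIV G" for G :: "real \<times> real \<Rightarrow> real"
      using \<epsilon>(4,5)
    proof eventually_elim
      case (elim x)
      have "(\<lambda>n. vw n x) \<longlonglongrightarrow> vw0 x" unfolding vw_def vw0_def by (rule tendsto_Pair[OF elim])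
      then show ?case
        using that by (intro isCont_tendsto_compose[where g = G]) (auto simp: continuous_on_eq_continuous_at vw0_def)
    qed
    obtain P where P: "\<And>x. norm (\<phi> x) \<le> P" using bounded_compact_support[OF K(5) K(1) K(3)] by blast
    obtain Q where Q: "\<And>x. norm (E x \<bullet> h) \<le> Q"
      using bounded_compact_support[OF K(6)[of h] K(1)] K(4) by (metis inner_zero_left)
    note phim[measurable] = borel_measurable_continuous_onI[OF K(5)] borel_measurable_continuous_onI[OF K(6)[of h]]
    have IBP: "(\<integral>x. F1 (vw n x) * \<phi> x * mollify (\<epsilon> n) a0 x + F2 (vw n x) * \<phi> x * mollify (\<epsilon> n) b0 x + F (vw n x) * (E x \<bullet> h) \<partial>lborel) = 0" for n
    proof -
      let ?du = "\<lambda>x. (F1 (vw n x) * mollify_deriv (\<epsilon> n) v0 h x + F2 (vw n x) * mollify_deriv (\<epsilon> n) w0 h x) * \<phi> x + F (vw n x) * (E x \<bullet> h)"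
      have "(\<integral>x. ?du x \<partial>lborel) = 0"
      proof (rule integral_directional_derivative_eq_0[where u = "\<lambda>x. F (vw n x) * \<phi> x" and h = h, OF _ _ K(1)])
        have cc: "continuous_on UNIV (\<lambda>x. G (vw n x))" if "continuous_on UNIV G" for G :: "real \<times> real \<Rightarrow> real"
          by (rule continuous_on_compose2[OF that vwc]) auto
        show "continuous_on UNIV (\<lambda>x. F (vw n x) * \<phi> x)"
          by (intro continuous_intros cc Fc K)
        show "continuous_on UNIV ?du"
          by (intro continuous_intros cc Fc c K continuous_on_mollify_deriv \<epsilon> v0 w0)
        fix x :: 'a and s :: real
        let ?y = "x + s *\<^sub>R h"
        have d1: "((\<lambda>s. vw n (x + s *\<^sub>R h)) has_derivative (\<lambda>t. (mollify_deriv (\<epsilon> n) v0 h ?y * t, mollify_deriv (\<epsilon> n) w0 h ?y * t))) (at s)"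
          unfolding vw_def
          using mollify_has_derivative[OF \<epsilon>(1) v0(1), of n x h s] mollify_has_derivative[OF \<epsilon>(1) w0(1), of n x h s]
          by (intro has_derivative_Pair) (simp_all add: has_field_derivative_def)
        have dF: "((\<lambda>s. F (vw n (x + s *\<^sub>R h))) has_real_derivative
            (F1 (vw n ?y) * mollify_deriv (\<epsilon> n) v0 h ?y + F2 (vw n ?y) * mollify_deriv (\<epsilon> n) w0 h ?y)) (at s)"
          using has_derivative_compose[OF d1 D] by (rule has_real_derivativeI) (simp add: algebra_simps)
        have "((\<lambda>s. x + s *\<^sub>R h) has_derivative (\<lambda>t. t *\<^sub>R h)) (at s)"
          by (auto intro!: derivative_eq_intros)
        from has_derivative_compose[OF this E[rule_format]]
        have d\<phi>: "((\<lambda>s. \<phi> (x + s *\<^sub>R h)) has_real_derivative (E ?y \<bullet> h)) (at s)"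
          by (rule has_real_derivativeI) simp
        show "((\<lambda>s. F (vw n (x + s *\<^sub>R h)) * \<phi> (x + s *\<^sub>R h)) has_real_derivative ?du (x + s *\<^sub>R h)) (at s)"
          using DERIV_mult[OF dF d\<phi>] by (simp add: algebra_simps)
      qed (use K in auto)
      \<comment> \<open>At points of \<open>K\<close> the kernel ball lies in \<open>K'\<close>, so
        the derivative of the mollification is the mollified weak derivative; off \<open>K\<close>
        the test function and its gradient vanish, and both sides are 0.\<close>
      moreover have "?du x = F1 (vw n x) * \<phi> x * mollify (\<epsilon> n) a0 x + F2 (vw n x) * \<phi> x * mollify (\<epsilon> n) b0 x + F (vw n x) * (E x \<bullet> h)" for x
      proof (cases "x \<in> K")
        case True
        have cb: "cball x (\<epsilon> n) \<subseteq> K'" using \<delta>(5)[OF True] \<epsilon>(2)[of n] by auto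
        show ?thesis
          using mollify_weak_deriv[OF \<Omega> v \<delta>(2,4) v0 a0 \<epsilon>(1) cb] mollify_weak_deriv[OF \<Omega> w \<delta>(2,4) w0 b0 \<epsilon>(1) cb]
          by (simp add: algebra_simps)
      qed (use K in simp)
      ultimately show ?thesis by simp
    qed
    have cb: "\<bar>G (vw n x) * \<phi> x\<bar> \<le> M * P" "\<bar>G (vw0 x) * \<phi> x\<bar> \<le> M * P" if "\<And>p. \<bar>G p\<bar> \<le> M" for G :: "real \<times> real \<Rightarrow> real" and n x
      using that P[of x] M0 by (auto simp: abs_mult vw_def vw0_def intro!: mult_mono)
    have T1: "(\<lambda>n. \<integral>x. G (vw n x) * \<phi> x * mollify (\<epsilon> n) f x \<partial>lborel) \<longlonglongrightarrow> (\<integral>x. G (vw0 x) * \<phi> x * f x \<partial>lborel)"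
       "\<And>n. integrable lborel (\<lambda>x. G (vw n x) * \<phi> x * mollify (\<epsilon> n) f x)" "integrable lborel (\<lambda>x. G (vw0 x) * \<phi> x * f x)"
      if f: "integrable lborel f" and G: "continuous_on UNIV G" "\<And>p. \<bar>G p\<bar> \<le> M" for f and G :: "real \<times> real \<Rightarrow> real"
    proof -
      have cbG: "\<bar>G (vw n x) * \<phi> x\<bar> \<le> M * P" "\<bar>G (vw0 x) * \<phi> x\<bar> \<le> M * P" for n x
        by (rule cb, rule G(2))+
      have "AE x in lborel. (\<lambda>n. G (vw n x) * \<phi> x) \<longlonglongrightarrow> G (vw0 x) * \<phi> x"
        using vwlim[OF G(1)] by eventually_elim (intro tendsto_intros)
      note * = L1_tendsto_mult_bounded[where c = "\<lambda>n x. G (vw n x) * \<phi> x" and c' = "\<lambda>x. G (vw0 x) * \<phi> x" and a' = f and a = "\<lambda>n. mollify (\<epsilon> n) f" and M = "M * P",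
          OF integrable_mollify[OF \<epsilon>(1) f] f mollify_L1_tendsto[OF f \<epsilon>(1,3)] borel_measurable_times[OF vwm(1)[OF G(1)] phim(1)]
           borel_measurable_times[OF vwm(2)[OF G(1)] phim(1)] cbG this]
      show "(\<lambda>n. \<integral>x. G (vw n x) * \<phi> x * mollify (\<epsilon> n) f x \<partial>lborel) \<longlonglongrightarrow> (\<integral>x. G (vw0 x) * \<phi> x * f x \<partial>lborel)" by (rule *(1))
      show "integrable lborel (\<lambda>x. G (vw n x) * \<phi> x * mollify (\<epsilon> n) f x)" for n by (rule *(2))
      show "integrable lborel (\<lambda>x. G (vw0 x) * \<phi> x * f x)" by (rule *(3))
    qed
    \<comment> \<open>\<open>F\<close> may be unbounded, so the term containing \<open>F\<close>
      itself is compared through the Lipschitz estimate with this quantity, whose integral tends to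
      0.\<close>
    define R where "R n x = \<bar>mollify (\<epsilon> n) v0 x - v0 x\<bar> + \<bar>mollify (\<epsilon> n) w0 x - w0 x\<bar>" for n x
    have Ri: "integrable lborel (R n)" for n
      unfolding R_def using integrable_mollify[OF \<epsilon>(1) v0(1)] integrable_mollify[OF \<epsilon>(1) w0(1)] v0(1) w0(1) by auto
    have R0: "(\<lambda>n. \<integral>x. R n x \<partial>lborel) \<longlonglongrightarrow> 0"
    proof -
      have "(\<integral>x. R n x \<partial>lborel) = (\<integral>x. \<bar>mollify (\<epsilon> n) v0 x - v0 x\<bar> \<partial>lborel) + (\<integral>x. \<bar>mollify (\<epsilon> n) w0 x - w0 x\<bar> \<partial>lborel)" for n
        unfolding R_def using integrable_mollify[OF \<epsilon>(1) v0(1)] integrable_mollify[OF \<epsilon>(1) w0(1)] v0(1) w0(1)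
        by (intro Bochner_Integration.integral_add) auto
      then show ?thesis
        using tendsto_add[OF mollify_L1_tendsto[OF v0(1) \<epsilon>(1,3)] mollify_L1_tendsto[OF w0(1) \<epsilon>(1,3)]] by simp
    qed
    have Fi: "integrable lborel (\<lambda>x. F (vw n x) * (E x \<bullet> h))" for n
      by (rule integrable_lborel_compact_support[OF
            continuous_on_mult[OF continuous_on_compose2[OF Fc vwc subset_UNIV] K(6)] K(1)]) (simp add: K(4))
    have Fd: "norm (F (vw0 x) * (E x \<bullet> h) - F (vw n x) * (E x \<bullet> h)) \<le> (M * Q) * R n x" for n x
    proof -
      have "\<bar>F (vw0 x) - F (vw n x)\<bar> * \<bar>E x \<bullet> h\<bar> \<le> (M * R n x) * Q"
        using lip[of "vw0 x" "vw n x"] Q[of x] M0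
        by (intro mult_mono) (auto simp: R_def vw_def vw0_def abs_minus_commute)
      then show ?thesis by (simp add: left_diff_distrib[symmetric] abs_mult mult_ac)
    qed
    have Fdi: "integrable lborel (\<lambda>x. F (vw0 x) * (E x \<bullet> h) - F (vw n x) * (E x \<bullet> h))" for n
    proof (rule Bochner_Integration.integrable_bound[where f = "\<lambda>x. (M * Q) * R n x"])
      show "(\<lambda>x. F (vw0 x) * (E x \<bullet> h) - F (vw n x) * (E x \<bullet> h)) \<in> borel_measurable lborel"
        using vwm[OF Fc] phim(2) by simp
      show "AE x in lborel. norm (F (vw0 x) * (E x \<bullet> h) - F (vw n x) * (E x \<bullet> h)) \<le> norm (M * Q * R n x)"
        by (intro AE_I2 order_trans[OF Fd]) simp
    qed (use Ri in simp)
    have F0i: "integrable lborel (\<lambda>x. F (vw0 x) * (E x \<bullet> h))"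
      using Bochner_Integration.integrable_add[OF Fdi[of 0] Fi[of 0]] by simp
    have "(\<lambda>n. \<integral>x. F (vw0 x) * (E x \<bullet> h) - F (vw n x) * (E x \<bullet> h) \<partial>lborel) \<longlonglongrightarrow> 0"
    proof (rule Lim_null_comparison)
      show "(\<lambda>n. (M * Q) * (\<integral>x. R n x \<partial>lborel)) \<longlonglongrightarrow> 0" using tendsto_mult_right_zero[OF R0] .
      have "norm (\<integral>x. F (vw0 x) * (E x \<bullet> h) - F (vw n x) * (E x \<bullet> h) \<partial>lborel) \<le> (\<integral>x. (M * Q) * R n x \<partial>lborel)" for n
        using Fd Fdi Ri by (intro Bochner_Integration.integral_norm_bound_integral) auto
      then show "\<forall>\<^sub>F n in sequentially. norm (\<integral>x. F (vw0 x) * (E x \<bullet> h) - F (vw n x) * (E x \<bullet> h) \<partial>lborel) \<le> (M * Q) * (\<integral>x. R n x \<partial>lborel)"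
        by simp
    qed
    then have "(\<lambda>n. (\<integral>x. F (vw0 x) * (E x \<bullet> h) \<partial>lborel) - (\<integral>x. F (vw n x) * (E x \<bullet> h) \<partial>lborel)) \<longlonglongrightarrow> 0"
      using Fi F0i by simp
    from tendsto_diff[OF tendsto_const[of "\<integral>x. F (vw0 x) * (E x \<bullet> h) \<partial>lborel"] this]
    have T2: "(\<lambda>n. \<integral>x. F (vw n x) * (E x \<bullet> h) \<partial>lborel) \<longlonglongrightarrow> (\<integral>x. F (vw0 x) * (E x \<bullet> h) \<partial>lborel)"
      by simp
    note A = T1[OF a0(1) c(1) B(1)] and A' = T1[OF b0(1) c(2) B(2)]
    have "(\<integral>x. F1 (vw n x) * \<phi> x * mollify (\<epsilon> n) a0 x \<partial>lborel) + (\<integral>x. F2 (vw n x) * \<phi> x * mollify (\<epsilon> n) b0 x \<partial>lborel)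
         + (\<integral>x. F (vw n x) * (E x \<bullet> h) \<partial>lborel) = 0" for n
      using IBP[of n] A(2)[of n] A'(2)[of n] Fi[of n] by simp
    moreover have "(\<lambda>n. (\<integral>x. F1 (vw n x) * \<phi> x * mollify (\<epsilon> n) a0 x \<partial>lborel) + (\<integral>x. F2 (vw n x) * \<phi> x * mollify (\<epsilon> n) b0 x \<partial>lborel)
         + (\<integral>x. F (vw n x) * (E x \<bullet> h) \<partial>lborel)) \<longlonglongrightarrow>
        (\<integral>x. F1 (vw0 x) * \<phi> x * a0 x \<partial>lborel) + (\<integral>x. F2 (vw0 x) * \<phi> x * b0 x \<partial>lborel) + (\<integral>x. F (vw0 x) * (E x \<bullet> h) \<partial>lborel)"
      by (intro tendsto_add A(1) A'(1) T2)
    ultimately have "(\<integral>x. F1 (vw0 x) * \<phi> x * a0 x \<partial>lborel) + (\<integral>x. F2 (vw0 x) * \<phi> x * b0 x \<partial>lborel) + (\<integral>x. F (vw0 x) * (E x \<bullet> h) \<partial>lborel) = 0"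
      by (simp add: LIMSEQ_const_iff)
    then have limit: "(\<integral>x. F (vw0 x) * (E x \<bullet> h) \<partial>lborel) = - (\<integral>x. (F1 (vw0 x) * a0 x + F2 (vw0 x) * b0 x) * \<phi> x \<partial>lborel)"
      using Bochner_Integration.integral_add[OF A(3) A'(3)] by (simp add: algebra_simps)
    have aeK: "AE x in lborel. x \<in> K \<longrightarrow> v0 x = v x \<and> w0 x = w x \<and> a0 x = a x \<and> b0 x = b x"
      using v0(2) w0(2) a0(2) b0(2) by eventually_elim (use \<delta>(3) in \<open>auto simp: indicator_def split: if_splits\<close>)
    have "(\<integral>x. F (v x, w x) * (E x \<bullet> h) \<partial>lebesgue_on \<Omega>) = (\<integral>x. F (vw0 x) * (E x \<bullet> h) \<partial>lborel)"
    proof (rule integral_lebesgue_on_compact_support[OF \<Omega> lF K(1,2) K(6)])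
      show "AE x in lborel. x \<in> K \<longrightarrow> F (vw0 x) = F (v x, w x)"
        using aeK by eventually_elim (simp add: vw0_def)
    qed (use K(4) vwm[OF Fc] in auto)
    moreover have "(\<integral>x. (F1 (v x, w x) * a x + F2 (v x, w x) * b x) * \<phi> x \<partial>lebesgue_on \<Omega>)
        = (\<integral>x. (F1 (vw0 x) * a0 x + F2 (vw0 x) * b0 x) * \<phi> x \<partial>lborel)"
    proof (rule integral_lebesgue_on_compact_support[OF \<Omega> ld K(1,2) K(5)])
      show "AE x in lborel. x \<in> K \<longrightarrow> F1 (vw0 x) * a0 x + F2 (vw0 x) * b0 x = F1 (v x, w x) * a x + F2 (v x, w x) * b x"
        using aeK by eventually_elim (simp add: vw0_def)
    qed (use K(3) vwm[OF c(1)] vwm[OF c(2)] m0 in auto)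
    ultimately show "(\<integral>x. F (v x, w x) * (E x \<bullet> h) \<partial>lebesgue_on \<Omega>)
        = - (\<integral>x. (F1 (v x, w x) * a x + F2 (v x, w x) * b x) * \<phi> x \<partial>lebesgue_on \<Omega>)"
      using limit by simp
  qed
qed

section \<open>Pointwise convexity\<close>

text \<open>Mean value theorem between 1 and \<open>y\<close>: the derivative of the power exceeds
  \<open>r\<close> to the right of 1 and is smaller than \<open>r\<close> to the left of it.\<close>

lemma powr_bernoulli_strict:
  fixes y r :: real
  assumes "0 \<le> y" "1 < r" "y \<noteq> 1"
  shows "1 + r * (y - 1) < y powr r"
proof (cases "y = 0")
  case True
  then show ?thesis using assms by simp
next
  case False
  then have y: "0 < y" using assms by simp
  have d: "((\<lambda>z. z powr r) has_real_derivative r * z powr (r - 1)) (at z)" if "0 < z" for z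
    using that by (auto intro!: derivative_eq_intros)
  show ?thesis
  proof (cases "1 < y")
    case True
    then obtain z where z: "1 < z" "z < y" "y powr r - 1 powr r = (y - 1) * (r * z powr (r - 1))"
      using MVT2[of 1 y "\<lambda>z. z powr r" "\<lambda>z. r * z powr (r - 1)"] d by force
    have "1 < z powr (r - 1)" using z(1) assms(2) by (simp add: gr_one_powr)
    then have "r * (y - 1) * 1 < r * (y - 1) * z powr (r - 1)"
      using True assms(2) by (intro mult_strict_left_mono) auto
    with z(3) show ?thesis by (simp add: mult_ac)
  next
    case False
    then have y1: "y < 1" using assms(3) by simp
    then obtain z where z: "y < z" "z < 1" "1 powr r - y powr r = (1 - y) * (r * z powr (r - 1))"
      using MVT2[of y 1 "\<lambda>z. z powr r" "\<lambda>z. r * z powr (r - 1)"] d y by force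
    have "z powr (r - 1) < 1 powr (r - 1)" using z y assms(2) by (intro powr_less_mono2) auto
    then have "r * (1 - y) * z powr (r - 1) < r * (1 - y) * 1"
      using y1 assms(2) by (intro mult_strict_left_mono) auto
    with z(3) show ?thesis by (simp add: algebra_simps)
  qed
qed

text \<open>The power lies strictly above its tangent at the mean \<open>c\<close>, except at
  \<open>c\<close> itself. Homogeneity reduces the tangent inequality to the strict Bernoulli
  inequality for \<open>x / c\<close>, and the linear terms cancel in the average.\<close>

lemma powr_convex_strict:
  fixes A B r t :: real
  assumes "0 \<le> A" "0 \<le> B" "1 < r" "0 < t" "t < 1" "A \<noteq> B"
  shows "((1 - t) * A + t * B) powr r < (1 - t) * A powr r + t * B powr r"
proof -
  define c where "c = (1 - t) * A + t * B"
  have "0 < A \<or> 0 < B" using assms by auto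
  then have c: "0 < c" unfolding c_def using assms by (auto intro: add_pos_nonneg add_nonneg_pos)
  have ne: "A \<noteq> c" "B \<noteq> c"
  proof -
    have "A - c = t * (A - B)" "B - c = (1 - t) * (B - A)" by (simp_all add: c_def algebra_simps)
    moreover have "t * (A - B) \<noteq> 0" "(1 - t) * (B - A) \<noteq> 0" using assms by auto
    ultimately show "A \<noteq> c" "B \<noteq> c" by auto
  qed
  have tangent: "c powr r * (1 + r * (x / c - 1)) < x powr r" if "0 \<le> x" "x \<noteq> c" for x
  proof -
    have "1 + r * (x / c - 1) < (x / c) powr r"
      using powr_bernoulli_strict[of "x / c" r] that c assms(3) by simp
    then have "c powr r * (1 + r * (x / c - 1)) < c powr r * (x / c) powr r"
      using c by (intro mult_strict_left_mono) auto
    also have "\<dots> = x powr r" using c that by (simp add: powr_divide)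
    finally show ?thesis .
  qed
  have "c powr r = (1 - t) * (c powr r * (1 + r * (A / c - 1))) + t * (c powr r * (1 + r * (B / c - 1)))"
  proof -
    have "(1 - t) * (A / c - 1) + t * (B / c - 1) = ((1 - t) * A + t * B) / c - 1"
      by (simp add: diff_divide_distrib add_divide_distrib algebra_simps)
    also have "\<dots> = 0" using c by (simp add: c_def[symmetric])
    finally have 0: "(1 - t) * (A / c - 1) + t * (B / c - 1) = 0" .
    have "(1 - t) * (c powr r * (1 + r * (A / c - 1))) + t * (c powr r * (1 + r * (B / c - 1)))
       = c powr r * (1 + r * ((1 - t) * (A / c - 1) + t * (B / c - 1)))"
      by (simp add: algebra_simps)
    then show ?thesis using 0 by simp
  qed
  also have "\<dots> < (1 - t) * A powr r + t * B powr r"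
    using tangent[OF assms(1) ne(1)] tangent[OF assms(2) ne(2)] assms
    by (intro add_strict_mono mult_strict_left_mono) auto
  finally show ?thesis by (simp add: c_def)
qed

lemma powr_convex:
  fixes A B r t :: real
  assumes "0 \<le> A" "0 \<le> B" "1 \<le> r" "0 \<le> t" "t \<le> 1"
  shows "((1 - t) * A + t * B) powr r \<le> (1 - t) * A powr r + t * B powr r"
proof -
  consider "r = 1" | "t = 0" | "t = 1" | "A = B" | "1 < r" "0 < t" "t < 1" "A \<noteq> B"
    using assms by linarith
  then show ?thesis
  proof cases
    case 1
    then show ?thesis using assms by simp
  next
    case 4
    then show ?thesis by (simp add: algebra_simps)
  next
    case 5
    then show ?thesis using powr_convex_strict[of A B r t] assms by simp
  qed simp_all
qed

section \<open>Convexity of powers of the norm and its equality case\<close>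

lemma norm_powr_convex:
  fixes x y :: "'a::real_normed_vector"
  assumes "1 \<le> r" "0 \<le> t" "t \<le> 1"
  shows "norm ((1 - t) *\<^sub>R x + t *\<^sub>R y) powr r \<le> (1 - t) * norm x powr r + t * norm y powr r"
proof -
  have "norm ((1 - t) *\<^sub>R x + t *\<^sub>R y) \<le> (1 - t) * norm x + t * norm y"
    using norm_triangle_ineq[of "(1 - t) *\<^sub>R x" "t *\<^sub>R y"] assms by simp
  then have "norm ((1 - t) *\<^sub>R x + t *\<^sub>R y) powr r \<le> ((1 - t) * norm x + t * norm y) powr r"
    using assms by (intro powr_mono2) auto
  also have "\<dots> \<le> (1 - t) * norm x powr r + t * norm y powr r"
    using assms by (intro powr_convex) auto
  finally show ?thesis .
qed

text \<open>Strict convexity of the power first forces \<open>norm x = norm y\<close>; then the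
  combination has this norm as well. In an inner product space
  \<open>(1 - t) * t * (norm (x - y))^2\<close> is the defect of the squared norm from its average,
  which is now 0.\<close>

lemma norm_powr_convex_eq:
  fixes x y :: "'a::real_inner"
  assumes r: "1 < r" and t: "0 < t" "t < 1"
    and eq: "norm ((1 - t) *\<^sub>R x + t *\<^sub>R y) powr r = (1 - t) * norm x powr r + t * norm y powr r"
  shows "x = y"
proof -
  have le: "norm ((1 - t) *\<^sub>R x + t *\<^sub>R y) \<le> (1 - t) * norm x + t * norm y"
    using norm_triangle_ineq[of "(1 - t) *\<^sub>R x" "t *\<^sub>R y"] t by simp
  have le': "norm ((1 - t) *\<^sub>R x + t *\<^sub>R y) powr r \<le> ((1 - t) * norm x + t * norm y) powr r"
    using le r by (intro powr_mono2) auto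
  have n: "norm x = norm y"
  proof (rule ccontr)
    assume "norm x \<noteq> norm y"
    then show False
      using powr_convex_strict[of "norm x" "norm y" r t] r t eq le' by simp
  qed
  then have "norm ((1 - t) *\<^sub>R x + t *\<^sub>R y) powr r = norm x powr r"
    using eq by (simp add: algebra_simps)
  then have N: "norm ((1 - t) *\<^sub>R x + t *\<^sub>R y) = norm x"
    using r powr_less_mono2[of r "norm ((1 - t) *\<^sub>R x + t *\<^sub>R y)" "norm x"]
      powr_less_mono2[of r "norm x" "norm ((1 - t) *\<^sub>R x + t *\<^sub>R y)"]
    by (cases "norm ((1 - t) *\<^sub>R x + t *\<^sub>R y)" "norm x" rule: linorder_cases) auto
  have "(1 - t) * t * (norm (x - y))\<^sup>2
      = (1 - t) * (norm x)\<^sup>2 + t * (norm y)\<^sup>2 - (norm ((1 - t) *\<^sub>R x + t *\<^sub>R y))\<^sup>2"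
    unfolding power2_norm_eq_inner
    by (simp add: inner_diff_left inner_diff_right inner_add_left inner_add_right inner_commute[of y x] algebra_simps)
  also have "\<dots> = 0" unfolding N n by (simp add: algebra_simps)
  finally show ?thesis using t by simp
qed


text \<open>The formal gradient of the interpolation at values \<open>s\<close>, \<open>u\<close>
  with gradients \<open>a\<close>, \<open>b\<close>; the factors \<open>r\<close> and
  \<open>1 / r\<close> of the chain rule have cancelled. Because \<open>0 powr x = 0\<close>, it is
  0 where the base vanishes, and this is the value that the regularised gradients have in the
  limit.\<close>

definition interp_grad :: "real \<Rightarrow> real \<Rightarrow> real \<Rightarrow> real \<Rightarrow> 'a::real_vector \<Rightarrow> 'a \<Rightarrow> 'a" where
  "interp_grad r t s u a b = ((1 - t) * s powr r + t * u powr r) powr (1 / r - 1) *\<^sub>R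
     (((1 - t) * s powr (r - 1)) *\<^sub>R a + (t * u powr (r - 1)) *\<^sub>R b)"

text \<open>The logarithmic form divides by \<open>s\<close>, so \<open>s = 0\<close> is treated
  directly: all powers of \<open>u\<close> cancel and only the root of the weight is left.\<close>

lemma interp_grad_zero_left:
  assumes "1 < r" "0 \<le> u" "0 \<le> t"
  shows "interp_grad r t 0 u a b = (if u = 0 then 0 else (t powr (1 / r)) *\<^sub>R b)"
proof (cases "u = 0 \<or> t = 0")
  case True
  then show ?thesis using assms by (auto simp: interp_grad_def)
next
  case False
  then have "u powr (r * (1 / r - 1)) * u powr (r - 1) = 1"
    using assms by (simp add: powr_add[symmetric] field_simps)
  moreover have "t powr (1 / r - 1) * t = t powr (1 / r)"
    using False assms by (simp add: powr_diff)
  moreover have "(t * u powr r) powr (1 / r - 1) * (t * u powr (r - 1))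
      = (t powr (1 / r - 1) * t) * (u powr (r * (1 / r - 1)) * u powr (r - 1))"
    using assms by (simp add: powr_mult powr_powr)
  ultimately have "(t * u powr r) powr (1 / r - 1) * (t * u powr (r - 1)) = t powr (1 / r)"
    by simp
  then show ?thesis using False assms by (simp add: interp_grad_def)
qed

lemma interp_grad_swap: "interp_grad r (1 - t) u s b a = interp_grad r t s u a b"
  by (simp add: interp_grad_def add.commute)

text \<open>Logarithmic form: the gradient is \<open>S powr (1 / r)\<close> times the average of
  \<open>a / s\<close> and \<open>b / u\<close> with weight \<open>m\<close>, the share of the
  second summand in \<open>S\<close>. The upper bound is \<open>S\<close> times the average of the
  \<open>r\<close>-th powers with the same weight, so comparing the two is convexity of the
  \<open>r\<close>-th power of the norm.\<close>

lemma interp_grad_pos: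
  fixes a b :: "'a::real_normed_vector"
  assumes r: "1 < r" and t: "0 \<le> t" "t \<le> 1" and su: "0 < s" "0 < u"
  defines "S \<equiv> (1 - t) * s powr r + t * u powr r"
  defines "m \<equiv> t * u powr r / S"
  shows "0 < S" "0 \<le> m" "m \<le> 1" "0 < t \<Longrightarrow> 0 < m" "t < 1 \<Longrightarrow> m < 1"
    "norm (interp_grad r t s u a b) powr r = S * norm ((1 - m) *\<^sub>R (a /\<^sub>R s) + m *\<^sub>R (b /\<^sub>R u)) powr r"
    "(1 - t) * norm a powr r + t * norm b powr r
       = S * ((1 - m) * norm (a /\<^sub>R s) powr r + m * norm (b /\<^sub>R u) powr r)"
proof -
  have "0 < 1 - t \<or> 0 < t" using t by linarith
  then show S: "0 < S"
    unfolding S_def using t su by (auto intro: add_pos_nonneg add_nonneg_pos)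
  have m1: "1 - m = (1 - t) * s powr r / S"
  proof -
    have "(1 - t) * s powr r = S - t * u powr r" by (simp add: S_def)
    then show ?thesis using S by (simp add: m_def diff_divide_distrib)
  qed
  show "0 \<le> m" "0 < t \<Longrightarrow> 0 < m" using S t su by (auto simp: m_def)
  have "0 \<le> 1 - m" "t < 1 \<Longrightarrow> 0 < 1 - m" unfolding m1 using S t su by auto
  then show "m \<le> 1" "t < 1 \<Longrightarrow> m < 1" by auto
  have sp: "x powr k / x = x powr (k - 1)" "x powr k = x powr (k - 1) * x" if "0 < x" for x k :: real
    using that by (simp_all add: powr_diff)
  have Sm: "S * (1 - m) = (1 - t) * s powr r" "S * m = t * u powr r"
    using S by (simp add: m1, simp add: m_def)
  have "interp_grad r t s u a b = S powr (1 / r) *\<^sub>R ((1 - m) *\<^sub>R (a /\<^sub>R s) + m *\<^sub>R (b /\<^sub>R u))"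
  proof -
    have "S powr (1 / r) * (1 - m) / s = S powr (1 / r - 1) * (S * (1 - m)) / s"
      unfolding sp(2)[OF S, of "1 / r"] by (simp only: mult.assoc)
    then have "S powr (1 / r) * (1 - m) / s = S powr (1 / r - 1) * ((1 - t) * s powr (r - 1))"
      unfolding Sm sp(1)[OF su(1), symmetric] by (simp only: times_divide_eq_right)
    moreover have "S powr (1 / r) * m / u = S powr (1 / r - 1) * (S * m) / u"
      unfolding sp(2)[OF S, of "1 / r"] by (simp only: mult.assoc)
    then have "S powr (1 / r) * m / u = S powr (1 / r - 1) * (t * u powr (r - 1))"
      unfolding Sm sp(1)[OF su(2), symmetric] by (simp only: times_divide_eq_right)
    ultimately show ?thesis
      by (simp add: interp_grad_def S_def[symmetric] scaleR_add_right divide_inverse mult.assoc)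
  qed
  then show "norm (interp_grad r t s u a b) powr r = S * norm ((1 - m) *\<^sub>R (a /\<^sub>R s) + m *\<^sub>R (b /\<^sub>R u)) powr r"
    using S r by (simp add: powr_mult powr_powr)
  have n: "y powr r * norm (x /\<^sub>R y) powr r = norm x powr r" if "0 < y" for x :: 'a and y
    using that by (simp add: powr_mult[symmetric]) (simp add: mult.assoc[symmetric])
  show "(1 - t) * norm a powr r + t * norm b powr r
       = S * ((1 - m) * norm (a /\<^sub>R s) powr r + m * norm (b /\<^sub>R u) powr r)"
    by (simp only: distrib_left mult.assoc[symmetric] Sm) (simp only: mult.assoc n[OF su(1)] n[OF su(2)])
qed

text \<open>For positive values this is convexity in logarithmic form. For \<open>s = 0\<close> the
  \<open>r\<close>-th power of what remains is at most \<open>t * norm b powr r\<close>; the case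
  \<open>u = 0\<close> follows by exchanging the two functions and replacing \<open>t\<close> by
  \<open>1 - t\<close>.\<close>

lemma interp_grad_le:
  fixes a b :: "'a::real_normed_vector"
  assumes r: "1 < r" and t: "0 \<le> t" "t \<le> 1" and su: "0 \<le> s" "0 \<le> u"
  shows "norm (interp_grad r t s u a b) powr r \<le> (1 - t) * norm a powr r + t * norm b powr r"
proof -
  have zero: "norm (interp_grad r t 0 u a b) powr r \<le> (1 - t) * norm a powr r + t * norm b powr r"
    if "0 \<le> t" "t \<le> 1" "0 \<le> u" for t u and a b :: 'a
  proof -
    have "norm (interp_grad r t 0 u a b) powr r \<le> t * norm b powr r"
      using that r by (auto simp: interp_grad_zero_left powr_mult powr_powr)
    also have "\<dots> \<le> (1 - t) * norm a powr r + t * norm b powr r" using that by simp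
    finally show ?thesis .
  qed
  consider "s = 0" | "u = 0" | "0 < s" "0 < u" using su by linarith
  then show ?thesis
  proof cases
    case 1
    then show ?thesis using zero t su by simp
  next
    case 2
    then show ?thesis
      using zero[of "1 - t" s b a] t su by (simp add: interp_grad_swap add.commute)
  next
    case 3
    note p = interp_grad_pos(1-3)[OF r t 3]
    show ?thesis
      unfolding interp_grad_pos(6,7)[OF r t 3] using p(1-3) r by (intro mult_left_mono norm_powr_convex) auto
  qed
qed

lemma interp_grad_eq:
  fixes a b :: "'a::real_inner"
  assumes r: "1 < r" and t: "0 < t" "t < 1" and su: "0 < s" "0 < u"
    and eq: "norm (interp_grad r t s u a b) powr r = (1 - t) * norm a powr r + t * norm b powr r"
  shows "a /\<^sub>R s = b /\<^sub>R u"
proof -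
  note p = interp_grad_pos[OF r less_imp_le[OF t(1)] less_imp_le[OF t(2)] su]
  show ?thesis
  proof (rule norm_powr_convex_eq[OF r p(4)[OF t(1)] p(5)[OF t(2)]])
    show "norm ((1 - t * u powr r / ((1 - t) * s powr r + t * u powr r)) *\<^sub>R (a /\<^sub>R s) +
       (t * u powr r / ((1 - t) * s powr r + t * u powr r)) *\<^sub>R (b /\<^sub>R u)) powr r =
      (1 - t * u powr r / ((1 - t) * s powr r + t * u powr r)) * norm (a /\<^sub>R s) powr r +
      t * u powr r / ((1 - t) * s powr r + t * u powr r) * norm (b /\<^sub>R u) powr r"
      using eq p(1) unfolding p(6,7) by simp
  qed
qed

text \<open>The two convexity steps are recorded separately, so that equality of the outer terms can
  be traced back to each of them.\<close>

lemma interp_grad_energy_le: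
  fixes a b :: "'a::real_normed_vector"
  assumes r: "1 < r" "r \<le> p" and t: "0 \<le> t" "t \<le> 1" and su: "0 \<le> s" "0 \<le> u"
  shows "norm (interp_grad r t s u a b) powr p \<le> ((1 - t) * norm a powr r + t * norm b powr r) powr (p / r)"
    "((1 - t) * norm a powr r + t * norm b powr r) powr (p / r) \<le> (1 - t) * norm a powr p + t * norm b powr p"
proof -
  have "norm (interp_grad r t s u a b) powr p = (norm (interp_grad r t s u a b) powr r) powr (p / r)"
    using r by (simp add: powr_powr)
  also have "\<dots> \<le> ((1 - t) * norm a powr r + t * norm b powr r) powr (p / r)"
    using interp_grad_le[OF r(1) t su, of a b] r by (intro powr_mono2) auto
  finally show "norm (interp_grad r t s u a b) powr p \<le> ((1 - t) * norm a powr r + t * norm b powr r) powr (p / r)" .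
  have "((1 - t) * norm a powr r + t * norm b powr r) powr (p / r)
      \<le> (1 - t) * (norm a powr r) powr (p / r) + t * (norm b powr r) powr (p / r)"
    using r t by (intro powr_convex) auto
  then show "((1 - t) * norm a powr r + t * norm b powr r) powr (p / r) \<le> (1 - t) * norm a powr p + t * norm b powr p"
    using r by (simp add: powr_powr)
qed

text \<open>Equality of the outer terms makes both links of the chain equalities. The link with
  exponent \<open>r\<close> compares the logarithmic gradients; the link with exponent
  \<open>p / r\<close> compares the norms, and it is strict unless they agree as soon as
  \<open>r < p\<close>.\<close>

lemma interp_grad_energy_eq:
  fixes a b :: "'a::real_inner"
  assumes r: "1 < r" "r \<le> p" and t: "0 < t" "t < 1" and su: "0 \<le> s" "0 \<le> u"
    and eq: "norm (interp_grad r t s u a b) powr p = (1 - t) * norm a powr p + t * norm b powr p"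
  shows "0 < s \<Longrightarrow> 0 < u \<Longrightarrow> a /\<^sub>R s = b /\<^sub>R u" "r < p \<Longrightarrow> norm a = norm b"
proof -
  let ?Y = "(1 - t) * norm a powr r + t * norm b powr r"
  have t': "0 \<le> t" "t \<le> 1" using t by auto
  note le = interp_grad_energy_le[OF r t' su, of a b]
  have e1: "norm (interp_grad r t s u a b) powr p = ?Y powr (p / r)"
    and e2: "?Y powr (p / r) = (1 - t) * norm a powr p + t * norm b powr p"
    using le eq by linarith+
  show "a /\<^sub>R s = b /\<^sub>R u" if pos: "0 < s" "0 < u"
  proof (rule interp_grad_eq[OF r(1) t pos])
    have "(norm (interp_grad r t s u a b) powr p) powr (r / p) = (?Y powr (p / r)) powr (r / p)"
      using e1 by simp
    moreover have "0 \<le> ?Y" using t' by simp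
    ultimately show "norm (interp_grad r t s u a b) powr r = ?Y"
      using r by (simp add: powr_powr)
  qed
  show "norm a = norm b" if "r < p"
  proof (rule ccontr)
    assume ne: "norm a \<noteq> norm b"
    have "norm a powr r \<noteq> norm b powr r"
      using ne r powr_less_mono2[of r "norm a" "norm b"] powr_less_mono2[of r "norm b" "norm a"]
      by (cases "norm a" "norm b" rule: linorder_cases) auto
    then have "?Y powr (p / r) < (1 - t) * (norm a powr r) powr (p / r) + t * (norm b powr r) powr (p / r)"
      using r t that by (intro powr_convex_strict) auto
    then show False using e2 r by (simp add: powr_powr)
  qed
qed

section \<open>Weak gradients\<close>

lemma weak_deriv_direction_add:
  assumes \<Omega>: "open \<Omega>" and a: "weak_deriv \<Omega> h \<psi> a" and b: "weak_deriv \<Omega> k \<psi> b"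
  shows "weak_deriv \<Omega> (h + k) \<psi> (\<lambda>x. a x + b x)"
  unfolding weak_deriv_def
proof (intro conjI allI impI; (elim conjE)?)
  have l: "loc_integrable \<Omega> \<psi>" "loc_integrable \<Omega> a" "loc_integrable \<Omega> b"
    using a b by (auto simp: weak_deriv_def)
  show "loc_integrable \<Omega> \<psi>" "loc_integrable \<Omega> (\<lambda>x. a x + b x)"
    using l by (auto intro: loc_integrable_add)
  fix \<phi> D assume \<phi>: "test_fun \<Omega> \<phi>" "\<forall>x. (\<phi> has_derivative (\<lambda>k. D x \<bullet> k)) (at x)"
  note i = weak_deriv_integrable[OF \<Omega> _ \<phi>(1), of _ D, OF _ \<phi>(2)[rule_format]]
  have "(\<integral>x. \<psi> x * (D x \<bullet> h) \<partial>lebesgue_on \<Omega>) = - (\<integral>x. a x * \<phi> x \<partial>lebesgue_on \<Omega>)"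
    "(\<integral>x. \<psi> x * (D x \<bullet> k) \<partial>lebesgue_on \<Omega>) = - (\<integral>x. b x * \<phi> x \<partial>lebesgue_on \<Omega>)"
    using a b \<phi> by (auto simp: weak_deriv_def)
  then show "(\<integral>x. \<psi> x * (D x \<bullet> (h + k)) \<partial>lebesgue_on \<Omega>) = - (\<integral>x. (a x + b x) * \<phi> x \<partial>lebesgue_on \<Omega>)"
    using i(2)[OF l(1), of h] i(2)[OF l(1), of k] i(1)[OF l(2)] i(1)[OF l(3)]
    by (simp add: inner_add_right distrib_left distrib_right)
qed

lemma weak_deriv_direction_scaleR:
  assumes "weak_deriv \<Omega> h \<psi> a"
  shows "weak_deriv \<Omega> (c *\<^sub>R h) \<psi> (\<lambda>x. c * a x)"
proof -
  have "loc_integrable \<Omega> \<psi>" "loc_integrable \<Omega> (\<lambda>x. c * a x)"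
    using assms by (auto simp: weak_deriv_def intro: loc_integrable_cmult)
  moreover have "(\<integral>x. \<psi> x * (D x \<bullet> (c *\<^sub>R h)) \<partial>lebesgue_on \<Omega>) = - (\<integral>x. (c * a x) * \<phi> x \<partial>lebesgue_on \<Omega>)"
    if "test_fun \<Omega> \<phi>" "\<forall>x. (\<phi> has_derivative (\<lambda>k. D x \<bullet> k)) (at x)" for \<phi> and D :: "'a \<Rightarrow> 'a"
  proof -
    have "(\<integral>x. \<psi> x * (D x \<bullet> h) \<partial>lebesgue_on \<Omega>) = - (\<integral>x. a x * \<phi> x \<partial>lebesgue_on \<Omega>)" (is ?int)
      using assms that by (auto simp: weak_deriv_def)
    have eq: "\<psi> x * (D x \<bullet> (c *\<^sub>R h)) = c * (\<psi> x * (D x \<bullet> h))" "(c * a x) * \<phi> x = c * (a x * \<phi> x)" for x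
      by simp_all
    show ?thesis unfolding eq using \<open>?int\<close> by simp
  qed
  ultimately show ?thesis unfolding weak_deriv_def by blast
qed

lemma weak_grad_iff_basis:
  "weak_grad \<Omega> \<psi> g \<longleftrightarrow> (\<forall>i\<in>Basis. weak_deriv \<Omega> i \<psi> (\<lambda>x. g x \<bullet> i))"
proof
  assume g: "weak_grad \<Omega> \<psi> g"
  then have "loc_integrable \<Omega> (\<lambda>x. g x \<bullet> i)" for i
    by (auto simp: weak_grad_def loc_integrable_def)
  with g show "\<forall>i\<in>Basis. weak_deriv \<Omega> i \<psi> (\<lambda>x. g x \<bullet> i)"
    by (simp add: weak_grad_def weak_deriv_def)
next
  assume d: "\<forall>i\<in>Basis. weak_deriv \<Omega> i \<psi> (\<lambda>x. g x \<bullet> i)"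
  have "loc_integrable \<Omega> g"
    unfolding loc_integrable_def
  proof (intro allI impI)
    fix K assume K: "compact K \<and> K \<subseteq> \<Omega>"
    have "integrable (lebesgue_on K) (\<lambda>x. \<Sum>i\<in>Basis. (g x \<bullet> i) *\<^sub>R i)"
      using d K by (intro Bochner_Integration.integrable_sum integrable_scaleR_left)
        (auto simp: weak_deriv_def loc_integrable_def)
    then show "integrable (lebesgue_on K) g" by (simp add: euclidean_representation)
  qed
  moreover have "loc_integrable \<Omega> \<psi>"
    using bspec[OF d SOME_Basis] by (simp add: weak_deriv_def)
  ultimately show "weak_grad \<Omega> \<psi> g"
    using d by (simp add: weak_grad_def weak_deriv_def)
qed

text \<open>Expansion of \<open>h\<close> in the basis, built up one basis vector at a time.
  Constancy of functions with vanishing weak gradient uses derivatives in arbitrary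
  directions.\<close>

lemma weak_grad_imp_weak_deriv:
  fixes g :: "'a::euclidean_space \<Rightarrow> 'a"
  assumes \<Omega>: "open \<Omega>" and g: "weak_grad \<Omega> \<psi> g"
  shows "weak_deriv \<Omega> h \<psi> (\<lambda>x. g x \<bullet> h)"
proof -
  have "weak_deriv \<Omega> (\<Sum>i\<in>B. (h \<bullet> i) *\<^sub>R i) \<psi> (\<lambda>x. \<Sum>i\<in>B. (h \<bullet> i) * (g x \<bullet> i))"
    if "finite B" "B \<noteq> {}" "B \<subseteq> Basis" for B
    using that
  proof (induction B rule: finite_ne_induct)
    case (singleton i)
    then show ?case
      using g weak_deriv_direction_scaleR[of \<Omega> i \<psi> _ "h \<bullet> i"] by (simp add: weak_grad_iff_basis)
  next
    case (insert i B)
    then show ?case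
      using g weak_deriv_direction_scaleR[of \<Omega> i \<psi> _ "h \<bullet> i"]
      by (auto simp: weak_grad_iff_basis intro!: weak_deriv_direction_add[OF \<Omega>])
  qed
  from this[of Basis] show ?thesis
    by (simp add: euclidean_representation euclidean_inner[of _ h] mult.commute)
qed

lemma weak_grad_loc_integrable:
  assumes "weak_grad \<Omega> \<psi> g"
  shows "loc_integrable \<Omega> \<psi>" "loc_integrable \<Omega> g"
  using assms by (auto simp: weak_grad_def)

lemma weak_grad_unique:
  assumes \<Omega>: "open \<Omega>" and g: "weak_grad \<Omega> \<psi> g" "weak_grad \<Omega> \<psi>' g'"
    and eq: "AE x in lebesgue_on \<Omega>. \<psi> x = \<psi>' x"
  shows "AE x in lebesgue_on \<Omega>. g x = g' x"
proof -
  have "AE x in lebesgue_on \<Omega>. \<forall>i\<in>Basis. g x \<bullet> i = g' x \<bullet> i"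
  proof (rule AE_finite_allI[OF finite_Basis])
    show "AE x in lebesgue_on \<Omega>. g x \<bullet> i = g' x \<bullet> i" for i
      by (rule weak_deriv_unique[OF \<Omega> weak_grad_imp_weak_deriv[OF \<Omega> g(1)] weak_grad_imp_weak_deriv[OF \<Omega> g(2)] eq])
  qed
  then show ?thesis by eventually_elim (auto intro: euclidean_eqI)
qed

lemma weak_grad_lincomb:
  assumes "open \<Omega>" "weak_grad \<Omega> v a" "weak_grad \<Omega> w b"
  shows "weak_grad \<Omega> (\<lambda>x. \<alpha> * v x + \<beta> * w x) (\<lambda>x. \<alpha> *\<^sub>R a x + \<beta> *\<^sub>R b x)"
  using assms by (auto simp: weak_grad_iff_basis inner_add_left intro!: weak_deriv_add weak_deriv_cmult)

lemma weak_grad_cong_AE: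
  assumes \<Omega>: "open \<Omega>" and g: "weak_grad \<Omega> \<psi> g" and m: "\<psi>' \<in> borel_measurable (lebesgue_on \<Omega>)"
    and eq: "AE x in lebesgue_on \<Omega>. \<psi>' x = \<psi> x"
  shows "weak_grad \<Omega> \<psi>' g"
  unfolding weak_grad_iff_basis
proof
  fix i :: 'a assume "i \<in> Basis"
  then have d: "weak_deriv \<Omega> i \<psi> (\<lambda>x. g x \<bullet> i)" using g by (simp add: weak_grad_iff_basis)
  then have "(\<lambda>x. g x \<bullet> i) \<in> borel_measurable (lebesgue_on \<Omega>)"
    by (intro loc_integrable_measurable[OF \<Omega>]) (simp add: weak_deriv_def)
  from weak_deriv_cong_AE[OF \<Omega> d m this eq] show "weak_deriv \<Omega> i \<psi>' (\<lambda>x. g x \<bullet> i)" by simp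
qed

lemma weak_grad_chain:
  fixes F F1 F2 :: "real \<times> real \<Rightarrow> real"
  assumes \<Omega>: "open \<Omega>" and v: "weak_grad \<Omega> v a" and w: "weak_grad \<Omega> w b"
    and D: "\<And>p. (F has_derivative (\<lambda>k. F1 p * fst k + F2 p * snd k)) (at p)"
    and c: "continuous_on UNIV F1" "continuous_on UNIV F2"
    and B: "\<And>p. \<bar>F1 p\<bar> \<le> M" "\<And>p. \<bar>F2 p\<bar> \<le> M"
  shows "weak_grad \<Omega> (\<lambda>x. F (v x, w x)) (\<lambda>x. F1 (v x, w x) *\<^sub>R a x + F2 (v x, w x) *\<^sub>R b x)"
  unfolding weak_grad_iff_basis
proof
  fix i :: 'a assume "i \<in> Basis"
  then have "weak_deriv \<Omega> i v (\<lambda>x. a x \<bullet> i)" "weak_deriv \<Omega> i w (\<lambda>x. b x \<bullet> i)"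
    using v w by (auto simp: weak_grad_iff_basis)
  from weak_deriv_chain[OF \<Omega> this D c B]
  show "weak_deriv \<Omega> i (\<lambda>x. F (v x, w x)) (\<lambda>x. (F1 (v x, w x) *\<^sub>R a x + F2 (v x, w x) *\<^sub>R b x) \<bullet> i)"
    by (simp add: inner_add_left)
qed

text \<open>The two-variable rule for a function that ignores its second argument.\<close>

lemma weak_grad_chain_real:
  fixes F F' :: "real \<Rightarrow> real"
  assumes \<Omega>: "open \<Omega>" and v: "weak_grad \<Omega> v a"
    and D: "\<And>s. (F has_real_derivative F' s) (at s)"
    and c: "continuous_on UNIV F'" and B: "\<And>s. \<bar>F' s\<bar> \<le> M"
  shows "weak_grad \<Omega> (\<lambda>x. F (v x)) (\<lambda>x. F' (v x) *\<^sub>R a x)"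
proof -
  have "weak_grad \<Omega> (\<lambda>x. F (fst (v x, v x))) (\<lambda>x. F' (fst (v x, v x)) *\<^sub>R a x + 0 *\<^sub>R a x)"
  proof (rule weak_grad_chain[OF \<Omega> v v, where M = M and F = "\<lambda>p. F (fst p)"])
    fix p :: "real \<times> real"
    have "(fst has_derivative fst) (at p)"
      by (rule bounded_linear_imp_has_derivative[OF bounded_linear_fst])
    from has_derivative_compose[OF this D[THEN has_field_derivative_imp_has_derivative]]
    show "((\<lambda>p. F (fst p)) has_derivative (\<lambda>k. F' (fst p) * fst k + 0 * snd k)) (at p)" by simp
    show "continuous_on UNIV (\<lambda>p::real \<times> real. F' (fst p))"
      by (rule continuous_on_compose2[OF c]) (auto intro: continuous_intros)
    show "\<bar>F' (fst p)\<bar> \<le> M" by (rule B)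
    show "\<bar>0\<bar> \<le> M" using B[of 0] by linarith
  qed auto
  then show ?thesis by simp
qed

lemma weak_grad_limit:
  assumes \<Omega>: "open \<Omega>" and n: "\<And>n::nat. weak_grad \<Omega> (\<psi> n) (g n)"
    and m: "\<psi>' \<in> borel_measurable (lebesgue_on \<Omega>)" "g' \<in> borel_measurable (lebesgue_on \<Omega>)"
    and H: "loc_integrable \<Omega> H" "loc_integrable \<Omega> G"
    and lim: "AE x in lebesgue_on \<Omega>. (\<lambda>n. \<psi> n x) \<longlonglongrightarrow> \<psi>' x" "AE x in lebesgue_on \<Omega>. (\<lambda>n. g n x) \<longlonglongrightarrow> g' x"
    and bd: "\<And>n. AE x in lebesgue_on \<Omega>. \<bar>\<psi> n x\<bar> \<le> H x" "\<And>n. AE x in lebesgue_on \<Omega>. norm (g n x) \<le> G x"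
  shows "weak_grad \<Omega> \<psi>' g'"
  unfolding weak_grad_iff_basis
proof
  fix i :: 'a assume i: "i \<in> Basis"
  then have d: "weak_deriv \<Omega> i (\<psi> n) (\<lambda>x. g n x \<bullet> i)" for n using n by (simp add: weak_grad_iff_basis)
  show "weak_deriv \<Omega> i \<psi>' (\<lambda>x. g' x \<bullet> i)"
  proof (rule weak_deriv_limit[OF \<Omega> d m(1) _ H lim(1) _ bd(1)])
    show "(\<lambda>x. g' x \<bullet> i) \<in> borel_measurable (lebesgue_on \<Omega>)"
      using m(2) by (intro borel_measurable_inner) auto
    show "AE x in lebesgue_on \<Omega>. (\<lambda>n. g n x \<bullet> i) \<longlonglongrightarrow> g' x \<bullet> i"
      using lim(2) by eventually_elim (intro tendsto_intros)
    show "AE x in lebesgue_on \<Omega>. \<bar>g n x \<bullet> i\<bar> \<le> G x" for n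
      using bd(2)[of n] by eventually_elim (use Basis_le_norm[OF i] order_trans in blast)
  qed
qed

text \<open>What has to be seen is that each directional derivative of a test function has integral
  0.\<close>

lemma weak_grad_const:
  fixes \<Omega> :: "'a::euclidean_space set"
  assumes \<Omega>: "open \<Omega>"
  shows "weak_grad \<Omega> (\<lambda>_. c) (\<lambda>_. 0)"
  unfolding weak_grad_iff_basis weak_deriv_def
proof (intro ballI conjI allI impI; (elim conjE)?)
  show "loc_integrable \<Omega> (\<lambda>_. c)" "loc_integrable \<Omega> (\<lambda>x. 0 \<bullet> i)" for i :: 'a
    by (auto simp: loc_integrable_const)
  fix i :: 'a and \<phi> D assume \<phi>: "test_fun \<Omega> \<phi>" "\<forall>x. (\<phi> has_derivative (\<lambda>k. D x \<bullet> k)) (at x)"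
  obtain K where K: "compact K" "K \<subseteq> \<Omega>" "\<And>x. x \<notin> K \<Longrightarrow> \<phi> x = 0" "\<And>x. x \<notin> K \<Longrightarrow> D x = 0"
    "continuous_on UNIV \<phi>" "\<And>h. continuous_on UNIV (\<lambda>x. D x \<bullet> h)"
    using test_fun_support[OF \<phi>(1), of D] \<phi>(2) by metis
  have "(\<integral>x. D x \<bullet> i \<partial>lborel) = 0"
  proof (rule integral_directional_derivative_eq_0[OF K(5,6,1,3)])
    fix x s
    have "((\<lambda>s. x + s *\<^sub>R i) has_derivative (\<lambda>t. t *\<^sub>R i)) (at s)"
      by (auto intro!: derivative_eq_intros)
    from has_derivative_compose[OF this \<phi>(2)[rule_format]]
    show "((\<lambda>s. \<phi> (x + s *\<^sub>R i)) has_real_derivative D (x + s *\<^sub>R i) \<bullet> i) (at s)"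
      by (rule has_real_derivativeI) simp
  qed (use K in auto)
  moreover have "(\<integral>x. c * (D x \<bullet> i) \<partial>lebesgue_on \<Omega>) = (\<integral>x. c * (D x \<bullet> i) \<partial>lborel)"
    by (rule integral_lebesgue_on_compact_support[OF \<Omega> loc_integrable_const K(1,2,6)]) (use K(4) in auto)
  ultimately show "(\<integral>x. c * (D x \<bullet> i) \<partial>lebesgue_on \<Omega>) = - (\<integral>x. 0 \<bullet> i * \<phi> x \<partial>lebesgue_on \<Omega>)"
    by simp
qed

lemma weak_grad_zero_imp_const:
  assumes \<Omega>: "open \<Omega>" "connected \<Omega>" and g: "weak_grad \<Omega> \<psi> g" "AE x in lebesgue_on \<Omega>. g x = 0"
  obtains c where "AE x in lebesgue_on \<Omega>. \<psi> x = c"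
proof (rule weak_deriv_zero_const[OF \<Omega>])
  fix h
  have d: "weak_deriv \<Omega> h \<psi> (\<lambda>x. g x \<bullet> h)" by (rule weak_grad_imp_weak_deriv[OF \<Omega>(1) g(1)])
  show "weak_deriv \<Omega> h \<psi> (\<lambda>_. 0)"
  proof (rule weak_deriv_cong_AE[OF \<Omega>(1) d])
    show "\<psi> \<in> borel_measurable (lebesgue_on \<Omega>)"
      using d by (intro loc_integrable_measurable[OF \<Omega>(1)]) (simp add: weak_deriv_def)
    show "AE x in lebesgue_on \<Omega>. 0 = g x \<bullet> h" using g(2) by eventually_elim simp
  qed auto
qed (rule that)

lemma weak_grad_eq_imp_const_diff:
  assumes \<Omega>: "open \<Omega>" "connected \<Omega>" and g: "weak_grad \<Omega> v a" "weak_grad \<Omega> w b" "AE x in lebesgue_on \<Omega>. a x = b x"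
  obtains c where "AE x in lebesgue_on \<Omega>. v x = w x + c"
proof -
  have "AE x in lebesgue_on \<Omega>. 1 *\<^sub>R a x + (- 1) *\<^sub>R b x = 0"
    using g(3) by eventually_elim simp
  from weak_grad_zero_imp_const[OF \<Omega> weak_grad_lincomb[OF \<Omega>(1) g(1,2)] this]
  obtain c where c: "AE x in lebesgue_on \<Omega>. 1 * v x + - 1 * w x = c" .
  have "AE x in lebesgue_on \<Omega>. v x = w x + c"
    using c by eventually_elim simp
  then show ?thesis by (rule that)
qed

text \<open>Passing to the limit in \<open>arctan (n u) / n\<close>, which converges to 0, identifies
  \<open>g\<close> restricted to the zero set of \<open>u\<close> as a weak gradient of the zero function.\<close>

lemma weak_grad_on_zero_set:
  fixes g :: "'a::euclidean_space \<Rightarrow> 'a"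
  assumes \<Omega>: "open \<Omega>" and g: "weak_grad \<Omega> u g"
  shows "AE x in lebesgue_on \<Omega>. u x = 0 \<longrightarrow> g x = 0"
proof -
  define N where "N n = real (Suc n)" for n
  have N: "1 \<le> N n" "0 < N n" "N n \<noteq> 0" for n by (auto simp: N_def)
  let ?F = "\<lambda>n s. arctan (N n * s) / N n"
  \<comment> \<open>This derivative is at most 1 and tends to the indicator of the point 0, while
    the function \<open>?F n\<close> is at most \<open>2 / N n\<close> in absolute value.\<close>
  let ?F1 = "\<lambda>n s. 1 / (1 + (N n * s)\<^sup>2)"
  have pos: "0 < 1 + (N n * s)\<^sup>2" "1 + (N n * s)\<^sup>2 \<noteq> 0" for n s
    using zero_le_power2[of "N n * s"] by linarith+
  have le1: "\<bar>1 / (1 + (N n * s)\<^sup>2)\<bar> \<le> 1" for n s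
    using pos(1)[of n s] by simp
  have l: "loc_integrable \<Omega> u" "loc_integrable \<Omega> g" using g weak_grad_loc_integrable by auto
  note lm[measurable] = l(1)[THEN loc_integrable_measurable[OF \<Omega>]] l(2)[THEN loc_integrable_measurable[OF \<Omega>]]
  have W: "weak_grad \<Omega> (\<lambda>x. ?F n (u x)) (\<lambda>x. ?F1 n (u x) *\<^sub>R g x)" for n
  proof (rule weak_grad_chain_real[OF \<Omega> g, where M = 1])
    show "(?F n has_real_derivative ?F1 n s) (at s)" for s
      by (auto intro!: derivative_eq_intros simp: N divide_inverse)
    show "continuous_on UNIV (?F1 n)" by (intro continuous_intros) (use pos in auto)
  qed (rule le1)
  have "weak_grad \<Omega> (\<lambda>_. 0) (\<lambda>x. if u x = 0 then g x else 0)"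
  proof (rule weak_grad_limit[OF \<Omega> W, where H = "\<lambda>_. 2" and G = "\<lambda>x. norm (g x)"])
    show "(\<lambda>x. if u x = 0 then g x else 0) \<in> borel_measurable (lebesgue_on \<Omega>)"
      by measurable
    show "loc_integrable \<Omega> (\<lambda>x. norm (g x))" using l(2) by (auto simp: loc_integrable_def)
    have le2: "\<bar>arctan (N n * s) / N n\<bar> \<le> 2 / N n" for n s
    proof -
      have "\<bar>arctan (N n * s)\<bar> \<le> 2"
        using arctan_bounded[of "N n * s"] pi_less_4 by (auto simp: abs_le_iff)
      then show ?thesis using N[of n] by (simp add: divide_right_mono)
    qed
    show "AE x in lebesgue_on \<Omega>. \<bar>?F n (u x)\<bar> \<le> 2" for n
    proof (rule AE_I2)
      fix x
      have "2 / N n \<le> 2" using N[of n] by (simp add: divide_le_eq)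
      then show "\<bar>?F n (u x)\<bar> \<le> 2" using le2[of n "u x"] by simp
    qed
    have N0: "(\<lambda>n. 2 / N n) \<longlonglongrightarrow> 0"
      using tendsto_mult_right[OF LIMSEQ_inverse_real_of_nat, of 2] by (simp add: N_def divide_inverse mult.commute)
    show "AE x in lebesgue_on \<Omega>. (\<lambda>n. ?F n (u x)) \<longlonglongrightarrow> 0"
      by (rule AE_I2, rule Lim_null_comparison[OF _ N0]) (use le2 in simp)
    show "AE x in lebesgue_on \<Omega>. (\<lambda>n. ?F1 n (u x) *\<^sub>R g x) \<longlonglongrightarrow> (if u x = 0 then g x else 0)"
    proof (rule AE_I2)
      fix x
      show "(\<lambda>n. ?F1 n (u x) *\<^sub>R g x) \<longlonglongrightarrow> (if u x = 0 then g x else 0)"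
      proof (cases "u x = 0")
        case False
        have "(\<lambda>n. 1 / (1 + (N n * u x)\<^sup>2)) \<longlonglongrightarrow> 0"
        proof (rule Lim_null_comparison)
          show "(\<lambda>n. inverse ((u x)\<^sup>2) * inverse (N n)) \<longlonglongrightarrow> 0"
            using tendsto_mult_right_zero[OF LIMSEQ_inverse_real_of_nat, of "inverse ((u x)\<^sup>2)"] by (simp add: N_def)
          have "norm (1 / (1 + (N n * u x)\<^sup>2)) \<le> inverse ((u x)\<^sup>2) * inverse (N n)" for n
          proof -
            have u2: "0 < (u x)\<^sup>2" using False by simp
            have "(u x)\<^sup>2 * N n \<le> (u x)\<^sup>2 * (N n * N n)"
              using N[of n] by (intro mult_left_mono) auto
            also have "\<dots> \<le> 1 + (N n * u x)\<^sup>2" by (simp add: power2_eq_square mult_ac)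
            finally have "inverse (1 + (N n * u x)\<^sup>2) \<le> inverse ((u x)\<^sup>2 * N n)"
              using u2 N[of n] by (intro le_imp_inverse_le) auto
            then show ?thesis using pos(1)[of n "u x"] by (simp add: divide_inverse mult.commute)
          qed
          then show "\<forall>\<^sub>F n in sequentially. norm (1 / (1 + (N n * u x)\<^sup>2)) \<le> inverse ((u x)\<^sup>2) * inverse (N n)"
            by simp
        qed
        from tendsto_scaleR[OF this tendsto_const[of "g x"]] show ?thesis using False by simp
      qed simp
    qed
    show "AE x in lebesgue_on \<Omega>. norm (?F1 n (u x) *\<^sub>R g x) \<le> norm (g x)" for n
    proof (rule AE_I2)
      fix x
      show "norm (?F1 n (u x) *\<^sub>R g x) \<le> norm (g x)"
        using mult_right_mono[OF le1[of n "u x"], of "norm (g x)"] by simp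
    qed
  qed (auto simp: loc_integrable_const)
  from weak_grad_unique[OF \<Omega> this weak_grad_const[OF \<Omega>, of 0]]
  have "AE x in lebesgue_on \<Omega>. (if u x = 0 then g x else 0) = 0" by simp
  then show ?thesis by eventually_elim (auto split: if_splits)
qed

section \<open>The gradient of the interpolation\<close>

lemma abs_powr_has_derivative:
  fixes a r :: real
  assumes r: "1 < r"
  shows "((\<lambda>a. \<bar>a\<bar> powr r) has_real_derivative r * (\<bar>a\<bar> powr (r - 1) * sgn a)) (at a)"
proof -
  consider "a < 0" | "a = 0" | "0 < a" by linarith
  then show ?thesis
  proof cases
    case 1
    have "((\<lambda>a. (- a) powr r) has_real_derivative r * (\<bar>a\<bar> powr (r - 1) * sgn a)) (at a)"
      using 1 by (auto intro!: derivative_eq_intros)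
    moreover have "\<forall>\<^sub>F x in nhds a. \<bar>x\<bar> powr r = (- x) powr r"
      using eventually_nhds_in_open[of "{..<0}" a] 1 by (auto elim!: eventually_mono)
    ultimately show ?thesis by (subst DERIV_cong_ev[OF refl _ refl])
  next
    case 2
    have "(\<lambda>h. \<bar>h\<bar> powr r / h) \<midarrow>0\<rightarrow> 0"
    proof (rule Lim_null_comparison)
      show "\<forall>\<^sub>F h in at 0. norm (\<bar>h\<bar> powr r / h) \<le> \<bar>h\<bar> powr (r - 1)"
        by (rule always_eventually) (auto simp: powr_diff)
      have "((\<lambda>h::real. \<bar>h\<bar>) \<longlongrightarrow> 0) (at 0)" by (rule tendsto_rabs_zero) (rule tendsto_ident_at)
      then show "((\<lambda>h::real. \<bar>h\<bar> powr (r - 1)) \<longlongrightarrow> 0) (at 0)"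
        using r by (intro tendsto_zero_powrI[where b = "r - 1"]) auto
    qed
    then show ?thesis using 2 by (simp add: DERIV_def)
  next
    case 3
    have "((\<lambda>a. a powr r) has_real_derivative r * (\<bar>a\<bar> powr (r - 1) * sgn a)) (at a)"
      using 3 by (auto intro!: derivative_eq_intros)
    moreover have "\<forall>\<^sub>F x in nhds a. \<bar>x\<bar> powr r = x powr r"
      using eventually_nhds_in_open[of "{0<..}" a] 3 by (auto elim!: eventually_mono)
    ultimately show ?thesis by (subst DERIV_cong_ev[OF refl _ refl])
  qed
qed

lemma continuous_on_abs_powr_sgn:
  fixes k :: real
  assumes k: "0 < k"
  shows "continuous_on UNIV (\<lambda>a::real. \<bar>a\<bar> powr k * sgn a)"
proof (rule continuous_at_imp_continuous_on, rule ballI)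
  fix a :: real
  show "isCont (\<lambda>a. \<bar>a\<bar> powr k * sgn a) a"
  proof (cases "a = 0")
    case True
    have "((\<lambda>h::real. \<bar>h\<bar> powr k * sgn h) \<longlongrightarrow> 0) (at 0)"
    proof (rule Lim_null_comparison)
      show "\<forall>\<^sub>F h in at 0. norm (\<bar>h\<bar> powr k * sgn h) \<le> \<bar>h\<bar> powr k"
        by (rule always_eventually) (auto simp: abs_mult sgn_if)
      have "((\<lambda>h::real. \<bar>h\<bar>) \<longlongrightarrow> 0) (at 0)" by (rule tendsto_rabs_zero) (rule tendsto_ident_at)
      then show "((\<lambda>h::real. \<bar>h\<bar> powr k) \<longlongrightarrow> 0) (at 0)"
        using k by (intro tendsto_zero_powrI[where b = k]) auto
    qed
    then show ?thesis using True by (simp add: isCont_def)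
  next
    case False
    then have "isCont (\<lambda>a. \<bar>a\<bar> powr k) a" by (intro continuous_intros) auto
    moreover have "isCont sgn a"
      unfolding isCont_def using False by (intro tendsto_sgn tendsto_ident_at)
    ultimately show ?thesis by (intro continuous_mult)
  qed
qed

text \<open>The exponent \<open>1 / r - 1\<close> is negative, so discarding \<open>e\<close> and
  \<open>T\<close> from the base only enlarges the expression. Then all powers of
  \<open>\<bar>a\<bar>\<close> cancel and \<open>\<alpha> powr (1 / r)\<close> remains; the bound
  does not depend on \<open>e\<close>.\<close>

lemma regularised_interp_partial_bound:
  fixes e \<alpha> a T r :: real
  assumes "0 < e" "0 \<le> \<alpha>" "\<alpha> \<le> 1" "0 \<le> T" "1 < r"
  shows "\<bar>(e + (\<alpha> * \<bar>a\<bar> powr r + T)) powr (1 / r - 1) * (\<alpha> * (\<bar>a\<bar> powr (r - 1) * sgn a))\<bar> \<le> 1"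
proof (cases "\<alpha> = 0 \<or> a = 0")
  case True
  then show ?thesis by auto
next
  case False
  let ?S = "e + (\<alpha> * \<bar>a\<bar> powr r + T)" and ?P = "\<alpha> * \<bar>a\<bar> powr r"
  have P: "0 < ?P" "?P \<le> ?S" using False assms by auto
  have "\<bar>?S powr (1 / r - 1) * (\<alpha> * (\<bar>a\<bar> powr (r - 1) * sgn a))\<bar> = ?S powr (1 / r - 1) * (\<alpha> * \<bar>a\<bar> powr (r - 1))"
    using False assms by (simp add: abs_mult)
  also have "\<dots> \<le> ?P powr (1 / r - 1) * (\<alpha> * \<bar>a\<bar> powr (r - 1))"
    using P assms by (intro mult_right_mono powr_mono2') auto
  also have "\<dots> = (\<alpha> powr (1 / r - 1) * \<alpha>) * (\<bar>a\<bar> powr (r * (1 / r - 1)) * \<bar>a\<bar> powr (r - 1))"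
    using assms by (simp add: powr_mult powr_powr)
  also have "\<alpha> powr (1 / r - 1) * \<alpha> = \<alpha> powr (1 / r)"
    using False assms by (simp add: powr_diff)
  also have "\<bar>a\<bar> powr (r * (1 / r - 1)) * \<bar>a\<bar> powr (r - 1) = 1"
    using False assms by (simp add: powr_add[symmetric] field_simps)
  also have "\<alpha> powr (1 / r) * 1 \<le> 1"
    using False assms by (simp add: powr_le_one_le powr_le1)
  finally show ?thesis .
qed

text \<open>The two estimates are the majorants for letting \<open>e\<close> tend to 0: the first
  measures the growth from the value \<open>e powr (1 / r)\<close> at the origin by the Lipschitz
  bound, the second uses that the partial derivatives are at most 1.\<close>

lemma weak_grad_regularised_interp:
  assumes \<Omega>: "open \<Omega>" and v: "weak_grad \<Omega> v a" and w: "weak_grad \<Omega> w b"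
    and r: "1 < r" and t: "0 \<le> t" "t \<le> 1" and e: "0 < e"
  defines "S \<equiv> \<lambda>x. e + ((1 - t) * \<bar>v x\<bar> powr r + t * \<bar>w x\<bar> powr r)"
  shows "weak_grad \<Omega> (\<lambda>x. S x powr (1 / r))
     (\<lambda>x. (S x powr (1 / r - 1) * ((1 - t) * (\<bar>v x\<bar> powr (r - 1) * sgn (v x)))) *\<^sub>R a x
        + (S x powr (1 / r - 1) * (t * (\<bar>w x\<bar> powr (r - 1) * sgn (w x)))) *\<^sub>R b x)"
    "\<bar>S x powr (1 / r)\<bar> \<le> e powr (1 / r) + (\<bar>v x\<bar> + \<bar>w x\<bar>)"
    "norm ((S x powr (1 / r - 1) * ((1 - t) * (\<bar>v x\<bar> powr (r - 1) * sgn (v x)))) *\<^sub>R a x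
        + (S x powr (1 / r - 1) * (t * (\<bar>w x\<bar> powr (r - 1) * sgn (w x)))) *\<^sub>R b x) \<le> norm (a x) + norm (b x)"
proof -
  let ?d = "\<lambda>a::real. \<bar>a\<bar> powr (r - 1) * sgn a"
  define Z where "Z p = e + ((1 - t) * \<bar>fst p\<bar> powr r + t * \<bar>snd p\<bar> powr r)" for p :: "real \<times> real"
  define F1 where "F1 p = Z p powr (1 / r - 1) * ((1 - t) * ?d (fst p))" for p :: "real \<times> real"
  define F2 where "F2 p = Z p powr (1 / r - 1) * (t * ?d (snd p))" for p :: "real \<times> real"
  have Z0: "0 < Z p" for p unfolding Z_def using e t by (intro add_pos_nonneg add_nonneg_nonneg mult_nonneg_nonneg) auto
  have D: "((\<lambda>p. Z p powr (1 / r)) has_derivative (\<lambda>k. F1 p * fst k + F2 p * snd k)) (at p)" for p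
  proof -
    have f: "(fst has_derivative fst) (at p)" "(snd has_derivative snd) (at p)"
      by (auto intro: bounded_linear_imp_has_derivative bounded_linear_fst bounded_linear_snd)
    have dZ: "(Z has_derivative (\<lambda>k. (1 - t) * (r * ?d (fst p) * fst k) + t * (r * ?d (snd p) * snd k))) (at p)"
    proof -
      note d1 = has_derivative_compose[OF f(1) abs_powr_has_derivative[OF r, THEN has_field_derivative_imp_has_derivative]]
      note d2 = has_derivative_compose[OF f(2) abs_powr_has_derivative[OF r, THEN has_field_derivative_imp_has_derivative]]
      have "((\<lambda>p. e + ((1 - t) * \<bar>fst p\<bar> powr r + t * \<bar>snd p\<bar> powr r)) has_derivative
          (\<lambda>k. 0 + ((1 - t) * (r * ?d (fst p) * fst k) + t * (r * ?d (snd p) * snd k)))) (at p)"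
        by (intro has_derivative_add has_derivative_const has_derivative_mult_right d1 d2)
      then show ?thesis by (simp add: Z_def[abs_def])
    qed
    have "((\<lambda>z. z powr (1 / r)) has_real_derivative (1 / r) * Z p powr (1 / r - 1)) (at (Z p))"
      using Z0[of p] by (auto intro!: derivative_eq_intros)
    from has_derivative_compose[OF dZ this[THEN has_field_derivative_imp_has_derivative]]
    show ?thesis
      using r by (simp add: F1_def F2_def algebra_simps)
  qed
  have Zc: "continuous_on UNIV Z"
  proof -
    have "continuous_on UNIV (\<lambda>a::real. \<bar>a\<bar> powr r)"
      using abs_powr_has_derivative[OF r] by (meson DERIV_isCont continuous_at_imp_continuous_on)
    note c = continuous_on_compose2[OF this]
    show ?thesis unfolding Z_def by (intro continuous_intros c) auto
  qed
  have c: "continuous_on UNIV F1" "continuous_on UNIV F2"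
  proof -
    have "continuous_on UNIV ?d" using r by (intro continuous_on_abs_powr_sgn) auto
    note cd = continuous_on_compose2[OF this]
    have zp: "continuous_on UNIV (\<lambda>p. Z p powr (1 / r - 1))"
      using less_imp_neq[OF Z0, symmetric] by (intro continuous_on_powr Zc continuous_on_const) blast
    have d1: "continuous_on UNIV (\<lambda>p::real \<times> real. ?d (fst p))" "continuous_on UNIV (\<lambda>p::real \<times> real. ?d (snd p))"
      by (rule cd; auto intro: continuous_on_fst continuous_on_snd continuous_on_id)+
    show "continuous_on UNIV F1" "continuous_on UNIV F2"
      unfolding F1_def F2_def by (intro continuous_on_mult continuous_on_const zp d1)+
  qed
  have B: "\<bar>F1 p\<bar> \<le> 1" "\<bar>F2 p\<bar> \<le> 1" for p
  proof -
    have "Z p = e + (t * \<bar>snd p\<bar> powr r + (1 - t) * \<bar>fst p\<bar> powr r)" by (simp add: Z_def)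
    then show "\<bar>F2 p\<bar> \<le> 1"
      unfolding F2_def using e t r by (simp only:) (rule regularised_interp_partial_bound, auto)
    show "\<bar>F1 p\<bar> \<le> 1"
      unfolding F1_def Z_def by (rule regularised_interp_partial_bound) (use e t r in auto)
  qed
  have SZ: "S x = Z (v x, w x)" for x by (simp add: S_def Z_def)
  have F12: "S x powr (1 / r - 1) * ((1 - t) * ?d (v x)) = F1 (v x, w x)"
     "S x powr (1 / r - 1) * (t * ?d (w x)) = F2 (v x, w x)" for x
    by (simp_all add: F1_def F2_def SZ)
  show "weak_grad \<Omega> (\<lambda>x. S x powr (1 / r))
     (\<lambda>x. (S x powr (1 / r - 1) * ((1 - t) * ?d (v x))) *\<^sub>R a x + (S x powr (1 / r - 1) * (t * ?d (w x))) *\<^sub>R b x)"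
    unfolding F12 unfolding SZ by (rule weak_grad_chain[OF \<Omega> v w D c B])
  show "\<bar>S x powr (1 / r)\<bar> \<le> e powr (1 / r) + (\<bar>v x\<bar> + \<bar>w x\<bar>)"
  proof -
    have "\<bar>Z (v x, w x) powr (1 / r) - Z 0 powr (1 / r)\<bar> \<le> 1 * (\<bar>fst (v x, w x) - fst (0::real \<times> real)\<bar> + \<bar>snd (v x, w x) - snd (0::real \<times> real)\<bar>)"
      by (rule bounded_partials_lipschitz[OF D B])
    moreover have "Z 0 = e" using r by (simp add: Z_def)
    ultimately show ?thesis
      unfolding SZ using abs_triangle_ineq2[of "Z (v x, w x) powr (1 / r)" "e powr (1 / r)"] by simp
  qed
  show "norm ((S x powr (1 / r - 1) * ((1 - t) * ?d (v x))) *\<^sub>R a x + (S x powr (1 / r - 1) * (t * ?d (w x))) *\<^sub>R b x)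
      \<le> norm (a x) + norm (b x)"
    unfolding F12
  proof (rule order_trans[OF norm_triangle_ineq], rule add_mono)
    show "norm (F1 (v x, w x) *\<^sub>R a x) \<le> norm (a x)" "norm (F2 (v x, w x) *\<^sub>R b x) \<le> norm (b x)"
      using mult_right_mono[OF B(1)[of "(v x, w x)"], of "norm (a x)"]
        mult_right_mono[OF B(2)[of "(v x, w x)"], of "norm (b x)"] by simp_all
  qed
qed

lemma weak_grad_interp:
  assumes \<Omega>: "open \<Omega>" and v: "weak_grad \<Omega> v a" and w: "weak_grad \<Omega> w b"
    and r: "1 < r" and t: "0 \<le> t" "t \<le> 1"
    and nonneg: "\<forall>x\<in>\<Omega>. 0 \<le> v x" "\<forall>x\<in>\<Omega>. 0 \<le> w x"
  shows "weak_grad \<Omega> (interp r v w t) (\<lambda>x. interp_grad r t (v x) (w x) (a x) (b x))"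
proof -
  note nonneg = nonneg[rule_format]
  define e where "e n = inverse (real (Suc n))" for n
  have e: "0 < e n" "e n \<le> 1" for n by (auto simp: e_def field_simps)
  have e0: "e \<longlonglongrightarrow> 0" unfolding e_def by (rule LIMSEQ_inverse_real_of_nat)
  define S where "S n x = e n + ((1 - t) * \<bar>v x\<bar> powr r + t * \<bar>w x\<bar> powr r)" for n x
  define G where "G n x = (S n x powr (1 / r - 1) * ((1 - t) * (\<bar>v x\<bar> powr (r - 1) * sgn (v x)))) *\<^sub>R a x
        + (S n x powr (1 / r - 1) * (t * (\<bar>w x\<bar> powr (r - 1) * sgn (w x)))) *\<^sub>R b x" for n x
  define Z where "Z x = (1 - t) * \<bar>v x\<bar> powr r + t * \<bar>w x\<bar> powr r" for x
  note reg = weak_grad_regularised_interp[OF \<Omega> v w r t e(1), folded S_def]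
  have l: "loc_integrable \<Omega> v" "loc_integrable \<Omega> w" "loc_integrable \<Omega> a" "loc_integrable \<Omega> b"
    using v w weak_grad_loc_integrable by auto
  note lm[measurable] = l(1)[THEN loc_integrable_measurable[OF \<Omega>]] l(2)[THEN loc_integrable_measurable[OF \<Omega>]]
     l(3)[THEN loc_integrable_measurable[OF \<Omega>]] l(4)[THEN loc_integrable_measurable[OF \<Omega>]]
  have Z0: "0 \<le> Z x" for x using t by (simp add: Z_def)
  have Slim: "(\<lambda>n. S n x) \<longlonglongrightarrow> Z x" for x
    unfolding S_def Z_def using tendsto_add[OF e0 tendsto_const] by simp
  have ZS: "interp r v w t x = Z x powr (1 / r)" if "x \<in> \<Omega>" for x
    using nonneg that by (simp add: interp_def Z_def)
  show ?thesis
  proof (rule weak_grad_limit[OF \<Omega>, where \<psi> = "\<lambda>n x. S n x powr (1 / r)" and g = G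
        and H = "\<lambda>x. 1 + (\<bar>v x\<bar> + \<bar>w x\<bar>)" and G = "\<lambda>x. norm (a x) + norm (b x)"])
    show "weak_grad \<Omega> (\<lambda>x. S n x powr (1 / r)) (G n)" for n
      unfolding G_def by (rule reg(1))
    show "interp r v w t \<in> borel_measurable (lebesgue_on \<Omega>)"
      unfolding interp_def by measurable
    show "(\<lambda>x. interp_grad r t (v x) (w x) (a x) (b x)) \<in> borel_measurable (lebesgue_on \<Omega>)"
      unfolding interp_grad_def by measurable
    show "loc_integrable \<Omega> (\<lambda>x. 1 + (\<bar>v x\<bar> + \<bar>w x\<bar>))"
      using l by (intro loc_integrable_add loc_integrable_const loc_integrable_abs)
    show "loc_integrable \<Omega> (\<lambda>x. norm (a x) + norm (b x))"
      using l by (intro loc_integrable_add) (auto simp: loc_integrable_def)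
    show "AE x in lebesgue_on \<Omega>. \<bar>S n x powr (1 / r)\<bar> \<le> 1 + (\<bar>v x\<bar> + \<bar>w x\<bar>)" for n
    proof (rule AE_I2)
      fix x
      have "e n powr (1 / r) \<le> 1" using e[of n] r by (intro powr_le1) auto
      then show "\<bar>S n x powr (1 / r)\<bar> \<le> 1 + (\<bar>v x\<bar> + \<bar>w x\<bar>)" using reg(2)[of n x] by linarith
    qed
    show "AE x in lebesgue_on \<Omega>. norm (G n x) \<le> norm (a x) + norm (b x)" for n
      unfolding G_def by (intro AE_I2 reg(3))
    show "AE x in lebesgue_on \<Omega>. (\<lambda>n. S n x powr (1 / r)) \<longlonglongrightarrow> interp r v w t x"
    proof (rule AE_I2)
      fix x assume "x \<in> space (lebesgue_on \<Omega>)"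
      then have x: "x \<in> \<Omega>" by simp
      have "0 \<le> S n x" for n using e(1)[of n] t by (simp add: S_def)
      then show "(\<lambda>n. S n x powr (1 / r)) \<longlonglongrightarrow> interp r v w t x"
        unfolding ZS[OF x] using r by (intro tendsto_powr'[OF Slim tendsto_const]) auto
    qed
    show "AE x in lebesgue_on \<Omega>. (\<lambda>n. G n x) \<longlonglongrightarrow> interp_grad r t (v x) (w x) (a x) (b x)"
    proof (rule AE_I2)
      fix x assume "x \<in> space (lebesgue_on \<Omega>)"
      then have x: "x \<in> \<Omega>" by simp
      have d: "\<bar>v x\<bar> powr (r - 1) * sgn (v x) = v x powr (r - 1)" "\<bar>w x\<bar> powr (r - 1) * sgn (w x) = w x powr (r - 1)"
        using nonneg[OF x] by (auto simp: sgn_if)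
      have ig: "interp_grad r t (v x) (w x) (a x) (b x) =
         (Z x powr (1 / r - 1) * ((1 - t) * v x powr (r - 1))) *\<^sub>R a x + (Z x powr (1 / r - 1) * (t * w x powr (r - 1))) *\<^sub>R b x"
        using nonneg[OF x] by (simp add: interp_grad_def Z_def scaleR_add_right)
      show "(\<lambda>n. G n x) \<longlonglongrightarrow> interp_grad r t (v x) (w x) (a x) (b x)"
      proof (cases "Z x = 0")
        \<comment> \<open>Where the base \<open>Z x\<close> vanishes, the factor
          \<open>S n x powr (1 / r - 1)\<close> is unbounded in \<open>n\<close>, but it multiplies
          coefficients that are exactly 0.\<close>
        case True
        then have "(1 - t) * \<bar>v x\<bar> powr r = 0" "t * \<bar>w x\<bar> powr r = 0"
          using t unfolding Z_def by (simp_all add: add_nonneg_eq_0_iff)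
        then have z: "(1 - t) * v x powr (r - 1) = 0" "t * w x powr (r - 1) = 0" by auto
        show ?thesis unfolding G_def d ig z by simp
      next
        case False
        then have L: "(\<lambda>n. S n x powr (1 / r - 1)) \<longlonglongrightarrow> Z x powr (1 / r - 1)"
          by (intro tendsto_powr Slim tendsto_const)
        show ?thesis unfolding G_def d ig
          by (intro tendsto_add tendsto_scaleR tendsto_mult L tendsto_const)
      qed
    qed
  qed
qed

section \<open>Logarithms of functions locally bounded away from zero\<close>

lemma inv_Linf_loc_AE_pos:
  assumes \<Omega>: "open \<Omega>" and v: "inv_Linf_loc \<Omega> v" "\<forall>x\<in>\<Omega>. 0 \<le> v x"
  shows "AE x in lebesgue_on \<Omega>. 0 < v x"
proof (rule AE_lebesgue_on_openI[OF \<Omega>])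
  fix K assume K: "compact K" "K \<subseteq> \<Omega>"
  then obtain M where "AE x in lebesgue_on K. v x \<noteq> 0 \<and> \<bar>1 / v x\<bar> \<le> M"
    using v(1) unfolding inv_Linf_loc_def by blast
  then show "AE x in lebesgue. x \<in> K \<longrightarrow> 0 < v x"
    unfolding AE_lebesgue_on_compact_iff[OF K(1)]
  proof eventually_elim
    case (elim x)
    show ?case
    proof
      assume x: "x \<in> K"
      then have "0 \<le> v x" using v(2) K(2) by blast
      with elim x show "0 < v x" by simp
    qed
  qed
qed

lemma loc_integrable_divide_inv_Linf_loc:
  fixes f :: "'a::euclidean_space \<Rightarrow> real"
  assumes \<Omega>: "open \<Omega>" and v: "inv_Linf_loc \<Omega> v" "v \<in> borel_measurable (lebesgue_on \<Omega>)"
    and f: "loc_integrable \<Omega> f"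
  shows "loc_integrable \<Omega> (\<lambda>x. f x * (1 / v x))"
  unfolding loc_integrable_def
proof (intro allI impI, elim conjE)
  fix K assume K: "compact K" "K \<subseteq> \<Omega>"
  then obtain M where M: "AE x in lebesgue_on K. v x \<noteq> 0 \<and> \<bar>1 / v x\<bar> \<le> M"
    using v(1) unfolding inv_Linf_loc_def by blast
  have fK: "integrable (lebesgue_on K) f" using f K by (simp add: loc_integrable_def)
  have m[measurable]: "v \<in> borel_measurable (lebesgue_on K)" "f \<in> borel_measurable (lebesgue_on K)"
    using measurable_restrict_mono[OF v(2) K(2)] fK by auto
  show "integrable (lebesgue_on K) (\<lambda>x. f x * (1 / v x))"
  proof (rule Bochner_Integration.integrable_bound)
    show "integrable (lebesgue_on K) (\<lambda>x. f x * M)" using fK by simp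
    show "AE x in lebesgue_on K. norm (f x * (1 / v x)) \<le> norm (f x * M)"
      using M
    proof eventually_elim
      case (elim x)
      then have "\<bar>f x\<bar> * \<bar>1 / v x\<bar> \<le> \<bar>f x\<bar> * \<bar>M\<bar>" by (intro mult_left_mono) auto
      then show ?case by (simp only: real_norm_def abs_mult)
    qed
  qed measurable
qed

text \<open>The logarithm has no bounded derivative near 0, so it is approximated by
  \<open>ln (e n + s^2) / 2\<close>, which is smooth on the whole line. The limit is dominated by
  \<open>v + 1 / v\<close> for the functions and by \<open>norm g / v\<close> for the gradients,
  both locally integrable.\<close>

lemma weak_grad_ln:
  fixes g :: "'a::euclidean_space \<Rightarrow> 'a"
  assumes \<Omega>: "open \<Omega>" and g: "weak_grad \<Omega> v g" and v: "inv_Linf_loc \<Omega> v" "\<forall>x\<in>\<Omega>. 0 \<le> v x"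
  shows "weak_grad \<Omega> (\<lambda>x. ln (v x)) (\<lambda>x. g x /\<^sub>R v x)"
proof -
  define e where "e n = inverse (real (Suc n))" for n
  have e: "0 < e n" "e n \<le> 1" for n by (auto simp: e_def field_simps)
  have e0: "e \<longlonglongrightarrow> 0" unfolding e_def by (rule LIMSEQ_inverse_real_of_nat)
  have l: "loc_integrable \<Omega> v" "loc_integrable \<Omega> g" using g weak_grad_loc_integrable by auto
  note lm[measurable] = l(1)[THEN loc_integrable_measurable[OF \<Omega>]] l(2)[THEN loc_integrable_measurable[OF \<Omega>]]
  have pos: "AE x in lebesgue_on \<Omega>. 0 < v x" by (rule inv_Linf_loc_AE_pos[OF \<Omega> v])
  have es: "0 < e n + s\<^sup>2" for n s using e(1)[of n] by (simp add: add_pos_nonneg)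
  show ?thesis
  proof (rule weak_grad_limit[OF \<Omega>, where \<psi> = "\<lambda>n x. ln (e n + (v x)\<^sup>2) / 2" and g = "\<lambda>n x. (v x / (e n + (v x)\<^sup>2)) *\<^sub>R g x"
        and H = "\<lambda>x. v x + 1 * (1 / v x)" and G = "\<lambda>x. norm (g x) * (1 / v x)"])
    show "weak_grad \<Omega> (\<lambda>x. ln (e n + (v x)\<^sup>2) / 2) (\<lambda>x. (v x / (e n + (v x)\<^sup>2)) *\<^sub>R g x)" for n
    proof (rule weak_grad_chain_real[OF \<Omega> g, where M = "1 / e n"])
      show "((\<lambda>s. ln (e n + s\<^sup>2) / 2) has_real_derivative s / (e n + s\<^sup>2)) (at s)" for s
      proof -
        have "((\<lambda>s. e n + s\<^sup>2) has_real_derivative 2 * s) (at s)"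
          by (auto intro!: derivative_eq_intros)
        then have "((\<lambda>s. ln (e n + s\<^sup>2)) has_real_derivative inverse (e n + s\<^sup>2) * (2 * s)) (at s)"
          by (rule DERIV_chain2[where f = ln and g = "\<lambda>s. e n + s\<^sup>2" and x = s, OF DERIV_ln[OF es[of n s]]])
        then have "((\<lambda>s. ln (e n + s\<^sup>2) / 2) has_real_derivative inverse (e n + s\<^sup>2) * (2 * s) / 2) (at s)"
          by (rule DERIV_cdivide)
        moreover have "inverse (e n + s\<^sup>2) * (2 * s) / 2 = s / (e n + s\<^sup>2)"
          by (simp only: divide_inverse) simp
        ultimately show ?thesis by (simp only:)
      qed
      show "continuous_on UNIV (\<lambda>s. s / (e n + s\<^sup>2))"
        using less_imp_neq[OF es, symmetric] by (intro continuous_intros) blast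
      show "\<bar>s / (e n + s\<^sup>2)\<bar> \<le> 1 / e n" for s
      proof -
        \<comment> \<open>A bound depending on \<open>n\<close> is enough for the chain rule, and
          \<open>e n \<le> 1\<close> makes \<open>1 / e n\<close> work; the domination uniform in
          \<open>n\<close> comes from \<open>1 / v\<close>.\<close>
        have "0 \<le> (\<bar>s\<bar> - 1)\<^sup>2" by simp
        then have "\<bar>s\<bar> \<le> 1 + s\<^sup>2" by (simp add: power2_diff)
        then have "e n * \<bar>s\<bar> \<le> e n * (1 + s\<^sup>2)" using e(1)[of n] by (intro mult_left_mono) auto
        also have "\<dots> \<le> e n + s\<^sup>2"
          using mult_right_mono[OF e(2)[of n], of "s\<^sup>2"] by (simp add: distrib_left)
        finally show ?thesis using es[of n s] e(1)[of n] by (simp add: field_simps)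
      qed
    qed
    show "(\<lambda>x. ln (v x)) \<in> borel_measurable (lebesgue_on \<Omega>)" by measurable
    show "(\<lambda>x. g x /\<^sub>R v x) \<in> borel_measurable (lebesgue_on \<Omega>)" by measurable
    show "loc_integrable \<Omega> (\<lambda>x. v x + 1 * (1 / v x))"
      by (intro loc_integrable_add l loc_integrable_divide_inv_Linf_loc[OF \<Omega> v(1) lm(1)] loc_integrable_const)
    have "loc_integrable \<Omega> (\<lambda>x. norm (g x))" using l(2) by (auto simp: loc_integrable_def)
    then show "loc_integrable \<Omega> (\<lambda>x. norm (g x) * (1 / v x))"
      by (rule loc_integrable_divide_inv_Linf_loc[OF \<Omega> v(1) lm(1)])
    show "AE x in lebesgue_on \<Omega>. (\<lambda>n. ln (e n + (v x)\<^sup>2) / 2) \<longlonglongrightarrow> ln (v x)"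
      using pos
    proof eventually_elim
      case (elim x)
      have "(\<lambda>n. ln (e n + (v x)\<^sup>2) / 2) \<longlonglongrightarrow> ln (0 + (v x)\<^sup>2) / 2"
        using elim by (intro tendsto_intros e0) auto
      then show ?case using elim by (simp add: ln_realpow)
    qed
    show "AE x in lebesgue_on \<Omega>. (\<lambda>n. (v x / (e n + (v x)\<^sup>2)) *\<^sub>R g x) \<longlonglongrightarrow> g x /\<^sub>R v x"
      using pos
    proof eventually_elim
      case (elim x)
      have "(\<lambda>n. (v x / (e n + (v x)\<^sup>2)) *\<^sub>R g x) \<longlonglongrightarrow> (v x / (0 + (v x)\<^sup>2)) *\<^sub>R g x"
        using elim by (intro tendsto_intros e0) auto
      moreover have "v x / (0 + (v x)\<^sup>2) = inverse (v x)"
        using elim by (simp add: power2_eq_square field_simps)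
      ultimately show ?case by (simp only:)
    qed
    show "AE x in lebesgue_on \<Omega>. \<bar>ln (e n + (v x)\<^sup>2) / 2\<bar> \<le> v x + 1 * (1 / v x)" for n
      using pos
    proof eventually_elim
      case (elim x)
      \<comment> \<open>From above, \<open>e n \<le> 1\<close> gives a base of at most
        \<open>(1 + v x)^2\<close>; from below, the base is at least \<open>(v x)^2\<close> and
        \<open>ln (1 / v x) \<le> 1 / v x\<close>.\<close>
      have "ln (e n + (v x)\<^sup>2) \<le> ln ((1 + v x)\<^sup>2)"
        using elim e[of n] es[of n "v x"] by (intro ln_mono) (auto simp: power2_sum)
      also have "\<dots> = 2 * ln (1 + v x)" using elim by (simp add: ln_realpow)
      also have "\<dots> \<le> 2 * v x" using elim ln_add_one_self_le_self[of "v x"] by simp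
      finally have u: "ln (e n + (v x)\<^sup>2) / 2 \<le> v x" by simp
      have "ln (1 / v x) \<le> 1 / v x - 1" using elim by (intro ln_le_minus_one) simp
      then have "- (1 / v x) \<le> ln (v x)" using elim by (simp add: ln_div)
      moreover have "2 * ln (v x) = ln ((v x)\<^sup>2)" using elim by (simp add: ln_realpow)
      moreover have "ln ((v x)\<^sup>2) \<le> ln (e n + (v x)\<^sup>2)" using elim e[of n] by (intro ln_mono) auto
      ultimately have "- (1 / v x) \<le> ln (e n + (v x)\<^sup>2) / 2" by simp
      moreover have "0 < 1 / v x" using elim by simp
      ultimately show ?case using u elim unfolding abs_le_iff by linarith
    qed
    show "AE x in lebesgue_on \<Omega>. norm ((v x / (e n + (v x)\<^sup>2)) *\<^sub>R g x) \<le> norm (g x) * (1 / v x)" for n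
      using pos
    proof eventually_elim
      case (elim x)
      have "v x / (e n + (v x)\<^sup>2) \<le> v x / (v x)\<^sup>2"
        using elim e[of n] es[of n "v x"] by (intro divide_left_mono mult_pos_pos) auto
      also have "\<dots> = 1 / v x" using elim by (simp add: power2_eq_square)
      finally have "\<bar>v x / (e n + (v x)\<^sup>2)\<bar> * norm (g x) \<le> 1 / v x * norm (g x)"
        using elim es[of n "v x"] by (intro mult_right_mono) auto
      then show ?case by (simp only: norm_scaleR mult.commute)
    qed
  qed
qed

section \<open>The energy inequality and its equality cases\<close>

lemma energy_cong_AE:
  assumes "g \<in> borel_measurable (lebesgue_on \<Omega>)" "g' \<in> borel_measurable (lebesgue_on \<Omega>)"
    and "AE x in lebesgue_on \<Omega>. g x = g' x"
  shows "energy p \<Omega> g = energy p \<Omega> g'"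
  unfolding energy_def
proof (rule integral_cong_AE)
  show "AE x in lebesgue_on \<Omega>. norm (g x) powr p = norm (g' x) powr p"
    using assms(3) by eventually_elim simp
qed (use assms in measurable)

lemma energy_weak_grad_cong_AE:
  assumes \<Omega>: "open \<Omega>" and g: "weak_grad \<Omega> \<psi> g" "weak_grad \<Omega> \<psi>' g'"
    and eq: "AE x in lebesgue_on \<Omega>. g x = g' x"
  shows "energy p \<Omega> g = energy p \<Omega> g'"
  by (rule energy_cong_AE[OF _ _ eq]) (use g weak_grad_loc_integrable loc_integrable_measurable[OF \<Omega>] in blast)+

lemma energy_zero: "energy p \<Omega> (\<lambda>_. 0) = 0"
  by (simp add: energy_def)

lemma energy_scaleR: "energy p \<Omega> (\<lambda>x. k *\<^sub>R g x) = \<bar>k\<bar> powr p * energy p \<Omega> g"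
  by (simp add: energy_def powr_mult)

text \<open>Membership provides some weak gradient in \<open>L^p\<close>; uniqueness almost
  everywhere transfers its integrability to the given one.\<close>

lemma Xqp_weak_grad_Lp:
  assumes \<Omega>: "open \<Omega>" and v: "v \<in> Xqp q p \<Omega>" and g: "weak_grad \<Omega> v g"
  shows "integrable (lebesgue_on \<Omega>) (\<lambda>x. norm (g x) powr p)"
proof -
  obtain g' where g': "weak_grad \<Omega> v g'" "Lp_vec p \<Omega> g'" using v by (auto simp: Xqp_def)
  have gm[measurable]: "g \<in> borel_measurable (lebesgue_on \<Omega>)" "g' \<in> borel_measurable (lebesgue_on \<Omega>)"
    using g g'(1) weak_grad_loc_integrable loc_integrable_measurable[OF \<Omega>] by blast+
  have "AE x in lebesgue_on \<Omega>. g x = g' x"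
    by (rule weak_grad_unique[OF \<Omega> g g'(1)]) simp
  then have "AE x in lebesgue_on \<Omega>. norm (g x) powr p = norm (g' x) powr p"
    by eventually_elim simp
  moreover have "integrable (lebesgue_on \<Omega>) (\<lambda>x. norm (g' x) powr p)"
    using g'(2) by (simp add: Lp_vec_def)
  ultimately show ?thesis
    by (subst integrable_cong_AE[where g = "\<lambda>x. norm (g' x) powr p"]) auto
qed

lemma interp_le_max:
  assumes "1 \<le> r" "0 \<le> t" "t \<le> 1" "0 \<le> v x" "0 \<le> w x"
  shows "0 \<le> interp r v w t x" "interp r v w t x \<le> max (v x) (w x)"
proof -
  let ?m = "max (v x) (w x)"
  show "0 \<le> interp r v w t x" by (simp add: interp_def)
  have "(1 - t) * v x powr r + t * w x powr r \<le> (1 - t) * ?m powr r + t * ?m powr r"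
    using assms by (intro add_mono mult_left_mono powr_mono2) auto
  also have "\<dots> = ?m powr r" by (simp add: algebra_simps)
  finally have "interp r v w t x \<le> (?m powr r) powr (1 / r)"
    unfolding interp_def using assms by (intro powr_mono2) auto
  also have "\<dots> = ?m" using assms by (simp add: powr_powr)
  finally show "interp r v w t x \<le> ?m" .
qed

lemma Lp_real_interp:
  assumes \<Omega>: "open \<Omega>" and v: "Lp_real q \<Omega> v" and w: "Lp_real q \<Omega> w"
    and "1 \<le> q" "1 \<le> r" "0 \<le> t" "t \<le> 1"
    and nonneg: "\<forall>x\<in>\<Omega>. 0 \<le> v x" "\<forall>x\<in>\<Omega>. 0 \<le> w x"
  shows "Lp_real q \<Omega> (interp r v w t)"
proof -
  note nonneg = nonneg[rule_format]
  have m[measurable]: "v \<in> borel_measurable (lebesgue_on \<Omega>)" "w \<in> borel_measurable (lebesgue_on \<Omega>)"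
    using v w by (auto simp: Lp_real_def)
  have im[measurable]: "interp r v w t \<in> borel_measurable (lebesgue_on \<Omega>)"
    unfolding interp_def by measurable
  have "integrable (lebesgue_on \<Omega>) (\<lambda>x. \<bar>interp r v w t x\<bar> powr q)"
  proof (rule Bochner_Integration.integrable_bound)
    show "integrable (lebesgue_on \<Omega>) (\<lambda>x. \<bar>v x\<bar> powr q + \<bar>w x\<bar> powr q)"
      using v w by (simp add: Lp_real_def)
    show "AE x in lebesgue_on \<Omega>. norm (\<bar>interp r v w t x\<bar> powr q) \<le> norm (\<bar>v x\<bar> powr q + \<bar>w x\<bar> powr q)"
    proof (rule AE_I2)
      fix x assume "x \<in> space (lebesgue_on \<Omega>)"
      then have n: "0 \<le> v x" "0 \<le> w x" using nonneg by auto
      note i = interp_le_max[where v = v and w = w and x = x, OF assms(5-7) n]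
      have "interp r v w t x powr q \<le> max (v x) (w x) powr q"
        using i assms(4) by (intro powr_mono2) auto
      also have "\<dots> \<le> v x powr q + w x powr q" by (simp add: max_def)
      finally show "norm (\<bar>interp r v w t x\<bar> powr q) \<le> norm (\<bar>v x\<bar> powr q + \<bar>w x\<bar> powr q)"
        using i n by simp
    qed
  qed measurable
  then show ?thesis using im by (simp add: Lp_real_def)
qed

lemma weak_grad_interp_1:
  assumes \<Omega>: "open \<Omega>" and v: "weak_grad \<Omega> v a" and w: "weak_grad \<Omega> w b"
    and nonneg: "\<forall>x\<in>\<Omega>. 0 \<le> v x" "\<forall>x\<in>\<Omega>. 0 \<le> w x" and t: "0 \<le> t" "t \<le> 1"
  shows "weak_grad \<Omega> (interp 1 v w t) (\<lambda>x. (1 - t) *\<^sub>R a x + t *\<^sub>R b x)"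
proof (rule weak_grad_cong_AE[OF \<Omega> weak_grad_lincomb[OF \<Omega> v w]])
  note nonneg = nonneg[rule_format]
  have m[measurable]: "v \<in> borel_measurable (lebesgue_on \<Omega>)" "w \<in> borel_measurable (lebesgue_on \<Omega>)"
    using v w weak_grad_loc_integrable loc_integrable_measurable[OF \<Omega>] by blast+
  show "interp 1 v w t \<in> borel_measurable (lebesgue_on \<Omega>)" unfolding interp_def by measurable
  show "AE x in lebesgue_on \<Omega>. interp 1 v w t x = (1 - t) * v x + t * w x"
    using nonneg t by (intro AE_I2) (auto simp: interp_def)
qed

lemma integral_AE_eq:
  fixes f g :: "'a \<Rightarrow> real"
  assumes "integrable M f" "integrable M g" "\<And>x. x \<in> space M \<Longrightarrow> f x \<le> g x" "(\<integral>x. f x \<partial>M) = (\<integral>x. g x \<partial>M)"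
  shows "AE x in M. f x = g x"
proof -
  have "AE x in M. g x - f x = 0"
    using assms by (subst integral_nonneg_eq_0_iff_AE[symmetric]) (auto intro!: AE_I2)
  then show ?thesis by eventually_elim simp
qed

text \<open>Everything is read off the explicit weak gradient \<open>G\<close>. Its existence makes
  the universally quantified equality hypothesis of the last claim effective, and uniqueness carries
  the inequality to every other weak gradient.\<close>

lemma interp_energy:
  fixes \<Omega> :: "'a::euclidean_space set" and gv gw :: "'a \<Rightarrow> 'a"
  assumes "1 \<le> q" "1 < p" "1 \<le> r" "r \<le> min p q" and \<Omega>: "open \<Omega>"
    and v: "v \<in> Xqp q p \<Omega>" "weak_grad \<Omega> v gv" and w: "w \<in> Xqp q p \<Omega>" "weak_grad \<Omega> w gw"
    and nonneg: "\<forall>x\<in>\<Omega>. 0 \<le> v x" "\<forall>x\<in>\<Omega>. 0 \<le> w x" and t: "0 \<le> t" "t \<le> 1"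
  defines "E \<equiv> (1 - t) * energy p \<Omega> gv + t * energy p \<Omega> gw"
  shows "interp r v w t \<in> Xqp q p \<Omega>"
    and "\<And>g. weak_grad \<Omega> (interp r v w t) g \<Longrightarrow> energy p \<Omega> g \<le> E"
    and "0 < t \<Longrightarrow> t < 1 \<Longrightarrow> (\<And>g. weak_grad \<Omega> (interp r v w t) g \<Longrightarrow> energy p \<Omega> g = E) \<Longrightarrow>
      AE x in lebesgue_on \<Omega>. (r = 1 \<longrightarrow> gv x = gw x) \<and> (1 < r \<longrightarrow> 0 < v x \<longrightarrow> 0 < w x \<longrightarrow> gv x /\<^sub>R v x = gw x /\<^sub>R w x)
        \<and> (r < p \<longrightarrow> norm (gv x) = norm (gw x))"
proof -
  note nonneg' = nonneg and nonneg = nonneg[rule_format]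
  have rp: "r \<le> p" using assms(4) by simp
  \<comment> \<open>At \<open>r = 1\<close> the general formula would contain
    \<open>0 powr 0 = 0\<close> at zeros of \<open>v\<close> or \<open>w\<close> and lose a term
    there, so the linear combination is written out.\<close>
  define G where "G x = (if r = 1 then (1 - t) *\<^sub>R gv x + t *\<^sub>R gw x else interp_grad r t (v x) (w x) (gv x) (gw x))" for x
  have WG: "weak_grad \<Omega> (interp r v w t) G"
  proof (cases "r = 1")
    case True
    then have "G = (\<lambda>x. (1 - t) *\<^sub>R gv x + t *\<^sub>R gw x)" by (simp add: G_def fun_eq_iff)
    then show ?thesis using True weak_grad_interp_1[OF \<Omega> v(2) w(2) nonneg' t] by simp
  next
    case False
    then have "G = (\<lambda>x. interp_grad r t (v x) (w x) (gv x) (gw x))" by (simp add: G_def fun_eq_iff)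
    then show ?thesis using False assms(3) weak_grad_interp[OF \<Omega> v(2) w(2) _ t nonneg', of r] by simp
  qed
  have le: "norm (G x) powr p \<le> (1 - t) * norm (gv x) powr p + t * norm (gw x) powr p" if "x \<in> \<Omega>" for x
  proof (cases "r = 1")
    case True
    then show ?thesis using norm_powr_convex[of p t "gv x" "gw x"] assms(2) t by (simp add: G_def)
  next
    case False
    then have "1 < r" using assms(3) by simp
    from interp_grad_energy_le[OF this rp t nonneg(1)[OF that] nonneg(2)[OF that], of "gv x" "gw x"] False
    show ?thesis by (simp add: G_def)
  qed
  have Gm[measurable]: "G \<in> borel_measurable (lebesgue_on \<Omega>)"
    using WG weak_grad_loc_integrable loc_integrable_measurable[OF \<Omega>] by blast
  have iv: "integrable (lebesgue_on \<Omega>) (\<lambda>x. norm (gv x) powr p)" by (rule Xqp_weak_grad_Lp[OF \<Omega> v])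
  have iw: "integrable (lebesgue_on \<Omega>) (\<lambda>x. norm (gw x) powr p)" by (rule Xqp_weak_grad_Lp[OF \<Omega> w])
  have irhs: "integrable (lebesgue_on \<Omega>) (\<lambda>x. (1 - t) * norm (gv x) powr p + t * norm (gw x) powr p)"
    using iv iw by simp
  have E: "E = (\<integral>x. (1 - t) * norm (gv x) powr p + t * norm (gw x) powr p \<partial>lebesgue_on \<Omega>)"
    unfolding E_def energy_def using iv iw by simp
  have iG: "integrable (lebesgue_on \<Omega>) (\<lambda>x. norm (G x) powr p)"
  proof (rule Bochner_Integration.integrable_bound[OF irhs])
    show "AE x in lebesgue_on \<Omega>. norm (norm (G x) powr p) \<le> norm ((1 - t) * norm (gv x) powr p + t * norm (gw x) powr p)"
    proof (rule AE_I2)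
      fix x assume "x \<in> space (lebesgue_on \<Omega>)"
      then have "x \<in> \<Omega>" by simp
      from le[OF this] show "norm (norm (G x) powr p) \<le> norm ((1 - t) * norm (gv x) powr p + t * norm (gw x) powr p)"
        by simp
    qed
  qed measurable
  have "Lp_real q \<Omega> v" "Lp_real q \<Omega> w" using v w by (auto simp: Xqp_def)
  then have "Lp_real q \<Omega> (interp r v w t)"
    using Lp_real_interp[OF \<Omega> _ _ assms(1,3) t nonneg'] by blast
  moreover have "Lp_vec p \<Omega> G" using iG Gm by (simp add: Lp_vec_def)
  ultimately show "interp r v w t \<in> Xqp q p \<Omega>" using WG by (auto simp: Xqp_def)
  have "energy p \<Omega> G \<le> E"
    unfolding E unfolding energy_def using iG irhs le by (intro integral_mono) auto
  then show "energy p \<Omega> g \<le> E" if "weak_grad \<Omega> (interp r v w t) g" for g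
    using energy_weak_grad_cong_AE[OF \<Omega> that WG weak_grad_unique[OF \<Omega> that WG]] by simp
  assume t': "0 < t" "t < 1" and eq: "\<And>g. weak_grad \<Omega> (interp r v w t) g \<Longrightarrow> energy p \<Omega> g = E"
  have "AE x in lebesgue_on \<Omega>. norm (G x) powr p = (1 - t) * norm (gv x) powr p + t * norm (gw x) powr p"
    by (rule integral_AE_eq[OF iG irhs]) (use le eq[OF WG] E in \<open>auto simp: energy_def\<close>)
  moreover have "AE x in lebesgue_on \<Omega>. x \<in> \<Omega>" by (rule AE_I2) simp
  ultimately show "AE x in lebesgue_on \<Omega>. (r = 1 \<longrightarrow> gv x = gw x) \<and> (1 < r \<longrightarrow> 0 < v x \<longrightarrow> 0 < w x \<longrightarrow> gv x /\<^sub>R v x = gw x /\<^sub>R w x)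
        \<and> (r < p \<longrightarrow> norm (gv x) = norm (gw x))"
  proof eventually_elim
    case (elim x)
    show ?case
    proof (cases "r = 1")
      case True
      then have "gv x = gw x"
        using norm_powr_convex_eq[OF assms(2) t', of "gv x" "gw x"] elim(1) by (simp add: G_def)
      then show ?thesis using True by simp
    next
      case False
      then have r: "1 < r" using assms(3) by simp
      have "norm (interp_grad r t (v x) (w x) (gv x) (gw x)) powr p = (1 - t) * norm (gv x) powr p + t * norm (gw x) powr p"
        using elim(1) False by (simp add: G_def)
      note eqs = interp_grad_energy_eq[OF r rp t' nonneg(1)[OF elim(2)] nonneg(2)[OF elim(2)] this]
      show ?thesis using eqs False by blast
    qed
  qed
qed

theorem theorem2p9:
  fixes \<Omega> :: "'a::euclidean_space set"
    and v w :: "'a \<Rightarrow> real" and gv gw :: "'a \<Rightarrow> 'a" and p q r :: real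
  assumes "1 \<le> q" and "1 < p" and "1 \<le> r" and "r \<le> min p q"
    and "open \<Omega>"
    and "v \<in> Xqp q p \<Omega>" and "w \<in> Xqp q p \<Omega>"
    and "\<forall>x\<in>\<Omega>. 0 \<le> v x" and "\<forall>x\<in>\<Omega>. 0 \<le> w x"
    and "weak_grad \<Omega> v gv" and "weak_grad \<Omega> w gw"
  shows "(\<forall>t\<in>{0..1}. interp r v w t \<in> Xqp q p \<Omega> \<and>
            (\<forall>g. weak_grad \<Omega> (interp r v w t) g \<longrightarrow>
               energy p \<Omega> g \<le> (1 - t) * energy p \<Omega> gv + t * energy p \<Omega> gw))
    \<and> (connected \<Omega> \<longrightarrow>
        (r = 1 \<longrightarrow>
           ((\<exists>t\<in>{0<..<1}. \<forall>g. weak_grad \<Omega> (interp r v w t) g \<longrightarrow>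
               energy p \<Omega> g = (1 - t) * energy p \<Omega> gv + t * energy p \<Omega> gw)
            \<longleftrightarrow> (\<exists>C. AE x in lebesgue_on \<Omega>. v x = w x + C)))
      \<and> (1 < r \<and> r < p \<longrightarrow>
           ((\<exists>t\<in>{0<..<1}. \<forall>g. weak_grad \<Omega> (interp r v w t) g \<longrightarrow>
               energy p \<Omega> g = (1 - t) * energy p \<Omega> gv + t * energy p \<Omega> gw)
            \<longleftrightarrow> ((AE x in lebesgue_on \<Omega>. v x = w x) \<or>
                 ((\<exists>C. AE x in lebesgue_on \<Omega>. v x = C) \<and>
                  (\<exists>C. AE x in lebesgue_on \<Omega>. w x = C)))))
      \<and> (1 < r \<and> r = p \<and> inv_Linf_loc \<Omega> v \<and> inv_Linf_loc \<Omega> w \<longrightarrow>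
           ((\<exists>t\<in>{0<..<1}. \<forall>g. weak_grad \<Omega> (interp r v w t) g \<longrightarrow>
               energy p \<Omega> g = (1 - t) * energy p \<Omega> gv + t * energy p \<Omega> gw)
            \<longleftrightarrow> (\<exists>C>0. AE x in lebesgue_on \<Omega>. v x = C * w x))))"
proof -
  note \<Omega> = \<open>open \<Omega>\<close> and WV = \<open>weak_grad \<Omega> v gv\<close> and WW = \<open>weak_grad \<Omega> w gw\<close>
  note nonneg = \<open>\<forall>x\<in>\<Omega>. 0 \<le> v x\<close> \<open>\<forall>x\<in>\<Omega>. 0 \<le> w x\<close>
  have in\<Omega>: "AE x in lebesgue_on \<Omega>. x \<in> \<Omega>" by (rule AE_I2) simp
  note main = interp_energy[OF assms(1-4) \<Omega> assms(6) WV assms(7) WW nonneg]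
  let ?E = "\<lambda>t. (1 - t) * energy p \<Omega> gv + t * energy p \<Omega> gw"
  let ?eq = "\<exists>t\<in>{0<..<1}. \<forall>g. weak_grad \<Omega> (interp r v w t) g \<longrightarrow> energy p \<Omega> g = ?E t"
  have eqD: "AE x in lebesgue_on \<Omega>. (r = 1 \<longrightarrow> gv x = gw x) \<and> (1 < r \<longrightarrow> 0 < v x \<longrightarrow> 0 < w x \<longrightarrow> gv x /\<^sub>R v x = gw x /\<^sub>R w x)
        \<and> (r < p \<longrightarrow> norm (gv x) = norm (gw x))" if ?eq
  proof -
    obtain t where t: "0 < t" "t < 1" "\<And>g. weak_grad \<Omega> (interp r v w t) g \<Longrightarrow> energy p \<Omega> g = ?E t"
      using \<open>?eq\<close> by auto
    show ?thesis by (rule main(3)[OF less_imp_le[OF t(1)] less_imp_le[OF t(2)] t])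
  qed
  \<comment> \<open>The converse implications need equality for one parameter only, and the midpoint
    is used. The interpolation may be replaced by a simpler function \<psi>' that equals it almost
    everywhere and has a known weak gradient.\<close>
  have eqI: ?eq if "\<psi> = interp r v w (1 / 2)" "weak_grad \<Omega> \<psi>' g'" "AE x in lebesgue_on \<Omega>. \<psi> x = \<psi>' x" "energy p \<Omega> g' = ?E (1 / 2)" for \<psi> \<psi>' g'
  proof (intro bexI[of _ "1 / 2"] allI impI)
    fix g assume g: "weak_grad \<Omega> (interp r v w (1 / 2)) g"
    have "AE x in lebesgue_on \<Omega>. g x = g' x"
      by (rule weak_grad_unique[OF \<Omega> g that(2)]) (use that in simp)
    then show "energy p \<Omega> g = ?E (1 / 2)"
      using energy_weak_grad_cong_AE[OF \<Omega> g that(2)] that(4) by simp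
  qed simp
  have self: "interp r u u t x = u x" if "0 \<le> u x" for u :: "'a \<Rightarrow> real" and t x
  proof -
    have "(1 - t) * u x powr r + t * u x powr r = u x powr r" by (simp add: algebra_simps)
    then show ?thesis using that \<open>1 \<le> r\<close> by (simp add: interp_def powr_powr)
  qed
  have part1: "\<forall>t\<in>{0..1}. interp r v w t \<in> Xqp q p \<Omega> \<and> (\<forall>g. weak_grad \<Omega> (interp r v w t) g \<longrightarrow> energy p \<Omega> g \<le> ?E t)"
  proof (intro ballI conjI allI impI)
    fix t :: real assume "t \<in> {0..1}"
    then have t: "0 \<le> t" "t \<le> 1" by auto
    show "interp r v w t \<in> Xqp q p \<Omega>" by (rule main(1)[OF t])
    show "energy p \<Omega> g \<le> ?E t" if "weak_grad \<Omega> (interp r v w t) g" for g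
      by (rule main(2)[OF t that])
  qed
  have part_a: "?eq \<longleftrightarrow> (\<exists>C. AE x in lebesgue_on \<Omega>. v x = w x + C)" if conn: "connected \<Omega>" and r: "r = 1"
  proof
    assume ?eq
    then have "AE x in lebesgue_on \<Omega>. gv x = gw x" using eqD r by (auto elim: eventually_mono)
    from weak_grad_eq_imp_const_diff[OF \<Omega> conn WV WW this]
    show "\<exists>C. AE x in lebesgue_on \<Omega>. v x = w x + C" by blast
  next
    assume "\<exists>C. AE x in lebesgue_on \<Omega>. v x = w x + C"
    then obtain C where C: "AE x in lebesgue_on \<Omega>. v x = w x + C" by blast
    have "AE x in lebesgue_on \<Omega>. v x = 1 * w x + 1 * C" using C by simp
    from weak_grad_unique[OF \<Omega> WV weak_grad_lincomb[OF \<Omega> WW weak_grad_const[OF \<Omega>]] this]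
    have g: "AE x in lebesgue_on \<Omega>. gv x = gw x" by simp
    note W = weak_grad_interp_1[OF \<Omega> WV WW nonneg, of "1 / 2"]
    have "AE x in lebesgue_on \<Omega>. (1 - 1 / 2) *\<^sub>R gv x + (1 / 2) *\<^sub>R gw x = gv x"
      using g by eventually_elim (simp add: scaleR_add_left[symmetric])
    then have "energy p \<Omega> (\<lambda>x. (1 - 1 / 2) *\<^sub>R gv x + (1 / 2) *\<^sub>R gw x) = energy p \<Omega> gv"
      using energy_weak_grad_cong_AE[OF \<Omega> W WV] by simp
    moreover have "energy p \<Omega> gv = energy p \<Omega> gw"
      by (rule energy_weak_grad_cong_AE[OF \<Omega> WV WW g])
    ultimately show ?eq
      using eqI[OF refl W] r by simp
  qed
  have part_b: "?eq \<longleftrightarrow> ((AE x in lebesgue_on \<Omega>. v x = w x) \<or>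
       ((\<exists>C. AE x in lebesgue_on \<Omega>. v x = C) \<and> (\<exists>C. AE x in lebesgue_on \<Omega>. w x = C)))"
    if conn: "connected \<Omega>" and r: "1 < r" "r < p"
  proof
    assume ?eq
    have "AE x in lebesgue_on \<Omega>. 1 * v x + (- 1) * w x = 0 \<longrightarrow> 1 *\<^sub>R gv x + (- 1) *\<^sub>R gw x = 0"
      by (rule weak_grad_on_zero_set[OF \<Omega> weak_grad_lincomb[OF \<Omega> WV WW]])
    with eqD[OF \<open>?eq\<close>] weak_grad_on_zero_set[OF \<Omega> WV] weak_grad_on_zero_set[OF \<Omega> WW] in\<Omega>
    \<comment> \<open>If one function vanishes, so does its gradient, and equal norms take care of
      the other. If both are positive, equal norms and equal logarithmic gradients give
      \<open>norm (gv x) / v x = norm (gv x) / w x\<close>, hence \<open>v x = w x\<close> or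
      \<open>gv x = 0\<close>. Where \<open>v x = w x\<close>, the gradient of the difference
      vanishes.\<close>
    have dich: "AE x in lebesgue_on \<Omega>. gv x = gw x \<and> (v x \<noteq> w x \<longrightarrow> gv x = 0 \<and> gw x = 0)"
    proof eventually_elim
      case (elim x)
      have n: "norm (gv x) = norm (gw x)" using elim(1) r by blast
      show ?case
      proof (cases "v x = 0 \<or> w x = 0")
        case True
        then have "gv x = 0 \<or> gw x = 0" using elim(2,3) by blast
        then show ?thesis using n by auto
      next
        case False
        then have pos: "0 < v x" "0 < w x" using nonneg elim(4) by auto
        have q: "gv x /\<^sub>R v x = gw x /\<^sub>R w x" using elim(1) r pos by blast
        have "norm (gv x /\<^sub>R v x) = norm (gw x /\<^sub>R w x)" by (rule arg_cong[OF q])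
        then have "norm (gv x) / v x = norm (gw x) / w x"
          using pos by (simp add: divide_inverse mult.commute)
        then have "v x = w x \<or> gv x = 0" using n pos by (auto simp: frac_eq_eq)
        then show ?thesis using n elim(5) by auto
      qed
    qed
    then have "AE x in lebesgue_on \<Omega>. gv x = gw x" by eventually_elim simp
    from weak_grad_eq_imp_const_diff[OF \<Omega> conn WV WW this]
    obtain C where C: "AE x in lebesgue_on \<Omega>. v x = w x + C" .
    show "(AE x in lebesgue_on \<Omega>. v x = w x) \<or>
       ((\<exists>C. AE x in lebesgue_on \<Omega>. v x = C) \<and> (\<exists>C. AE x in lebesgue_on \<Omega>. w x = C))"
    proof (cases "C = 0")
      case True
      then show ?thesis using C by simp
    next
      case False
      have z: "AE x in lebesgue_on \<Omega>. gv x = 0 \<and> gw x = 0"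
        using C dich by eventually_elim (use False in auto)
      have zv: "AE x in lebesgue_on \<Omega>. gv x = 0" using z by eventually_elim simp
      have zw: "AE x in lebesgue_on \<Omega>. gw x = 0" using z by eventually_elim simp
      obtain c where "AE x in lebesgue_on \<Omega>. v x = c" by (rule weak_grad_zero_imp_const[OF \<Omega> conn WV zv])
      moreover obtain c' where "AE x in lebesgue_on \<Omega>. w x = c'" by (rule weak_grad_zero_imp_const[OF \<Omega> conn WW zw])
      ultimately show ?thesis by blast
    qed
  next
    assume "(AE x in lebesgue_on \<Omega>. v x = w x) \<or>
       ((\<exists>C. AE x in lebesgue_on \<Omega>. v x = C) \<and> (\<exists>C. AE x in lebesgue_on \<Omega>. w x = C))"
    then show ?eq
    proof (elim disjE conjE exE)
      assume eq: "AE x in lebesgue_on \<Omega>. v x = w x"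
      have "AE x in lebesgue_on \<Omega>. interp r v w (1 / 2) x = v x"
        using eq in\<Omega>
      proof eventually_elim
        case (elim x)
        then have "interp r v w (1 / 2) x = interp r v v (1 / 2) x" by (simp add: interp_def)
        then show ?case using self[of v x] nonneg(1) elim(2) by simp
      qed
      moreover have "energy p \<Omega> gv = energy p \<Omega> gw"
        by (rule energy_weak_grad_cong_AE[OF \<Omega> WV WW weak_grad_unique[OF \<Omega> WV WW eq]])
      ultimately show ?eq using eqI[OF refl WV] by simp
    next
      fix c c' assume c: "AE x in lebesgue_on \<Omega>. v x = c" "AE x in lebesgue_on \<Omega>. w x = c'"
      \<comment> \<open>The interpolation of two constant functions does not depend on the point, so
        \<open>undefined\<close> merely stands for some argument.\<close>
      have "AE x in lebesgue_on \<Omega>. interp r v w (1 / 2) x = interp r (\<lambda>_. c) (\<lambda>_. c') (1 / 2) undefined"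
        using c by eventually_elim (simp add: interp_def)
      moreover have "energy p \<Omega> gv = 0"
        using energy_weak_grad_cong_AE[OF \<Omega> WV weak_grad_const[OF \<Omega>] weak_grad_unique[OF \<Omega> WV weak_grad_const[OF \<Omega>] c(1)]]
        by (simp add: energy_zero)
      moreover have "energy p \<Omega> gw = 0"
        using energy_weak_grad_cong_AE[OF \<Omega> WW weak_grad_const[OF \<Omega>] weak_grad_unique[OF \<Omega> WW weak_grad_const[OF \<Omega>] c(2)]]
        by (simp add: energy_zero)
      ultimately show ?eq using eqI[OF refl weak_grad_const[OF \<Omega>]] by (simp add: energy_zero)
    qed
  qed
  have part_c: "?eq \<longleftrightarrow> (\<exists>C>0. AE x in lebesgue_on \<Omega>. v x = C * w x)"
    if conn: "connected \<Omega>" and r: "1 < r" "r = p" and inv: "inv_Linf_loc \<Omega> v" "inv_Linf_loc \<Omega> w"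
  proof
    assume ?eq
    have pos: "AE x in lebesgue_on \<Omega>. 0 < v x" "AE x in lebesgue_on \<Omega>. 0 < w x"
      using inv_Linf_loc_AE_pos[OF \<Omega>] inv nonneg by auto
    have "AE x in lebesgue_on \<Omega>. gv x /\<^sub>R v x = gw x /\<^sub>R w x"
      using eqD[OF \<open>?eq\<close>] pos by eventually_elim (use r in blast)
    from weak_grad_eq_imp_const_diff[OF \<Omega> conn weak_grad_ln[OF \<Omega> WV inv(1) nonneg(1)] weak_grad_ln[OF \<Omega> WW inv(2) nonneg(2)] this]
    obtain c where c: "AE x in lebesgue_on \<Omega>. ln (v x) = ln (w x) + c" .
    have "AE x in lebesgue_on \<Omega>. v x = exp c * w x"
      using c pos
    proof eventually_elim
      case (elim x)
      have "v x = exp (ln (w x) + c)" using elim(1,2) exp_ln[of "v x"] by simp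
      also have "\<dots> = exp c * w x" using elim(3) by (simp add: exp_add)
      finally show ?case .
    qed
    then show "\<exists>C>0. AE x in lebesgue_on \<Omega>. v x = C * w x" by (intro exI[of _ "exp c"]) simp
  next
    assume "\<exists>C>0. AE x in lebesgue_on \<Omega>. v x = C * w x"
    then obtain C where C: "0 < C" "AE x in lebesgue_on \<Omega>. v x = C * w x" by blast
    \<comment> \<open>Interpolating \<open>C * w\<close> and \<open>w\<close> at the midpoint gives
      \<open>K powr (1 / r) * w\<close>. As \<open>r = p\<close>, its energy is \<open>K\<close>
      times that of \<open>w\<close>, which is also the average of the energies of
      \<open>C * w\<close> and \<open>w\<close>.\<close>
    define K where "K = (1 / 2) * C powr r + 1 / 2"
    have K: "0 < K" by (simp add: K_def add_nonneg_pos)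
    have W: "weak_grad \<Omega> (\<lambda>x. k * w x) (\<lambda>x. k *\<^sub>R gw x)" for k
      using weak_grad_lincomb[OF \<Omega> WW WW, of k 0] by simp
    have gC: "AE x in lebesgue_on \<Omega>. gv x = C *\<^sub>R gw x"
      by (rule weak_grad_unique[OF \<Omega> WV W C(2)])
    have "energy p \<Omega> gv = C powr p * energy p \<Omega> gw"
      using energy_weak_grad_cong_AE[OF \<Omega> WV W gC] C(1) by (simp add: energy_scaleR)
    moreover have "energy p \<Omega> (\<lambda>x. (K powr (1 / r)) *\<^sub>R gw x) = K * energy p \<Omega> gw"
      using K r by (simp add: energy_scaleR powr_powr)
    moreover have "AE x in lebesgue_on \<Omega>. interp r v w (1 / 2) x = K powr (1 / r) * w x"
      using C(2) in\<Omega>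
    proof eventually_elim
      case (elim x)
      have w0: "0 \<le> w x" using nonneg(2) elim(2) by blast
      have "(1 - 1 / 2) * v x powr r + 1 / 2 * w x powr r = K * w x powr r"
        using C(1) w0 by (simp add: elim(1) powr_mult K_def algebra_simps)
      then show ?case using K w0 r by (simp add: interp_def powr_mult powr_powr)
    qed
    ultimately show ?eq
      using eqI[OF refl W[of "K powr (1 / r)"]] r by (simp add: K_def algebra_simps)
  qed
  show ?thesis using part1 part_a part_b part_c by blast
qed

end
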